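(* Let $d=3$ and let $u_0\in\mathbb{H}^1_{\Sigma 0}(\mathbb{T}^3)$ be such that $$\|u_0\|_1\le 0.407 .$$ Then the (maximal) solution $u$ of the Navier-Stokes initial value problem in mild form $$u(t)=e^{t\Delta}u_0-\int_0^t ds\, e^{(t-s)\Delta}\,\mathfrak{L}\big(u(s)\cdot\partial u(s)\big),\qquad u\in C([0,T),\mathbb{H}^1_{\Sigma 0}(\mathbb{T}^3)),$$ is global, i.e. it has domain $[0,+\infty)$. Furthermore, for all $t\in[0,+\infty)$, $$\|u(t)\|_1\le \mathcal{X}\Big(\frac{\|u_0\|_1}{0.407}\Big)\,e^{-t}\,\|u_0\|_1\le 2\,e^{-t}\,\|u_0\|_1 ,$$ where $\mathcal{X}\in C([0,1],[1,2])$ is the increasing function defined by $\mathcal{X}(z):=\dfrac{1-\sqrt{1-z}}{z/2}$ for $z\in(0,1]$ and $\mathcal{X}(0):=1$.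
   Context: Here $d=3$. $\mathbb{T}^d:=(\mathbb{R}/2\pi\mathbb{Z})^d$, $\mathbb{Z}^d_0:=\mathbb{Z}^d\setminus\{0\}$, and $e_k(x):=(2\pi)^{-d/2}e^{ik\cdot x}$ for $k\in\mathbb{Z}^d$. A vector field is a $d$-tuple $v=(v^1,\dots,v^d)$ of real (periodic) distributions on $\mathbb{T}^d$; its Fourier coefficients are $v_k=(\langle v^r,e_{-k}\rangle)_{r=1,\dots,d}\in\mathbb{C}^d$, so that $v=\sum_{k\in\mathbb{Z}^d}v_ke_k$ and $\overline{v_k}=v_{-k}$. For $c\in\mathbb{C}^d$, $|c|$ is the standard Hermitian norm, and $a\cdot b=\sum_r a^rb^r$. For $n\in\mathbb{R}$, $\mathbb{H}^n_0(\mathbb{T}^d)$ is the space of vector fields $v$ with zero mean ($v_0=0$) and $\sum_{k\in\mathbb{Z}^d_0}|k|^{2n}|v_k|^2<+\infty$, with the Hilbert norm $\|v\|_n:=\big(\sum_{k\in\mathbb{Z}^d_0}|k|^{2n}|v_k|^2\big)^{1/2}$. $\mathbb{H}^n_{\Sigma 0}(\mathbb{T}^d)$ is its closed subspace of divergence free elements ($k\cdot v_k=0$ for all $k$), with the same norm. $e^{t\Delta}v:=\sum_{k\in\mathbb{Z}^d}e^{-t|k|^2}v_ke_k$ for $t\ge0$. The Leray projection is $\mathfrak{L}v:=\sum_{k\in\mathbb{Z}^d}(\mathfrak{L}_kv_k)e_k$, with $\mathfrak{L}_0c=c$ and $\mathfrak{L}_kc=c-\frac{k\cdot c}{|k|^2}k$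 for $k\ne0$. $v\cdot\partial w$ is the vector field with components $(v\cdot\partial w)^r=\sum_{s=1}^dv^s\partial_sw^r$. A solution of the initial value problem is a function $u\in C([0,T),\mathbb{H}^1_{\Sigma 0})$, $T\in(0,+\infty]$, satisfying the integral equation for all $t\in[0,T)$; it is known that there is a unique maximal solution (one that cannot be extended) and every other solution is a restriction of it. A solution is global if its domain is $[0,+\infty)$. *)

theory Defs
  imports "HOL-Analysis.Analysis"
begin

text \<open>Functions on the torus are \<open>2\<pi>\<close>-periodic functions on \<open>\<real>\<^sup>3\<close>; integrals over the torus are
  Lebesgue integrals over the period cell.\<close>

definition period_cell :: "(real^3) set" where
  "period_cell = cbox 0 (\<chi> r. 2 * pi)"

definition periodic :: "(real^3 \<Rightarrow> complex) \<Rightarrow> bool" where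
  "periodic f \<longleftrightarrow> (\<forall>x r. f (x + (2 * pi) *\<^sub>R axis r 1) = f x)"

definition partial :: "3 \<Rightarrow> (real^3 \<Rightarrow> complex) \<Rightarrow> real^3 \<Rightarrow> complex" where
  "partial r f x = frechet_derivative f (at x) (axis r 1)"

definition smooth :: "(real^3 \<Rightarrow> complex) \<Rightarrow> bool" where
  "smooth f \<longleftrightarrow> (\<forall>rs x. foldr partial rs f differentiable (at x))"

definition test_functions :: "(real^3 \<Rightarrow> complex) set" where
  "test_functions = {\<phi>. smooth \<phi> \<and> periodic \<phi>}"

definition C_norm :: "nat \<Rightarrow> (real^3 \<Rightarrow> complex) \<Rightarrow> real" where
  "C_norm m \<phi> = (\<Sum>rs | length rs \<le> m. SUP x. cmod (foldr partial rs \<phi> x))"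

text \<open>Periodic distributions are the continuous linear functionals on the test functions. They
  are extensional, so that HOL equality is equality of distributions.\<close>

type_synonym functional = "(real^3 \<Rightarrow> complex) \<Rightarrow> complex"

definition distributions :: "functional set" where
  "distributions = {T \<in> extensional test_functions.
     (\<forall>\<phi>\<in>test_functions. \<forall>\<psi>\<in>test_functions. T (\<lambda>x. \<phi> x + \<psi> x) = T \<phi> + T \<psi>) \<and>
     (\<forall>c. \<forall>\<phi>\<in>test_functions. T (\<lambda>x. c * \<phi> x) = c * T \<phi>) \<and>
     (\<exists>C m. \<forall>\<phi>\<in>test_functions. cmod (T \<phi>) \<le> C * C_norm m \<phi>)}"

definition real_distributions :: "functional set" where
  "real_distributions =
     {T \<in> distributions. \<forall>\<phi>\<in>test_functions. T (\<lambda>x. cnj (\<phi> x)) = cnj (T \<phi>)}"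

definition vector_fields :: "(functional^3) set" where
  "vector_fields = {v. \<forall>r. v $ r \<in> real_distributions}"

definition vf_diff :: "functional^3 \<Rightarrow> functional^3 \<Rightarrow> functional^3" where
  "vf_diff v w = (\<chi> r. (\<lambda>\<phi>\<in>test_functions. (v $ r) \<phi> - (w $ r) \<phi>))"

definition real_vec :: "int^3 \<Rightarrow> real^3" where
  "real_vec k = (\<chi> r. of_int (k $ r))"

definition complex_vec :: "int^3 \<Rightarrow> complex^3" where
  "complex_vec k = (\<chi> r. of_int (k $ r))"

text \<open>The bilinear product, without conjugation.\<close>

definition cdot :: "complex^3 \<Rightarrow> complex^3 \<Rightarrow> complex" where
  "cdot a b = (\<Sum>r\<in>UNIV. a $ r * b $ r)"

definition basis_fun :: "int^3 \<Rightarrow> real^3 \<Rightarrow> complex" where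
  "basis_fun k x =
     complex_of_real ((2 * pi) powr (- 3 / 2)) * exp (\<i> * complex_of_real (real_vec k \<bullet> x))"

definition fourier_coeff :: "functional^3 \<Rightarrow> int^3 \<Rightarrow> complex^3" where
  "fourier_coeff v k = (\<chi> r. (v $ r) (basis_fun (- k)))"

definition distribution_of :: "(real^3 \<Rightarrow> complex) \<Rightarrow> functional" where
  "distribution_of f = (\<lambda>\<phi>\<in>test_functions. LINT x:period_cell|lborel. f x * \<phi> x)"

text \<open>The sum \<open>\<Sum>\<^sub>k c\<^sub>k e\<^sub>k\<close> in the weak topology of distributions.\<close>

definition fourier_series :: "(int^3 \<Rightarrow> complex^3) \<Rightarrow> functional^3" where
  "fourier_series c =
     (\<chi> r. (\<lambda>\<phi>\<in>test_functions. \<Sum>\<^sub>\<infinity>k. c k $ r * distribution_of (basis_fun k) \<phi>))"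

definition sobolev :: "real \<Rightarrow> (functional^3) set" where
  "sobolev n = {v \<in> vector_fields. fourier_coeff v 0 = 0 \<and>
     (\<lambda>k. norm (real_vec k) powr (2 * n) * (norm (fourier_coeff v k))\<^sup>2) summable_on (UNIV - {0})}"

definition sobolev_norm :: "real \<Rightarrow> functional^3 \<Rightarrow> real" where
  "sobolev_norm n v =
     sqrt (\<Sum>\<^sub>\<infinity>k\<in>UNIV - {0}. norm (real_vec k) powr (2 * n) * (norm (fourier_coeff v k))\<^sup>2)"

definition sobolev_div_free :: "real \<Rightarrow> (functional^3) set" where
  "sobolev_div_free n = {v \<in> sobolev n. \<forall>k. cdot (complex_vec k) (fourier_coeff v k) = 0}"

definition heat :: "real \<Rightarrow> functional^3 \<Rightarrow> functional^3" where
  "heat t v = fourier_series (\<lambda>k. exp (- t * (norm (real_vec k))\<^sup>2) *\<^sub>R fourier_coeff v k)"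

definition leray_symbol :: "int^3 \<Rightarrow> complex^3 \<Rightarrow> complex^3" where
  "leray_symbol k c =
     (if k = 0 then c
      else c - (cdot (complex_vec k) c / complex_of_real ((norm (real_vec k))\<^sup>2)) *s complex_vec k)"

definition leray :: "functional^3 \<Rightarrow> functional^3" where
  "leray v = fourier_series (\<lambda>k. leray_symbol k (fourier_coeff v k))"

definition distribution_deriv :: "3 \<Rightarrow> functional \<Rightarrow> functional" where
  "distribution_deriv s T = (\<lambda>\<phi>\<in>test_functions. - T (partial s \<phi>))"

definition square_integrable :: "(real^3 \<Rightarrow> complex) \<Rightarrow> bool" where
  "square_integrable f \<longleftrightarrow>
     f \<in> borel_measurable lborel \<and> set_integrable lborel period_cell (\<lambda>x. (cmod (f x))\<^sup>2)"

text \<open>The product of two distributions given by square integrable functions is the distribution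
  given by the (integrable) pointwise product. The choice of representatives is immaterial, since
  they are determined almost everywhere on the cell. For \<open>v, w\<close> in the Sobolev space of
  order 1, all \<open>v\<^sup>s\<close> and \<open>\<partial>\<^sub>s w\<^sup>r\<close> are of this kind.\<close>

definition L2_representative :: "functional \<Rightarrow> real^3 \<Rightarrow> complex" where
  "L2_representative T = (SOME f. square_integrable f \<and> distribution_of f = T)"

definition distribution_mult :: "functional \<Rightarrow> functional \<Rightarrow> functional" where
  "distribution_mult S T = distribution_of (\<lambda>x. L2_representative S x * L2_representative T x)"

definition advection :: "functional^3 \<Rightarrow> functional^3 \<Rightarrow> functional^3" where
  "advection v w = (\<chi> r. (\<lambda>\<phi>\<in>test_functions.
     \<Sum>s\<in>UNIV. distribution_mult (v $ s) (distribution_deriv s (w $ r)) \<phi>))"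

definition time_domain :: "ereal \<Rightarrow> real set" where
  "time_domain T = {t. 0 \<le> t \<and> ereal t < T}"

text \<open>The time integral is the weak integral of a distribution-valued function: it is tested
  against every test function, with integrability required.\<close>

definition mild_solution :: "functional^3 \<Rightarrow> ereal \<Rightarrow> (real \<Rightarrow> functional^3) \<Rightarrow> bool" where
  "mild_solution u0 T u \<longleftrightarrow>
     0 < T \<and>
     (\<forall>t\<in>time_domain T. u t \<in> sobolev_div_free 1) \<and>
     (\<forall>t\<in>time_domain T.
        ((\<lambda>t'. sobolev_norm 1 (vf_diff (u t') (u t))) \<longlongrightarrow> 0) (at t within time_domain T)) \<and>
     (\<forall>t\<in>time_domain T. \<forall>r. \<forall>\<phi>\<in>test_functions.
        set_integrable lborel {0..t} (\<lambda>s. (heat (t - s) (leray (advection (u s) (u s))) $ r) \<phi>) \<and>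
        (u t $ r) \<phi> = (heat t u0 $ r) \<phi>
          - (LINT s:{0..t}|lborel. (heat (t - s) (leray (advection (u s) (u s))) $ r) \<phi>))"

definition maximal_solution :: "functional^3 \<Rightarrow> ereal \<Rightarrow> (real \<Rightarrow> functional^3) \<Rightarrow> bool" where
  "maximal_solution u0 T u \<longleftrightarrow>
     mild_solution u0 T u \<and>
     \<not> (\<exists>T' u'. T < T' \<and> mild_solution u0 T' u' \<and> (\<forall>t\<in>time_domain T. u' t = u t))"

definition chi_fun :: "real \<Rightarrow> real" where
  "chi_fun z = (if z = 0 then 1 else (1 - sqrt (1 - z)) / (z / 2))"

end

theory Submission
  imports Defs "HOL-Probability.Distributions"
begin

text \<open>The Fourier coefficients of a mild solution satisfy the Duhamel equation mode by mode, the
\<open>H\<^sup>1\<close> norm is a weighted \<open>\<ell>\<^sup>2\<close> norm of the coefficients, and a vector field is determined by its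
coefficients. The solution is therefore constructed as a curve of coefficient families and
transferred to distributions at the end.

The core is one inequality, \<open>heat_bilin_estimate\<close>: the \<open>H\<^sup>1\<close> norm of
\<open>exp (t \<Delta>) \<LL> (a \<cdot> \<partial> b)\<close> is at most \<open>kernel t\<close> times the product of the \<open>H\<^sup>1\<close> norms of \<open>a\<close> and \<open>b\<close>.
The coefficient with index \<open>k\<close> is bounded by the sum over \<open>l\<close> of \<open>|a (k - l)| |l| |b l|\<close>; pairing with a
test sequence and using the Cauchy-Schwarz inequality, first in \<open>k\<close> for fixed \<open>l\<close> and then in \<open>l\<close>,
reduces the claim to a bound, uniform in \<open>l\<close>, for the sum over \<open>k\<close> of
\<open>|k|\<^sup>2 exp (- 2 t |k|\<^sup>2) / |k - l|\<^sup>2\<close>. The quotient \<open>1 / |k - l|\<^sup>2\<close> is an integral of Gaussians, so only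
Gaussian sums over the lattice are left, and such a sum exceeds the Gaussian integral by
at most a factor \<open>exp (a / 4)\<close>, since a Gaussian lies below a multiple of its average over a unit cube.
The result is a kernel that behaves like \<open>0.18 t\<close> to the power \<open>-3/4\<close> for small \<open>t\<close> and decays
like \<open>exp (- t)\<close>, because the frequencies have length at least \<open>1\<close>.

In the norm given by the supremum over \<open>t\<close> of \<open>exp t\<close> times the \<open>H\<^sup>1\<close> norm at time \<open>t\<close>, the Duhamel
term is then a bounded bilinear operation with constant at most the supremum over \<open>t\<close> of the integral of
\<open>kernel s * exp (2 * s - t)\<close> over \<open>s\<close> in \<open>[0, t]\<close>. This is at most \<open>250 / 407\<close>, which is
\<open>1 / (4 * 0.407)\<close> (\<open>kernel_weighted_integral\<close>). With \<open>N\<close> the norm of the initial datum, the Picard iterates and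
their increments are dominated by the scalar iteration \<open>x \<mapsto> N + 250 / 407 * x\<^sup>2\<close> and its increments.
For \<open>N \<le> 0.407\<close> this increases to a limit not exceeding the smaller fixed point, which is
\<open>N * chi_fun (N / 0.407)\<close>. Domination by a convergent scalar sequence gives convergence also in the
borderline case, where the iteration is no contraction (\<open>coeff_global_solution\<close>).

Two solutions on a compact interval agree because the singularity of the kernel is integrable: with
the weight \<open>exp (- \<lambda> t)\<close> for large \<open>\<lambda>\<close> the Duhamel difference halves every bound
(\<open>coeff_solution_unique\<close>). Hence each mild solution is a restriction of the global one, and a maximal
solution has the whole half-line as its domain.

The transfer rests on Fourier analysis on the torus. Integrals over the period cell are
invariant under translation, which yields orthogonality and integration by parts. The
Stone-Weierstrass theorem shows that an integrable function with vanishing coefficients vanishes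
almost everywhere. Test functions are the sums of their Fourier series with all derivatives, so
distributions are determined by their coefficients. Finally, square summable coefficients come from
square integrable functions, and products have the convolution of the coefficients
(\<open>fourier_coeff_advection\<close>).\<close>

section \<open>Gaussian sums over the lattice\<close>

lemma gaussian_integral:
  fixes a :: real assumes "a > 0"
  shows "integrable lborel (\<lambda>z. exp (- a * z\<^sup>2))" "(LINT z|lborel. exp (- a * z\<^sup>2)) = sqrt (pi / a)"
proof -
  define s where "s = sqrt (1 / (2 * a))"
  have s: "s > 0" "s\<^sup>2 = 1 / (2 * a)" using assms by (auto simp: s_def)
  have eq: "exp (- a * z\<^sup>2) = sqrt (pi / a) * normal_density 0 s z" for z
    using assms unfolding normal_density_def s(2) by (simp add: field_simps real_sqrt_divide)
  show "integrable lborel (\<lambda>z. exp (- a * z\<^sup>2))"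
    unfolding eq using s by (intro integrable_mult_right integrable_normal_density)
  show "(LINT z|lborel. exp (- a * z\<^sup>2)) = sqrt (pi / a)"
    unfolding eq using integral_normal_density[OF s(1)] by simp
qed

text \<open>Jensen's inequality for the convex exponential: the average of \<open>exp (- a * z\<^sup>2)\<close> over the unit interval
around \<open>y\<close> is at least \<open>exp\<close> of the average of \<open>- a * z\<^sup>2\<close>, and the average of \<open>z\<^sup>2\<close> is
\<open>y\<^sup>2 + 1 / 12\<close>.\<close>

lemma exp_le_cell_average:
  fixes a y :: real assumes "a > 0"
  shows "exp (- a * y\<^sup>2) \<le> exp (a / 12) * (LINT z|lborel. indicator {y - 1/2..<y + 1/2} z * exp (- a * z\<^sup>2))"
proof -
  let ?I = "{y - 1/2..y + 1/2}"
  let ?c = "exp (- a * (y\<^sup>2 + 1/12))"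
  let ?p = "\<lambda>z. ?c * (1 + a * (y\<^sup>2 + 1/12)) - (?c * a) * z\<^sup>2"
  let ?P = "\<lambda>z. ?c * (1 + a * (y\<^sup>2 + 1/12)) * z - (?c * a) * (z ^ 3 / 3)"
  have P: "(?p has_integral ?P (y + 1/2) - ?P (y - 1/2)) ?I"
    by (intro fundamental_theorem_of_calculus)
       (auto intro!: derivative_eq_intros simp: has_real_derivative_iff_has_vector_derivative[symmetric] power2_eq_square)
  have "C * (1 + a * (y\<^sup>2 + 1/12)) * (y + 1/2) - (C * a) * ((y + 1/2) ^ 3 / 3)
      - (C * (1 + a * (y\<^sup>2 + 1/12)) * (y - 1/2) - (C * a) * ((y - 1/2) ^ 3 / 3)) = C" for C :: real
    by (simp add: field_simps power2_eq_square power3_eq_cube)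
  then have "?P (y + 1/2) - ?P (y - 1/2) = ?c" .
  with P have P: "(?p has_integral ?c) ?I" by simp
  have ci: "(\<lambda>z. exp (- a * z\<^sup>2)) integrable_on ?I"
    by (intro integrable_continuous_interval continuous_intros)
  have "?c \<le> integral ?I (\<lambda>z. exp (- a * z\<^sup>2))"
  proof (rule has_integral_le[OF P integrable_integral[OF ci]])
    fix z assume "z \<in> ?I"
    have "1 + a * (y\<^sup>2 + 1/12 - z\<^sup>2) \<le> exp (a * (y\<^sup>2 + 1/12 - z\<^sup>2))" by (rule exp_ge_add_one_self)
    then have "?c * (1 + a * (y\<^sup>2 + 1/12 - z\<^sup>2)) \<le> ?c * exp (a * (y\<^sup>2 + 1/12 - z\<^sup>2))"
      by (intro mult_left_mono) auto
    also have "\<dots> = exp (- a * z\<^sup>2)" by (simp add: exp_add[symmetric] algebra_simps)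
    finally show "?p z \<le> exp (- a * z\<^sup>2)" by (simp add: algebra_simps)
  qed
  also have "integral ?I (\<lambda>z. exp (- a * z\<^sup>2)) = (LINT z:?I|lborel. exp (- a * z\<^sup>2))"
    by (intro set_borel_integral_eq_integral(2)[symmetric] borel_integrable_compact[unfolded set_integrable_def[symmetric]])
       (auto simp: set_integrable_def intro!: borel_integrable_compact continuous_intros)
  also have "\<dots> = (LINT z|lborel. indicator {y - 1/2..<y + 1/2} z * exp (- a * z\<^sup>2))"
    unfolding set_lebesgue_integral_def
  proof (rule integral_cong_AE)
    show "AE z in lborel. indicat_real ?I z *\<^sub>R exp (- a * z\<^sup>2) = indicat_real {y - 1/2..<y + 1/2} z * exp (- a * z\<^sup>2)"
      using AE_lborel_singleton[of "y + 1/2"] by eventually_elim (auto simp: indicator_def)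
  qed auto
  finally have "exp (a/12) * ?c \<le> exp (a/12) * (LINT z|lborel. indicator {y - 1/2..<y + 1/2} z * exp (- a * z\<^sup>2))"
    by (intro mult_left_mono) auto
  moreover have "exp (a/12) * ?c = exp (- a * y\<^sup>2)" by (simp add: exp_add[symmetric] algebra_simps)
  ultimately show ?thesis by linarith
qed

text \<open>The unit intervals around the points \<open>m - x\<close> are disjoint, so the averages of the previous lemma add
up to at most the full Gaussian integral, whatever the centre \<open>x\<close> is.\<close>

lemma gaussian_sum_int:
  fixes a x :: real assumes a: "a > 0" and F: "finite F"
  shows "(\<Sum>m\<in>F. exp (- a * (of_int m - x)\<^sup>2)) \<le> exp (a / 12) * sqrt (pi / a)"
proof -
  let ?g = "\<lambda>z::real. exp (- a * z\<^sup>2)"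
  let ?i = "\<lambda>m z. indicat_real {of_int m - x - 1/2..<of_int m - x + 1/2} z"
  have int: "integrable lborel (\<lambda>z. ?i m z * ?g z)" for m :: int
    using integrable_mult_indicator[OF _ gaussian_integral(1)[OF a], of "{of_int m - x - 1/2..<of_int m - x + 1/2}"]
    by simp
  have disj: "(\<Sum>m\<in>F. ?i m z) \<le> 1" for z
  proof -
    have "?i m z = 0" if "m \<noteq> \<lfloor>z + x + 1/2\<rfloor>" for m
      using that by (auto simp: indicator_def) linarith
    then have "(\<Sum>m\<in>F. ?i m z) = (\<Sum>m\<in>F \<inter> {\<lfloor>z + x + 1/2\<rfloor>}. ?i m z)"
      using F by (intro sum.mono_neutral_right) auto
    also have "\<dots> \<le> (\<Sum>m\<in>{\<lfloor>z + x + 1/2\<rfloor>}. ?i m z)"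
      by (rule sum_mono2) auto
    also have "\<dots> \<le> 1" by (subst sum.insert) (auto simp: indicator_def)
    finally show ?thesis .
  qed
  have "(\<Sum>m\<in>F. ?g (of_int m - x)) \<le> (\<Sum>m\<in>F. exp (a / 12) * (LINT z|lborel. ?i m z * ?g z))"
    by (intro sum_mono exp_le_cell_average[OF a])
  also have "\<dots> = exp (a / 12) * (LINT z|lborel. (\<Sum>m\<in>F. ?i m z * ?g z))"
    using int by (simp add: sum_distrib_left Bochner_Integration.integral_sum)
  also have "\<dots> \<le> exp (a / 12) * (LINT z|lborel. ?g z)"
  proof (intro mult_left_mono integral_mono gaussian_integral(1)[OF a] Bochner_Integration.integrable_sum int)
    fix z show "(\<Sum>m\<in>F. ?i m z * ?g z) \<le> ?g z"
      using mult_right_mono[OF disj[of z], of "?g z"] by (simp add: sum_distrib_right)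
  qed auto
  finally show ?thesis using gaussian_integral(2)[OF a] by simp
qed

lemma norm_vec3_power2: "(norm (x :: real^'n))\<^sup>2 = (\<Sum>r\<in>UNIV. (x $ r)\<^sup>2)"
  by (simp add: power2_norm_eq_inner inner_vec_def) (simp add: power2_eq_square)

text \<open>A finite subset of \<open>\<int>\<^sup>3\<close> lies in a box, and over a box the sum of a product factors.\<close>

lemma sum_prod_vec_le:
  fixes f :: "3 \<Rightarrow> int \<Rightarrow> real"
  assumes F: "finite F" and f: "\<And>r m. f r m \<ge> 0"
    and B: "\<And>r G. finite G \<Longrightarrow> (\<Sum>m\<in>G. f r m) \<le> b r"
  shows "(\<Sum>k\<in>F. \<Prod>r\<in>UNIV. f r (k $ r)) \<le> (\<Prod>r\<in>UNIV. b r)"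
proof -
  define G where "G r = (\<lambda>k :: int^3. k $ r) ` F" for r
  have fG: "finite (G r)" for r using F by (simp add: G_def)
  have "(\<Sum>k\<in>F. \<Prod>r\<in>UNIV. f r (k $ r)) = (\<Sum>g\<in>vec_nth ` F. \<Prod>r\<in>UNIV. f r (g r))"
    by (subst sum.reindex) (auto simp: inj_on_def vec_eq_iff)
  also have "\<dots> \<le> (\<Sum>g\<in>PiE UNIV G. \<Prod>r\<in>UNIV. f r (g r))"
    by (rule sum_mono2) (auto simp: G_def fG F f intro!: finite_PiE prod_nonneg)
  also have "\<dots> = (\<Prod>r\<in>UNIV. \<Sum>m\<in>G r. f r m)"
    by (rule prod_sum_PiE[symmetric]) (auto simp: fG)
  also have "\<dots> \<le> (\<Prod>r\<in>UNIV. b r)"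
    by (intro prod_mono) (auto intro!: sum_nonneg f B fG)
  finally show ?thesis .
qed

lemma gaussian_sum_lattice:
  fixes a :: real and x :: "real^3" assumes a: "a > 0" and F: "finite F"
  shows "(\<Sum>k\<in>F. exp (- a * (norm (real_vec k - x))\<^sup>2)) \<le> (exp (a / 12) * sqrt (pi / a)) ^ 3"
proof -
  have "(\<Sum>k\<in>F. exp (- a * (norm (real_vec k - x))\<^sup>2)) = (\<Sum>k\<in>F. \<Prod>r\<in>UNIV. exp (- a * (of_int (k $ r) - x $ r)\<^sup>2))"
    by (simp add: norm_vec3_power2 real_vec_def exp_sum[symmetric] sum_distrib_left)
  also have "\<dots> \<le> (\<Prod>r\<in>(UNIV::3 set). exp (a / 12) * sqrt (pi / a))"
    by (rule sum_prod_vec_le[OF F, where f = "\<lambda>r m. exp (- a * (of_int m - x $ r)\<^sup>2)"]) (use gaussian_sum_int[OF a] in simp_all)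
  finally show ?thesis by simp
qed

text \<open>Completing the square leaves a single Gaussian with parameter \<open>p + s\<close> and a centre depending on \<open>x\<close>;
the bound for the lattice sum is uniform in the centre.\<close>

lemma gaussian_product_sum_lattice:
  fixes p s :: real and x :: "real^3" assumes p: "p > 0" and s: "s \<ge> 0" and F: "finite F"
  shows "(\<Sum>k\<in>F. exp (- p * (norm (real_vec k))\<^sup>2 - s * (norm (real_vec k - x))\<^sup>2))
     \<le> exp ((p + s) / 4) * (pi * sqrt pi) * (p + s) powr (- 3 / 2)"
proof -
  let ?x = "(s / (p + s)) *\<^sub>R x"
  have "(\<Sum>k\<in>F. exp (- p * (norm (real_vec k))\<^sup>2 - s * (norm (real_vec k - x))\<^sup>2))
     \<le> (\<Sum>k\<in>F. exp (- (p + s) * (norm (real_vec k - ?x))\<^sup>2))"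
  proof (rule sum_mono)
    fix k
    let ?k = "real_vec k"
    have sq: "(norm (?k - c *\<^sub>R x))\<^sup>2 = (norm ?k)\<^sup>2 - 2 * c * (?k \<bullet> x) + c\<^sup>2 * (norm x)\<^sup>2" for c
      by (simp only: power2_norm_eq_inner inner_diff_left inner_diff_right inner_scaleR_left inner_scaleR_right)
         (simp add: inner_commute algebra_simps power2_eq_square)
    have "(p + s) * (norm (?k - ?x))\<^sup>2 = (p + s) * (norm ?k)\<^sup>2 - 2 * s * (?k \<bullet> x) + s\<^sup>2 / (p + s) * (norm x)\<^sup>2"
    proof -
      have "q * (A - 2 * (s / q) * Y + (s / q)\<^sup>2 * X) = q * A - 2 * s * Y + s\<^sup>2 / q * X" if "q > 0" for q A X Y :: real
        using that by (simp add: field_simps power2_eq_square)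
      from this[of "p + s"] show ?thesis unfolding sq using p s by simp
    qed
    moreover have "p * (norm ?k)\<^sup>2 + s * (norm (?k - x))\<^sup>2 = (p + s) * (norm ?k)\<^sup>2 - 2 * s * (?k \<bullet> x) + s * (norm x)\<^sup>2"
    proof -
      have "(norm (?k - x))\<^sup>2 = (norm ?k)\<^sup>2 - 2 * (?k \<bullet> x) + (norm x)\<^sup>2" using sq[of 1] by simp
      then show ?thesis by (simp only:) (simp add: algebra_simps)
    qed
    moreover have "s\<^sup>2 / (p + s) * (norm x)\<^sup>2 \<le> s * (norm x)\<^sup>2"
      using p s by (intro mult_right_mono) (auto simp: field_simps power2_eq_square)
    ultimately show "exp (- p * (norm ?k)\<^sup>2 - s * (norm (?k - x))\<^sup>2) \<le> exp (- (p + s) * (norm (?k - ?x))\<^sup>2)"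
      by (simp add: algebra_simps)
  qed
  also have "\<dots> \<le> (exp ((p + s) / 12) * sqrt (pi / (p + s))) ^ 3"
    using p s F by (intro gaussian_sum_lattice) auto
  also have "\<dots> = exp ((p + s) / 4) * (pi * sqrt pi) * (1 / ((p + s) * sqrt (p + s)))"
  proof -
    have "exp ((p + s) / 12) ^ 3 = exp ((p + s) / 4)" by (simp add: exp_of_nat_mult[symmetric])
    moreover have "sqrt (pi / (p + s)) ^ 3 = pi * sqrt pi * (1 / ((p + s) * sqrt (p + s)))"
      using p s by (simp add: power3_eq_cube real_sqrt_divide)
    ultimately show ?thesis by (simp only: power_mult_distrib mult.assoc)
  qed
  also have "1 / ((p + s) * sqrt (p + s)) = (p + s) powr (- 3 / 2)"
  proof -
    have "(p + s) powr (3/2) = (p + s) powr (1 + 1/2)" by simp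
    also have "\<dots> = (p + s) * sqrt (p + s)" using p s by (subst powr_add) (simp add: powr_half_sqrt)
    finally show ?thesis using p s by (simp add: powr_minus_divide)
  qed
  finally show ?thesis .
qed

section \<open>The norm of the smoothed bilinear term\<close>

lemma norm_real_vec_ge_1: "k \<noteq> 0 \<Longrightarrow> norm (real_vec k) \<ge> 1"
proof -
  assume "k \<noteq> 0"
  then obtain r where "k $ r \<noteq> 0" by (auto simp: vec_eq_iff)
  then have "1 \<le> \<bar>real_vec k $ r\<bar>" by (simp add: real_vec_def)
  also have "\<dots> \<le> norm (real_vec k)" by (rule component_le_norm_cart)
  finally show ?thesis .
qed

lemma real_vec_diff: "real_vec (k - l) = real_vec k - real_vec l"
  by (simp add: real_vec_def vec_eq_iff)

text \<open>The square root of the bound from the Gaussian sums. The constant that arises there is about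
\<open>0.1755\<close>, which is rounded up to \<open>9 / 50\<close>.\<close>

definition kernel0 :: "real \<Rightarrow> real" where
  "kernel0 t = 9 / 50 * exp (t / 12) * t powr (- 3 / 4)"

text \<open>With \<open>x\<close> the square of a distance of lattice points, this writes its inverse through Gaussians.
Truncating the integral at \<open>1\<close> costs only the constant factor in front, because \<open>x \<ge> 1\<close>.\<close>

lemma inverse_le_exp_integral:
  fixes x :: real assumes "x \<ge> 1"
  shows "1 / x \<le> exp 1 / (exp 1 - 1) * integral {0..1} (\<lambda>s. exp (- s * x))"
proof -
  have "((\<lambda>s. exp (- s * x)) has_integral (- exp (- 1 * x) / x - (- exp (- 0 * x) / x))) {0..1}"
    using assms by (intro fundamental_theorem_of_calculus)
       (auto intro!: derivative_eq_intros simp: has_real_derivative_iff_has_vector_derivative[symmetric])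
  then have eq: "integral {0..1} (\<lambda>s. exp (- s * x)) = (1 - exp (- x)) / x"
    by (simp add: integral_unique diff_divide_distrib)
  have "exp (- x) \<le> exp (- 1)" using assms by simp
  then have "(exp 1 - 1) / exp 1 \<le> 1 - exp (- x)" by (simp add: exp_minus field_simps)
  then have "1 \<le> exp 1 / (exp 1 - 1) * (1 - exp (- x))"
    by (simp add: field_simps)
  then have "1 / x \<le> (exp 1 / (exp 1 - 1) * (1 - exp (- x))) / x"
    using assms by (intro divide_right_mono) auto
  then show ?thesis by (simp only: eq times_divide_eq_right)
qed

lemma times_exp_le:
  fixes x d :: real assumes "d > 0"
  shows "x * exp (- d * x) \<le> 1 / (exp 1 * d)"
proof -
  have "d * x \<le> exp (d * x - 1)" using exp_ge_add_one_self[of "d * x - 1"] by simp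
  then have "d * x * exp (- d * x) \<le> exp (d * x - 1) * exp (- d * x)" by (intro mult_right_mono) auto
  also have "\<dots> = 1 / exp 1" by (simp add: exp_add[symmetric] exp_minus field_simps)
  finally show ?thesis using assms by (simp add: field_simps)
qed

text \<open>Two thirds of the exponent are used to absorb the factor \<open>x\<close>. A share \<open>c * t\<close> leads to a constant
proportional to \<open>1 / (c * sqrt (2 - c))\<close> in \<open>kernel0_sum_bound\<close>, which is least for \<open>c = 4 / 3\<close>.\<close>

lemma times_exp_le_exp:
  fixes x t :: real assumes "t > 0"
  shows "x * exp (- 2 * t * x) \<le> 3 / (4 * exp 1 * t) * exp (- (2 * t / 3) * x)"
proof -
  have "x * exp (- 2 * t * x) = (x * exp (- (4 * t / 3) * x)) * exp (- (2 * t / 3) * x)"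
    by (simp only: mult.assoc exp_add[symmetric]) (simp add: field_simps)
  also have "\<dots> \<le> (1 / (exp 1 * (4 * t / 3))) * exp (- (2 * t / 3) * x)"
    using assms by (intro mult_right_mono times_exp_le) auto
  finally show ?thesis by (simp add: mult_ac)
qed

text \<open>On the left are the factors that are collected in \<open>kernel0_sum_bound\<close>. After division by
\<open>(2 * pi) ^ 3\<close> the claim is roughly \<open>0.0308 \<le> 0.0324\<close>.\<close>

lemma kernel_constant:
  "(exp 1 / (exp 1 - 1)) * (3 / (4 * exp 1)) * (exp (1 / 4) * (pi * sqrt pi) * 2 * sqrt (3 / 2)) \<le> (2 * pi) ^ 3 * (9 / 50)\<^sup>2"
proof -
  have e: "exp (1::real) \<ge> 2.718" "exp (1::real) \<le> 2.7183"
    using e_approx_32 by (auto simp: abs_if split: if_splits)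
  have "exp (1 / 4) ^ 4 = exp (1::real)" by (simp add: exp_of_nat_mult[symmetric])
  also have "\<dots> \<le> 1.2841 ^ 4" using e by (simp add: power4_eq_xxxx)
  finally have e4: "exp (1 / 4) \<le> (1.2841 :: real)" by (rule power_mono_iff[THEN iffD1, rotated 3]) auto
  have s: "sqrt (3 / 2) \<le> 1.225" by (rule real_le_lsqrt) (auto simp: power2_eq_square)
  have p: "sqrt pi \<ge> 1.77" using pi_approx(1) by (intro real_le_rsqrt) (simp add: power2_eq_square)
  have pp: "pi * sqrt pi \<ge> 3.14 * 1.77" using pi_approx(1) p by (intro mult_mono) auto
  have "3 / 2 * (exp (1 / 4) * sqrt (3 / 2)) \<le> 3 / 2 * (1.2841 * 1.225)"
    using e4 s by (intro mult_left_mono mult_mono) auto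
  also have "\<dots> \<le> 8 * (9 / 50)\<^sup>2 * (3.14 * 1.77) * (2.718 - 1)" by (simp add: power2_eq_square)
  also have "\<dots> \<le> 8 * (9 / 50)\<^sup>2 * (pi * sqrt pi) * (exp 1 - 1)"
    using pp e by (intro mult_mono[OF mult_left_mono]) auto
  finally have "3 / 2 * (exp (1 / 4) * sqrt (3 / 2)) / (exp 1 - 1) \<le> 8 * (9 / 50)\<^sup>2 * (pi * sqrt pi)"
    using e by (simp only: divide_le_eq) auto
  then have "3 / 2 * (exp (1 / 4) * sqrt (3 / 2)) / (exp 1 - 1) * (pi * sqrt pi) \<le> 8 * (9 / 50)\<^sup>2 * (pi * sqrt pi) * (pi * sqrt pi)"
    using pi_gt_zero by (intro mult_right_mono) auto
  moreover have "3 / 2 * (exp (1 / 4) * sqrt (3 / 2)) / (exp 1 - 1) * (pi * sqrt pi)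
     = (exp 1 / (exp 1 - 1)) * (3 / (4 * exp 1)) * (exp (1 / 4) * (pi * sqrt pi) * 2 * sqrt (3 / 2))"
  proof -
    have "3 / 2 * (u * v) / (E - 1) * w = (E / (E - 1)) * (3 / (4 * E)) * (u * w * 2 * v)" if "E > 1" for E u v w :: real
      using that by (simp add: field_simps)
    from this[of "exp 1"] show ?thesis using e by simp
  qed
  moreover have "8 * (9 / 50)\<^sup>2 * (pi * sqrt pi) * (pi * sqrt pi) = (2 * pi) ^ 3 * (9 / 50)\<^sup>2"
  proof -
    have "(pi * sqrt pi) * (pi * sqrt pi) = pi ^ 3" by (simp add: power3_eq_cube)
    then have "8 * (9 / 50)\<^sup>2 * ((pi * sqrt pi) * (pi * sqrt pi)) = 8 * (9 / 50)\<^sup>2 * pi ^ 3" by (simp only:)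
    then show ?thesis by (simp only: mult.assoc power_mult_distrib) simp
  qed
  ultimately show ?thesis by simp
qed

text \<open>This sum, uniformly in \<open>l\<close>, is the square of the constant in the bilinear estimate. Each summand is
bounded by an integral over \<open>s\<close> of a product of Gaussians in \<open>k\<close> and \<open>k - l\<close>; for each \<open>s\<close> the sum
over \<open>k\<close> is then a Gaussian lattice sum, and what remains is the integral of \<open>p + s\<close> to the power
\<open>-3/2\<close>.\<close>

lemma kernel0_sum_bound:
  fixes t :: real assumes t: "t > 0" and F: "finite F"
  shows "(\<Sum>k\<in>F - {l}. (norm (real_vec k))\<^sup>2 * exp (- 2 * t * (norm (real_vec k))\<^sup>2) / (norm (real_vec (k - l)))\<^sup>2)
     \<le> (2 * pi) ^ 3 * (kernel0 t)\<^sup>2"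
proof -
  let ?c = "exp 1 / (exp 1 - 1) * (3 / (4 * exp 1 * t)) :: real"
  let ?p = "2 * t / 3"
  let ?e = "\<lambda>k s. exp (- ?p * (norm (real_vec k))\<^sup>2 - s * (norm (real_vec k - real_vec l))\<^sup>2)"
  have c0: "?c > 0" using t by (intro mult_pos_pos) auto
  have trm: "(norm (real_vec k))\<^sup>2 * exp (- 2 * t * (norm (real_vec k))\<^sup>2) / (norm (real_vec (k - l)))\<^sup>2
      \<le> ?c * integral {0..1} (?e k)" if "k \<noteq> l" for k
  proof -
    let ?k = "(norm (real_vec k))\<^sup>2" and ?h = "(norm (real_vec (k - l)))\<^sup>2"
    have h: "?h \<ge> 1" using norm_real_vec_ge_1[of "k - l"] that by (simp add: one_le_power)
    have "?k * exp (- 2 * t * ?k) * (1 / ?h) \<le> (3 / (4 * exp 1 * t) * exp (- ?p * ?k)) * (exp 1 / (exp 1 - 1) * integral {0..1} (\<lambda>s. exp (- s * ?h)))"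
      using t by (intro mult_mono inverse_le_exp_integral h times_exp_le_exp) auto
    also have "\<dots> = ?c * (exp (- ?p * ?k) * integral {0..1} (\<lambda>s. exp (- s * ?h)))"
      by (simp only: mult_ac)
    also have "exp (- ?p * ?k) * integral {0..1} (\<lambda>s. exp (- s * ?h)) = integral {0..1} (\<lambda>s. exp (- ?p * ?k) * exp (- s * ?h))"
      by (rule integral_mult_right[symmetric])
    also have "\<dots> = integral {0..1} (?e k)"
      by (simp add: exp_add[symmetric] real_vec_diff)
    finally show ?thesis by simp
  qed
  have ci: "(?e k) integrable_on {0..1}" for k
    by (intro integrable_continuous_interval continuous_intros)
  have FT: "((\<lambda>s. (?p + s) powr (- 3 / 2)) has_integral (- 2 * (?p + 1) powr (- 1 / 2) - (- 2 * (?p + 0) powr (- 1 / 2)))) {0..1}"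
    using t by (intro fundamental_theorem_of_calculus)
       (auto intro!: derivative_eq_intros simp: has_real_derivative_iff_has_vector_derivative[symmetric])
  have "(\<Sum>k\<in>F - {l}. (norm (real_vec k))\<^sup>2 * exp (- 2 * t * (norm (real_vec k))\<^sup>2) / (norm (real_vec (k - l)))\<^sup>2)
      \<le> (\<Sum>k\<in>F - {l}. ?c * integral {0..1} (?e k))"
    by (intro sum_mono trm) auto
  also have "\<dots> = ?c * integral {0..1} (\<lambda>s. \<Sum>k\<in>F - {l}. ?e k s)"
    using F by (subst integral_sum) (auto simp only: ci sum_distrib_left finite_Diff)
  also have "\<dots> \<le> ?c * (exp ((?p + 1) / 4) * (pi * sqrt pi) * integral {0..1} (\<lambda>s. (?p + s) powr (- 3 / 2)))"
  proof -
    have "integral {0..1} (\<lambda>s. \<Sum>k\<in>F - {l}. ?e k s) \<le> integral {0..1} (\<lambda>s. exp ((?p + 1) / 4) * (pi * sqrt pi) * (?p + s) powr (- 3 / 2))"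
    proof (rule integral_le)
      show "(\<lambda>s. exp ((?p + 1) / 4) * (pi * sqrt pi) * (?p + s) powr (- 3 / 2)) integrable_on {0..1}"
        using FT by (intro integrable_on_mult_right) (auto simp: integrable_on_def)
      show "(\<lambda>s. \<Sum>k\<in>F - {l}. ?e k s) integrable_on {0..1}"
        using F by (intro integrable_sum ci) auto
      fix s :: real assume s: "s \<in> {0..1}"
      have "(\<Sum>k\<in>F - {l}. ?e k s) \<le> exp ((?p + s) / 4) * (pi * sqrt pi) * (?p + s) powr (- 3 / 2)"
        using gaussian_product_sum_lattice[of ?p s "F - {l}" "real_vec l"] s t F by simp
      also have "\<dots> \<le> exp ((?p + 1) / 4) * (pi * sqrt pi) * (?p + s) powr (- 3 / 2)"
        using s by (intro mult_right_mono) auto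
      finally show "(\<Sum>k\<in>F - {l}. ?e k s) \<le> exp ((?p + 1) / 4) * (pi * sqrt pi) * (?p + s) powr (- 3 / 2)" .
    qed
    then show ?thesis using c0 by (intro mult_left_mono) (auto simp: less_imp_le)
  qed
  also have "\<dots> \<le> ?c * (exp ((?p + 1) / 4) * (pi * sqrt pi) * (2 * ?p powr (- 1 / 2)))"
    using FT c0 by (intro mult_left_mono) (auto simp: integral_unique less_imp_le)
  also have "\<dots> = ((exp 1 / (exp 1 - 1)) * (3 / (4 * exp 1)) * (exp (1 / 4) * (pi * sqrt pi) * 2 * sqrt (3 / 2))) * (exp (t / 6) * t powr (- 3 / 2))"
  proof -
    have "exp ((?p + 1) / 4) = exp (t / 6) * exp (1 / 4)" by (simp add: exp_add[symmetric] field_simps)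
    moreover have "?p powr (- 1 / 2) = sqrt (3 / 2) * t powr (- 1 / 2)"
    proof -
      have "?p powr (- 1 / 2) = (2 / 3) powr (- 1 / 2) * t powr (- 1 / 2)"
        using powr_mult[of "2 / 3" t "- 1 / 2"] t by simp
      moreover have "(2 / 3 :: real) powr (- 1 / 2) = sqrt (3 / 2)"
        by (simp add: powr_minus_divide powr_half_sqrt real_sqrt_divide)
      ultimately show ?thesis by simp
    qed
    moreover have "t powr (- 3 / 2) = t powr (- 1 / 2) / t"
      using t powr_add[of t "- 1 / 2" "- 1"] by (simp add: powr_minus_divide)
    ultimately show ?thesis by (simp add: field_simps)
  qed
  also have "\<dots> \<le> ((2 * pi) ^ 3 * (9 / 50)\<^sup>2) * (exp (t / 6) * t powr (- 3 / 2))"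
    by (intro mult_right_mono kernel_constant) auto
  also have "\<dots> = (2 * pi) ^ 3 * (kernel0 t)\<^sup>2"
  proof -
    have "(exp (t / 12))\<^sup>2 = exp (t / 6)" by (simp add: exp_of_nat_mult[symmetric])
    moreover have "(t powr (- 3 / 4))\<^sup>2 = t powr (- 3 / 2)" using t by (simp add: power2_eq_square powr_add[symmetric])
    ultimately show ?thesis by (simp only: kernel0_def power_mult_distrib mult.assoc)
  qed
  finally show ?thesis .
qed

text \<open>The time at which the bound \<open>kernel0\<close> is replaced by exponential decay. It is the fourth power of
\<open>3 / 4\<close>, so that the powers occurring below are rational.\<close>

definition tau0 :: real where "tau0 = 81 / 256"

definition kernel :: "real \<Rightarrow> real" where
  "kernel t = (if t \<le> tau0 then kernel0 t else exp (tau0 - t) * kernel0 tau0)"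

lemma kernel0_nonneg: "kernel0 t \<ge> 0"
  by (simp add: kernel0_def)

lemma kernel_nonneg: "kernel t \<ge> 0"
  by (simp add: kernel_def kernel0_nonneg)

text \<open>For \<open>t > tau0\<close> the additional heat flow over the time \<open>t - tau0\<close> contracts every nonzero mode by at least
\<open>exp (tau0 - t)\<close>, because nonzero frequencies have length at least \<open>1\<close>.\<close>

lemma kernel_sum_bound:
  fixes t :: real assumes t: "t > 0" and F: "finite F"
  shows "(\<Sum>k\<in>F - {l}. (norm (real_vec k))\<^sup>2 * exp (- 2 * t * (norm (real_vec k))\<^sup>2) / (norm (real_vec (k - l)))\<^sup>2)
     \<le> (2 * pi) ^ 3 * (kernel t)\<^sup>2"
proof (cases "t \<le> tau0")
  case True
  then show ?thesis using kernel0_sum_bound[OF t F] by (simp add: kernel_def)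
next
  case False
  have t0: "tau0 > 0" by (simp add: tau0_def)
  have "(\<Sum>k\<in>F - {l}. (norm (real_vec k))\<^sup>2 * exp (- 2 * t * (norm (real_vec k))\<^sup>2) / (norm (real_vec (k - l)))\<^sup>2)
      \<le> (\<Sum>k\<in>F - {l}. (exp (tau0 - t))\<^sup>2 * ((norm (real_vec k))\<^sup>2 * exp (- 2 * tau0 * (norm (real_vec k))\<^sup>2) / (norm (real_vec (k - l)))\<^sup>2))"
  proof (rule sum_mono)
    fix k
    let ?k = "(norm (real_vec k))\<^sup>2"
    have "?k * exp (- 2 * t * ?k) \<le> ?k * ((exp (tau0 - t))\<^sup>2 * exp (- 2 * tau0 * ?k))"
    proof (cases "k = 0")
      case True then show ?thesis by (simp add: real_vec_def zero_vec_def[symmetric])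
    next
      case False
      then have "1 \<le> ?k" by (simp add: norm_real_vec_ge_1 one_le_power)
      then have "(t - tau0) * 1 \<le> (t - tau0) * ?k" using \<open>\<not> t \<le> tau0\<close> by (intro mult_left_mono) auto
      then show ?thesis by (intro mult_left_mono) (auto simp: exp_of_nat_mult[symmetric] exp_add[symmetric] algebra_simps)
    qed
    from divide_right_mono[OF this, of "(norm (real_vec (k - l)))\<^sup>2"]
    show "?k * exp (- 2 * t * ?k) / (norm (real_vec (k - l)))\<^sup>2
       \<le> (exp (tau0 - t))\<^sup>2 * (?k * exp (- 2 * tau0 * ?k) / (norm (real_vec (k - l)))\<^sup>2)"
      by (simp add: mult_ac)
  qed
  also have "\<dots> \<le> (exp (tau0 - t))\<^sup>2 * ((2 * pi) ^ 3 * (kernel0 tau0)\<^sup>2)"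
    unfolding sum_distrib_left[symmetric] by (intro mult_left_mono kernel0_sum_bound t0 F) auto
  also have "\<dots> = (2 * pi) ^ 3 * (kernel t)\<^sup>2" using False by (simp add: kernel_def power_mult_distrib)
  finally show ?thesis .
qed

text \<open>For uniqueness and for continuity in time only the order of the singularity at \<open>0\<close> matters.\<close>

lemma kernel_le_powr: "\<exists>K\<ge>0. \<forall>t>0. kernel t \<le> K * t powr (- 3 / 4)"
proof (intro exI conjI allI impI)
  let ?K = "9 / 50 * exp (tau0 / 12) + exp tau0 * kernel0 tau0"
  show "?K \<ge> 0" using kernel0_nonneg[of tau0] by simp
  fix t :: real assume t: "t > 0"
  show "kernel t \<le> ?K * t powr (- 3 / 4)"
  proof (cases "t \<le> tau0")
    case True
    have "kernel t \<le> 9 / 50 * exp (tau0 / 12) * t powr (- 3 / 4)"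
      using True by (simp add: kernel_def kernel0_def mult_right_mono)
    also have "\<dots> \<le> ?K * t powr (- 3 / 4)"
      using kernel0_nonneg[of tau0] by (intro mult_right_mono) auto
    finally show ?thesis .
  next
    case False
    have "t powr (3 / 4) \<le> (1 + t) powr (3 / 4)" using t by (intro powr_mono2) auto
    also have "\<dots> \<le> (1 + t) powr 1" using t by (intro powr_mono) auto
    also have "\<dots> \<le> exp t" using t exp_ge_add_one_self[of t] by simp
    finally have "exp (- t) \<le> t powr (- 3 / 4)" using t by (simp add: exp_minus powr_minus_divide field_simps)
    then have "exp tau0 * kernel0 tau0 * exp (- t) \<le> exp tau0 * kernel0 tau0 * t powr (- 3 / 4)"
      using kernel0_nonneg[of tau0] by (intro mult_left_mono) auto
    moreover have "kernel t = exp tau0 * kernel0 tau0 * exp (- t)" using False by (simp add: kernel_def exp_diff exp_minus field_simps)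
    moreover have "exp tau0 * kernel0 tau0 * t powr (- 3 / 4) \<le> ?K * t powr (- 3 / 4)"
      by (intro mult_right_mono) auto
    ultimately show ?thesis by linarith
  qed
qed

lemma tau0_powr: "tau0 powr (1 / 4) = 3 / 4" "tau0 powr (- 3 / 4) = 64 / 27"
proof -
  have t: "tau0 = (3 / 4) powr 4" by (simp add: tau0_def powr_numeral power4_eq_xxxx)
  show "tau0 powr (1 / 4) = 3 / 4" unfolding t powr_powr by simp
  show "tau0 powr (- 3 / 4) = 64 / 27" unfolding t powr_powr by (simp add: powr_minus powr_numeral power3_eq_cube)
qed

text \<open>The exponential \<open>exp (13 / 12 * t)\<close>, which collects \<open>exp t\<close> and the factor \<open>exp (t / 12)\<close> of \<open>kernel0\<close>,
is replaced by a quadratic polynomial, so that the integral becomes explicit.\<close>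

lemma kernel_exp_majorant:
  assumes "0 < t" "t \<le> tau0"
  shows "kernel t * exp t \<le> 9 / 50 * (t powr (- 3 / 4) + 13 / 12 * t powr (1 / 4) + 169 / 144 * t powr (5 / 4))"
proof -
  have "exp (13 / 12 * t) \<le> 1 + 13 / 12 * t + (13 / 12 * t)\<^sup>2"
    using assms by (intro exp_bound) (auto simp: tau0_def)
  then have "9 / 50 * t powr (- 3 / 4) * exp (13 / 12 * t) \<le> 9 / 50 * t powr (- 3 / 4) * (1 + 13 / 12 * t + (13 / 12 * t)\<^sup>2)"
    by (intro mult_left_mono) auto
  moreover have "t powr (1 / 4) = t powr (- 3 / 4) * t" "t powr (5 / 4) = t powr (- 3 / 4) * t\<^sup>2"
    using assms powr_add[of t "- 3 / 4" 1] powr_add[of t "- 3 / 4" 2] by auto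
  moreover have "kernel t * exp t = 9 / 50 * t powr (- 3 / 4) * exp (13 / 12 * t)"
    using assms by (simp add: kernel_def kernel0_def exp_add[symmetric])
  ultimately show ?thesis by (simp add: power2_eq_square algebra_simps)
qed

lemma majorant_integral:
  fixes t :: real
  assumes "0 \<le> t"
  shows "((\<lambda>s. 9 / 50 * (s powr (- 3 / 4) + 13 / 12 * s powr (1 / 4) + 169 / 144 * s powr (5 / 4))) has_integral
     9 / 50 * (4 * t powr (1 / 4) + 13 / 15 * t powr (5 / 4) + 169 / 324 * t powr (9 / 4))) {0..t}"
proof -
  have *: "((\<lambda>s. s powr a) has_integral t powr (a + 1) / (a + 1)) {0..t}" if "a > -1" for a
    using has_integral_powr_from_0[OF that assms] .
  have "((\<lambda>s. 9 / 50 * (s powr (- 3 / 4) + 13 / 12 * s powr (1 / 4) + 169 / 144 * s powr (5 / 4))) has_integral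
     9 / 50 * (t powr (- 3 / 4 + 1) / (- 3 / 4 + 1) + 13 / 12 * (t powr (1 / 4 + 1) / (1 / 4 + 1))
        + 169 / 144 * (t powr (5 / 4 + 1) / (5 / 4 + 1)))) {0..t}"
    by (intro has_integral_mult_right has_integral_add *) auto
  then show ?thesis by simp
qed

lemma majorant_at_tau0:
  fixes t :: real
  assumes "0 \<le> t" "t \<le> tau0"
  shows "9 / 50 * (4 * t powr (1 / 4) + 13 / 15 * t powr (5 / 4) + 169 / 324 * t powr (9 / 4)) \<le> 250 / 407"
proof -
  have le: "t powr a \<le> tau0 powr a" if "a \<ge> 0" for a
    using assms that by (intro powr_mono2) auto
  have "9 / 50 * (4 * t powr (1 / 4) + 13 / 15 * t powr (5 / 4) + 169 / 324 * t powr (9 / 4))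
     \<le> 9 / 50 * (4 * tau0 powr (1 / 4) + 13 / 15 * tau0 powr (5 / 4) + 169 / 324 * tau0 powr (9 / 4))"
    by (intro mult_left_mono add_mono le) auto
  also have "tau0 powr (5 / 4) = 3 / 4 * tau0"
    using powr_add[of tau0 "1 / 4" 1] tau0_powr by (simp add: tau0_def)
  also have "tau0 powr (9 / 4) = 3 / 4 * tau0\<^sup>2"
    using powr_add[of tau0 "1 / 4" 2] tau0_powr by (simp add: tau0_def)
  also have "9 / 50 * (4 * tau0 powr (1 / 4) + 13 / 15 * (3 / 4 * tau0) + 169 / 324 * (3 / 4 * tau0\<^sup>2)) \<le> 250 / 407"
    unfolding tau0_powr by (simp add: tau0_def power2_eq_square)
  finally show ?thesis .
qed

lemma kernel_tau0_exp: "kernel0 tau0 * exp tau0 \<le> 250 / 407"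
proof -
  let ?x = "13 / 12 * tau0"
  \<comment> \<open>The estimate \<open>exp (- x) \<ge> 1 - x\<close> would be too weak; applied to a quarter of \<open>x\<close> it suffices.\<close>
  have "1 - ?x / 4 \<le> exp (- ?x / 4)" using exp_ge_add_one_self[of "- ?x / 4"] by simp
  then have "(1 - ?x / 4) ^ 4 \<le> exp (- ?x / 4) ^ 4" by (intro power_mono) (auto simp: tau0_def)
  also have "\<dots> = exp (- ?x)" by (simp add: exp_of_nat_mult[symmetric])
  finally have "exp ?x * (1 - ?x / 4) ^ 4 \<le> 1" by (simp add: exp_minus field_simps)
  moreover have "(1 - ?x / 4) ^ 4 \<ge> 0.698" by (simp add: tau0_def power4_eq_xxxx)
  ultimately have "exp ?x * 0.698 \<le> 1" by (smt (verit) exp_gt_zero mult_left_mono)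
  moreover have "kernel0 tau0 * exp tau0 = 9 / 50 * (64 / 27) * exp ?x"
  proof -
    have "exp (tau0 / 12) * exp tau0 = exp ?x" by (simp add: exp_add[symmetric])
    then show ?thesis by (simp only: kernel0_def tau0_powr mult_ac)
  qed
  ultimately show ?thesis by simp
qed

text \<open>The norm of the Duhamel term for curves that decay like \<open>exp (- s)\<close>. The threshold \<open>0.407\<close> enters
here, as \<open>250 / 407 = 1 / (4 * 0.407)\<close>. For \<open>t > tau0\<close> the integral is a convex combination,
with weights \<open>exp (tau0 - t)\<close> and \<open>1 - exp (tau0 - t)\<close>, of the small-time integral and of the value of
\<open>kernel s * exp s\<close> at \<open>tau0\<close>, and both are at most \<open>250 / 407\<close>. Only a majorant \<open>h\<close> of the
integrand is provided, since this is what the Duhamel estimate consumes.\<close>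

lemma kernel_weighted_integral:
  assumes "0 \<le> t"
  obtains h I where "(h has_integral I) {0..t}" "I \<le> 250 / 407" "\<And>s. 0 < s \<Longrightarrow> s \<le> t \<Longrightarrow> kernel s * exp (2 * s - t) \<le> h s"
proof -
  let ?m = "\<lambda>s. 9 / 50 * (s powr (- 3 / 4) + 13 / 12 * s powr (1 / 4) + 169 / 144 * s powr (5 / 4))"
  let ?M = "\<lambda>t. 9 / 50 * (4 * t powr (1 / 4) + 13 / 15 * t powr (5 / 4) + 169 / 324 * t powr (9 / 4))"
  show ?thesis
  proof (cases "t \<le> tau0")
    case True
    show ?thesis
    proof (rule that[OF majorant_integral[OF assms] majorant_at_tau0[OF assms True]])
      fix s assume s: "0 < s" "s \<le> t"
      have "kernel s * exp (2 * s - t) \<le> kernel s * exp s" using s by (intro mult_left_mono kernel_nonneg) auto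
      also have "\<dots> \<le> ?m s" using s True by (intro kernel_exp_majorant) auto
      finally show "kernel s * exp (2 * s - t) \<le> ?m s" .
    qed
  next
    case False
    let ?q = "exp (tau0 - t)"
    let ?h = "\<lambda>s. if s \<le> tau0 then ?q * ?m s else kernel0 tau0 * exp tau0 * exp (s - t)"
    have t0: "tau0 \<ge> 0" by (simp add: tau0_def)
    have 1: "(?h has_integral ?q * ?M tau0) {0..tau0}"
      by (rule has_integral_eq[OF _ has_integral_mult_right[OF majorant_integral[OF t0], of ?q]]) simp
    have "((\<lambda>s. kernel0 tau0 * exp tau0 * exp (s - t)) has_integral kernel0 tau0 * exp tau0 * (exp (t - t) - ?q)) {tau0..t}"
      using False by (intro has_integral_mult_right fundamental_theorem_of_calculus)
        (auto intro!: derivative_eq_intros simp: has_real_derivative_iff_has_vector_derivative[symmetric])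
    then have 2: "(?h has_integral kernel0 tau0 * exp tau0 * (exp (t - t) - ?q)) {tau0..t}"
      by (rule has_integral_spike_finite[of "{tau0}", rotated 2]) auto
    have I: "(?h has_integral (?q * ?M tau0 + kernel0 tau0 * exp tau0 * (exp (t - t) - ?q))) {0..t}"
      using False by (intro has_integral_combine[OF _ _ 1 2]) (auto simp: t0)
    have q: "0 \<le> ?q" "?q \<le> 1" using False by auto
    have "?q * ?M tau0 \<le> ?q * (250 / 407)" using q t0 by (intro mult_left_mono majorant_at_tau0) auto
    moreover have "kernel0 tau0 * exp tau0 * (exp (t - t) - ?q) \<le> 250 / 407 * (exp (t - t) - ?q)"
      using q by (intro mult_right_mono kernel_tau0_exp) auto
    ultimately have le: "?q * ?M tau0 + kernel0 tau0 * exp tau0 * (exp (t - t) - ?q) \<le> 250 / 407"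
      by (simp add: algebra_simps)
    show ?thesis
    proof (rule that[OF I le])
      fix s assume s: "0 < s" "s \<le> t"
      show "kernel s * exp (2 * s - t) \<le> ?h s"
      proof (cases "s \<le> tau0")
        case True
        have "kernel s * exp (2 * s - t) \<le> kernel s * (exp s * ?q)"
          unfolding exp_add[symmetric] using True by (intro mult_left_mono kernel_nonneg) auto
        also have "\<dots> \<le> ?q * ?m s"
          using mult_left_mono[OF kernel_exp_majorant[of s], of ?q] s True q by (simp add: mult_ac)
        finally show ?thesis using True by simp
      next
        case False
        have "exp (tau0 - s) * exp (2 * s - t) = exp tau0 * exp (s - t)"
          by (simp add: exp_add[symmetric])
        moreover have "kernel s * exp (2 * s - t) = kernel0 tau0 * (exp (tau0 - s) * exp (2 * s - t))"
          using False by (simp only: kernel_def if_False mult_ac)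
        ultimately show ?thesis using False by simp
      qed
    qed
  qed
qed

section \<open>Algebra of the Leray symbol\<close>

lemma norm_vector_scalar_mult: "norm (c *s (v :: complex^3)) = norm c * norm v"
  by (simp add: norm_vec_def L2_set_def norm_mult power_mult_distrib sum_distrib_left[symmetric] real_sqrt_mult)

lemma norm_cdot_le: "norm (cdot a b) \<le> norm a * norm b"
proof -
  have "norm (cdot a b) \<le> (\<Sum>r\<in>UNIV. \<bar>norm (a $ r)\<bar> * \<bar>norm (b $ r)\<bar>)"
    unfolding cdot_def by (rule order_trans[OF norm_sum]) (simp add: norm_mult)
  also have "\<dots> \<le> norm a * norm b" unfolding norm_vec_def by (rule L2_set_mult_ineq)
  finally show ?thesis .
qed

lemma norm_complex_vec: "norm (complex_vec k) = norm (real_vec k)"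
  by (simp add: norm_vec_def L2_set_def complex_vec_def real_vec_def)

lemma cdot_complex_vec_self: "cdot (complex_vec k) (complex_vec k) = complex_of_real ((norm (real_vec k))\<^sup>2)"
  unfolding norm_vec3_power2 by (simp add: cdot_def complex_vec_def real_vec_def power2_eq_square)

lemma cdot_add_right: "cdot a (b + c) = cdot a b + cdot a c"
  by (simp add: cdot_def algebra_simps sum.distrib)
lemma cdot_add_left: "cdot (a + b) c = cdot a c + cdot b c"
  by (simp add: cdot_def algebra_simps sum.distrib)
lemma cdot_diff_right: "cdot a (b - c) = cdot a b - cdot a c"
  by (simp add: cdot_def algebra_simps sum_subtractf)
lemma cdot_smult_right: "cdot a (z *s b) = z * cdot a b"
  by (simp add: cdot_def sum_distrib_left mult_ac)
lemma cdot_scaleR_right: "cdot a (x *\<^sub>R b) = x *\<^sub>R cdot a b"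
  by (simp add: cdot_def scaleR_sum_right)
lemma cdot_zero_right [simp]: "cdot a 0 = 0"
  by (simp add: cdot_def)
lemma cdot_minus_left: "cdot (- a) b = - cdot a b"
  by (simp add: cdot_def sum_negf)
lemma cdot_commute: "cdot a b = cdot b a"
  by (simp add: cdot_def mult.commute)

lemma bounded_linear_cdot: "bounded_linear (cdot a)"
  by (rule bounded_linear_intro[where K = "norm a"])
     (auto simp: cdot_add_right cdot_scaleR_right mult.commute intro: order_trans[OF norm_cdot_le])

lemma complex_vec_uminus: "complex_vec (- k) = - complex_vec k"
  by (simp add: complex_vec_def vec_eq_iff)
lemma complex_vec_0 [simp]: "complex_vec 0 = 0"
  by (simp add: complex_vec_def vec_eq_iff)
lemma real_vec_0 [simp]: "real_vec 0 = 0"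
  by (simp add: real_vec_def vec_eq_iff)
lemma real_vec_uminus: "real_vec (- k) = - real_vec k"
  by (simp add: real_vec_def vec_eq_iff)
lemma leray_symbol_add: "leray_symbol k (a + b) = leray_symbol k a + leray_symbol k b"
  by (simp add: leray_symbol_def cdot_add_right vec_eq_iff add_divide_distrib algebra_simps)

lemma scaleR_eq_vector_scalar_mult: "x *\<^sub>R (v :: complex^3) = complex_of_real x *s v"
  by (simp add: vec_eq_iff scaleR_conv_of_real[where 'a = complex])

lemma leray_symbol_smult: "leray_symbol k (z *s a) = z *s leray_symbol k a"
  by (simp add: leray_symbol_def cdot_smult_right vec_eq_iff algebra_simps)

lemma leray_symbol_scaleR: "leray_symbol k (x *\<^sub>R a) = x *\<^sub>R leray_symbol k a"
  by (simp only: scaleR_eq_vector_scalar_mult leray_symbol_smult)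

lemma cdot_leray_symbol: "cdot (complex_vec k) (leray_symbol k a) = 0"
proof (cases "k = 0")
  case False
  then have "norm (real_vec k) \<noteq> 0" using norm_real_vec_ge_1[of k] by linarith
  then show ?thesis using False
    by (simp add: leray_symbol_def cdot_diff_right cdot_smult_right cdot_complex_vec_self)
qed (simp add: cdot_def)

definition cnj_vec :: "complex^3 \<Rightarrow> complex^3" where "cnj_vec v = (\<chi> r. cnj (v $ r))"

lemma cdot_cnj_complex_vec: "cdot (complex_vec k) (cnj_vec v) = cnj (cdot (complex_vec k) v)"
  by (simp add: cdot_def cnj_vec_def complex_vec_def)

lemma cnj_vec_smult: "cnj_vec (z *s v) = cnj z *s cnj_vec v" and cnj_vec_diff: "cnj_vec (v - w) = cnj_vec v - cnj_vec w"
  and cnj_vec_add: "cnj_vec (v + w) = cnj_vec v + cnj_vec w" and cnj_vec_scaleR: "cnj_vec (x *\<^sub>R v) = x *\<^sub>R cnj_vec v"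
  and cnj_complex_vec: "cnj_vec (complex_vec k) = complex_vec k" and cnj_vec_0 [simp]: "cnj_vec 0 = 0"
  by (simp_all add: cnj_vec_def vec_eq_iff complex_vec_def)

lemma norm_cnj_vec: "norm (cnj_vec v) = norm v"
  by (simp add: norm_vec_def cnj_vec_def)

lemma bounded_linear_cnj_vec: "bounded_linear cnj_vec"
  by (rule bounded_linear_intro[where K = 1]) (simp_all add: cnj_vec_add cnj_vec_scaleR norm_cnj_vec)

lemma leray_symbol_cnj: "leray_symbol (- k) (cnj_vec v) = cnj_vec (leray_symbol k v)"
  by (simp add: leray_symbol_def cnj_vec_diff cnj_vec_smult cnj_complex_vec complex_vec_uminus real_vec_uminus cdot_minus_left cdot_cnj_complex_vec)

text \<open>The Leray symbol is the orthogonal projection along the wave vector, so this is Pythagoras' theorem.\<close>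

lemma norm_leray_symbol_le: "norm (leray_symbol k v) \<le> norm v"
proof (cases "k = 0")
  case False
  define n where "n = norm (real_vec k)"
  have n: "n \<ge> 1" using norm_real_vec_ge_1[OF False] by (simp add: n_def)
  define z where "z = cdot (complex_vec k) v / complex_of_real (n\<^sup>2)"
  define p where "p = leray_symbol k v"
  have p: "p = v - z *s complex_vec k" using False by (simp add: p_def leray_symbol_def z_def n_def)
  have k: "cdot (complex_vec k) p = 0" by (simp add: p_def cdot_leray_symbol)
  \<comment> \<open>The two parts are orthogonal for the Hermitian product, since the wave vector is real.\<close>
  have nc: "complex_of_real ((norm w)\<^sup>2) = cdot w (cnj_vec w)" for w :: "complex^3"
  proof -
    have "complex_of_real ((norm w)\<^sup>2) = (\<Sum>r\<in>UNIV. complex_of_real ((norm (w $ r))\<^sup>2))"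
      by (simp add: norm_vec_def L2_set_def sum_nonneg)
    then show ?thesis by (simp only: complex_norm_square cdot_def cnj_vec_def vec_lambda_beta)
  qed
  define q where "q = z *s complex_vec k"
  have v: "v = p + q" by (simp add: p q_def)
  have "cdot p (cnj_vec q) = 0"
    unfolding q_def cnj_vec_smult cnj_complex_vec cdot_smult_right cdot_commute[of p] k by simp
  moreover have "cdot q (cnj_vec p) = 0"
    unfolding q_def cdot_commute[of "z *s complex_vec k"] cdot_smult_right cdot_commute[of "cnj_vec p"] cdot_cnj_complex_vec k by simp
  ultimately have "cdot v (cnj_vec v) = cdot p (cnj_vec p) + cdot q (cnj_vec q)"
    unfolding v cnj_vec_add cdot_add_left cdot_add_right by simp
  then have "complex_of_real ((norm v)\<^sup>2) = complex_of_real ((norm p)\<^sup>2 + (norm q)\<^sup>2)" by (simp only: nc of_real_add)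
  then have "(norm v)\<^sup>2 = (norm p)\<^sup>2 + (norm q)\<^sup>2" by (simp only: of_real_eq_iff)
  then have "(norm p)\<^sup>2 \<le> (norm v)\<^sup>2" by simp
  then show ?thesis unfolding p_def by (rule power2_le_imp_le) simp
qed (simp add: leray_symbol_def)

lemma bounded_linear_leray_symbol: "bounded_linear (leray_symbol k)"
  by (rule bounded_linear_intro[where K = 1]) (auto simp: leray_symbol_add leray_symbol_scaleR norm_leray_symbol_le)

section \<open>Weighted sequences\<close>

text \<open>The bound on the \<open>H\<^sup>1\<close> norm is expressed by finite partial sums, which makes it stable under
pointwise limits and under integration in time.\<close>

definition h1_le :: "(int^3 \<Rightarrow> complex^3) \<Rightarrow> real \<Rightarrow> bool" where
  "h1_le a M \<longleftrightarrow> (\<forall>F. finite F \<longrightarrow> L2_set (\<lambda>k. norm (real_vec k) * norm (a k)) F \<le> M)"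

lemma h1_leI: "(\<And>F. finite F \<Longrightarrow> L2_set (\<lambda>k. norm (real_vec k) * norm (a k)) F \<le> M) \<Longrightarrow> h1_le a M"
  by (simp add: h1_le_def)

lemma h1_leD: "h1_le a M \<Longrightarrow> finite F \<Longrightarrow> L2_set (\<lambda>k. norm (real_vec k) * norm (a k)) F \<le> M"
  by (simp add: h1_le_def)

lemma h1_le_nonneg: "h1_le a M \<Longrightarrow> 0 \<le> M"
  using h1_leD[of a M "{}"] by simp

lemma h1_le_mono: "h1_le a M \<Longrightarrow> M \<le> N \<Longrightarrow> h1_le a N"
  unfolding h1_le_def by (meson order_trans)

lemma L2_set_norm_triangle:
  "L2_set (\<lambda>k. norm (real_vec k) * norm (a k + b k)) F
     \<le> L2_set (\<lambda>k. norm (real_vec k) * norm (a k)) F + L2_set (\<lambda>k. norm (real_vec k) * norm (b k :: complex^3)) F"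
  by (rule order_trans[OF _ L2_set_triangle_ineq], rule L2_set_mono)
     (simp_all add: distrib_left[symmetric] mult_left_mono norm_triangle_ineq)

lemma h1_le_add: "h1_le a A \<Longrightarrow> h1_le b B \<Longrightarrow> h1_le (\<lambda>k. a k + b k) (A + B)"
  by (rule h1_leI, rule order_trans[OF L2_set_norm_triangle], rule add_mono) (simp_all add: h1_leD)

lemma h1_le_minus: "h1_le (\<lambda>k. - a k) A \<longleftrightarrow> h1_le a A"
  by (simp add: h1_le_def)

lemma h1_le_diff: "h1_le a A \<Longrightarrow> h1_le b B \<Longrightarrow> h1_le (\<lambda>k. a k - b k) (A + B)"
  using h1_le_add[of a A "\<lambda>k. - b k" B] by (simp add: h1_le_minus)

lemma h1_le_diff_commute: "h1_le (\<lambda>k. a k - b k) A \<longleftrightarrow> h1_le (\<lambda>k. b k - a k) A"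
  by (simp add: h1_le_def norm_minus_commute)

lemma h1_le_zero: "h1_le (\<lambda>k. 0) 0"
  by (rule h1_leI) (simp add: L2_set_def)

lemma h1_le_limit:
  assumes lim: "\<And>k. ((\<lambda>n. a n k) \<longlongrightarrow> b k) G" and M: "(M \<longlongrightarrow> N) G" and le: "eventually (\<lambda>n. h1_le (a n) (M n)) G"
    and G: "G \<noteq> bot"
  shows "h1_le b N"
proof (rule h1_leI)
  fix F :: "(int^3) set" assume F: "finite F"
  have "((\<lambda>n. L2_set (\<lambda>k. norm (real_vec k) * norm (a n k)) F) \<longlongrightarrow> L2_set (\<lambda>k. norm (real_vec k) * norm (b k)) F) G"
    unfolding L2_set_def by (intro tendsto_intros lim)
  then show "L2_set (\<lambda>k. norm (real_vec k) * norm (b k)) F \<le> N"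
    by (rule tendsto_le[OF G M]) (use le in eventually_elim, simp add: h1_leD F)
qed

lemma h1_le_component: assumes "h1_le a M" shows "norm (real_vec k) * norm (a k) \<le> M"
  using h1_leD[OF assms, of "{k}"] by simp

lemma h1_le_component': assumes "h1_le a M" "a 0 = 0" shows "norm (a k) \<le> M"
proof (cases "k = 0")
  case False
  then have "norm (a k) \<le> norm (real_vec k) * norm (a k)"
    using mult_right_mono[OF norm_real_vec_ge_1, of k "norm (a k)"] by simp
  then show ?thesis using h1_le_component[OF assms(1), of k] by linarith
qed (use assms h1_le_nonneg in auto)

lemma h1_le_L2: assumes "h1_le a M" "a 0 = 0" "finite F" shows "L2_set (\<lambda>k. norm (a k)) F \<le> M"
proof -
  have "L2_set (\<lambda>k. norm (a k)) F \<le> L2_set (\<lambda>k. norm (real_vec k) * norm (a k)) F"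
  proof (rule L2_set_mono)
    fix k show "norm (a k) \<le> norm (real_vec k) * norm (a k)"
      using mult_right_mono[OF norm_real_vec_ge_1, of k "norm (a k)"] assms(2) by (cases "k = 0") auto
  qed simp
  then show ?thesis using h1_leD[OF assms(1,3)] by linarith
qed

definition h1_norm :: "(int^3 \<Rightarrow> complex^3) \<Rightarrow> real" where
  "h1_norm a = sqrt (\<Sum>\<^sub>\<infinity>k. (norm (real_vec k) * norm (a k))\<^sup>2)"

definition h1_finite :: "(int^3 \<Rightarrow> complex^3) \<Rightarrow> bool" where
  "h1_finite a \<longleftrightarrow> (\<lambda>k. (norm (real_vec k) * norm (a k))\<^sup>2) summable_on UNIV"

lemma h1_le_iff: "h1_le a M \<longleftrightarrow> h1_finite a \<and> h1_norm a \<le> M"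
proof
  assume le: "h1_le a M"
  have M: "M \<ge> 0" using le by (rule h1_le_nonneg)
  have b: "(\<Sum>k\<in>F. (norm (real_vec k) * norm (a k))\<^sup>2) \<le> M\<^sup>2" if "finite F" for F
    using h1_leD[OF le that] M unfolding L2_set_def by (subst (asm) real_sqrt_le_iff'[where y = M]) (auto intro!: sum_nonneg)
  have s: "(\<lambda>k. (norm (real_vec k) * norm (a k))\<^sup>2) summable_on UNIV"
    by (rule nonneg_bdd_above_summable_on) (auto intro!: bdd_aboveI2[where M = "M\<^sup>2"] b)
  have "(\<Sum>\<^sub>\<infinity>k. (norm (real_vec k) * norm (a k))\<^sup>2) \<le> M\<^sup>2"
    by (rule infsum_le_finite_sums[OF s]) (auto intro: b)
  then show "h1_finite a \<and> h1_norm a \<le> M"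
    using s M by (auto simp: h1_finite_def h1_norm_def intro!: real_le_lsqrt infsum_nonneg)
next
  assume a: "h1_finite a \<and> h1_norm a \<le> M"
  show "h1_le a M"
  proof (rule h1_leI)
    fix F :: "(int^3) set" assume "finite F"
    then have "(\<Sum>k\<in>F. (norm (real_vec k) * norm (a k))\<^sup>2) \<le> (\<Sum>\<^sub>\<infinity>k. (norm (real_vec k) * norm (a k))\<^sup>2)"
      using a by (intro finite_sum_le_infsum) (auto simp: h1_finite_def)
    then have "L2_set (\<lambda>k. norm (real_vec k) * norm (a k)) F \<le> h1_norm a"
      unfolding L2_set_def h1_norm_def by (rule real_sqrt_le_mono)
    then show "L2_set (\<lambda>k. norm (real_vec k) * norm (a k)) F \<le> M" using a by linarith
  qed
qed

lemma h1_le_h1_norm: "h1_finite a \<Longrightarrow> h1_le a (h1_norm a)"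
  by (simp add: h1_le_iff)

lemma h1_norm_nonneg: "h1_norm a \<ge> 0"
  by (simp add: h1_norm_def infsum_nonneg)

text \<open>Only the tails of a single sequence are controlled here. Together with \<open>h1_cont_criterion\<close> this gives
the continuity in time of the heat flow of an initial datum.\<close>

lemma h1_tail:
  assumes "h1_finite a" "e > 0"
  shows "\<exists>K. finite K \<and> (\<forall>F. finite F \<longrightarrow> F \<inter> K = {} \<longrightarrow> L2_set (\<lambda>k. norm (real_vec k) * norm (a k)) F \<le> e)"
proof -
  let ?f = "\<lambda>k. (norm (real_vec k) * norm (a k))\<^sup>2"
  from assms(1) have s: "(?f has_sum infsum ?f UNIV) UNIV" by (simp add: h1_finite_def has_sum_infsum)
  then have "eventually (\<lambda>K. dist (sum ?f K) (infsum ?f UNIV) < e\<^sup>2) (finite_subsets_at_top UNIV)"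
    using assms(2) unfolding has_sum_def by (intro tendstoD) auto
  then obtain K where K: "finite K" "\<And>F. finite F \<Longrightarrow> K \<subseteq> F \<Longrightarrow> dist (sum ?f F) (infsum ?f UNIV) < e\<^sup>2"
    unfolding eventually_finite_subsets_at_top by auto
  have "L2_set (\<lambda>k. norm (real_vec k) * norm (a k)) F \<le> e" if F: "finite F" "F \<inter> K = {}" for F
  proof -
    have "sum ?f F + sum ?f K = sum ?f (F \<union> K)" using F K by (intro sum.union_disjoint[symmetric]) auto
    also have "\<dots> \<le> infsum ?f UNIV" using s F K by (intro finite_sum_le_infsum) (auto simp: has_sum_imp_summable)
    finally have "sum ?f F \<le> e\<^sup>2" using K(2)[OF K(1)] by (auto simp: dist_real_def)
    then show ?thesis using assms(2) unfolding L2_set_def by (intro real_le_lsqrt) (auto intro!: sum_nonneg)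
  qed
  with K(1) show ?thesis by blast
qed

section \<open>The bilinear estimate\<close>

text \<open>The contribution of the mode \<open>l\<close> of \<open>b\<close> to the mode \<open>k\<close> of \<open>a \<cdot> \<partial> b\<close>; the factor
\<open>\<i> l\<close> comes from the derivative of \<open>b\<close>.\<close>

definition adv_term :: "(int^3 \<Rightarrow> complex^3) \<Rightarrow> (int^3 \<Rightarrow> complex^3) \<Rightarrow> int^3 \<Rightarrow> int^3 \<Rightarrow> complex^3" where
  "adv_term a b k l = (\<i> * cdot (complex_vec l) (a (k - l))) *s b l"

definition adv_coeff :: "(int^3 \<Rightarrow> complex^3) \<Rightarrow> (int^3 \<Rightarrow> complex^3) \<Rightarrow> int^3 \<Rightarrow> complex^3" where
  "adv_coeff a b k = ((2 * pi) powr (- 3 / 2)) *\<^sub>R (\<Sum>\<^sub>\<infinity>l. adv_term a b k l)"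

text \<open>The coefficients of the Leray projection of \<open>a \<cdot> \<partial> b\<close>.\<close>

definition bilin :: "(int^3 \<Rightarrow> complex^3) \<Rightarrow> (int^3 \<Rightarrow> complex^3) \<Rightarrow> int^3 \<Rightarrow> complex^3" where
  "bilin a b k = leray_symbol k (adv_coeff a b k)"

lemma norm_adv_term_le: "norm (adv_term a b k l) \<le> norm (a (k - l)) * (norm (real_vec l) * norm (b l))"
proof -
  have "norm (cdot (complex_vec l) (a (k - l))) * norm (b l) \<le> norm (real_vec l) * norm (a (k - l)) * norm (b l)"
    using norm_cdot_le[of "complex_vec l" "a (k - l)"] by (intro mult_right_mono) (simp_all add: norm_complex_vec)
  then show ?thesis by (simp add: adv_term_def norm_vector_scalar_mult norm_mult mult_ac)
qed

lemma sum_adv_majorant_le: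
  assumes "h1_le a A" "a 0 = 0" "h1_le b B" "finite L"
  shows "(\<Sum>l\<in>L. norm (a (k - l)) * (norm (real_vec l) * norm (b l))) \<le> A * B"
proof -
  have "(\<Sum>l\<in>L. norm (a (k - l)) * (norm (real_vec l) * norm (b l)))
      = (\<Sum>l\<in>L. \<bar>norm (a (k - l))\<bar> * \<bar>norm (real_vec l) * norm (b l)\<bar>)" by simp
  also have "\<dots> \<le> L2_set (\<lambda>l. norm (a (k - l))) L * L2_set (\<lambda>l. norm (real_vec l) * norm (b l)) L"
    by (rule L2_set_mult_ineq)
  also have "L2_set (\<lambda>l. norm (a (k - l))) L = L2_set (\<lambda>l. norm (a l)) ((\<lambda>l. k - l) ` L)"
    unfolding L2_set_def by (subst sum.reindex) (auto simp: inj_on_def)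
  also have "\<dots> * L2_set (\<lambda>l. norm (real_vec l) * norm (b l)) L \<le> A * B"
    using assms by (intro mult_mono h1_le_L2 h1_leD) (auto simp: L2_set_nonneg intro: h1_le_nonneg)
  finally show ?thesis .
qed

lemma adv_majorant_summable:
  assumes "h1_le a A" "a 0 = 0" "h1_le b B"
  shows "(\<lambda>l. norm (a (k - l)) * (norm (real_vec l) * norm (b l))) summable_on UNIV"
  by (rule nonneg_bdd_above_summable_on) (auto intro!: bdd_aboveI2[where M = "A * B"] sum_adv_majorant_le assms)

lemma adv_term_abs_summable:
  assumes "h1_le a A" "a 0 = 0" "h1_le b B"
  shows "(\<lambda>l. norm (adv_term a b k l)) summable_on UNIV"
  by (rule Infinite_Sum.abs_summable_on_comparison_test'[OF adv_majorant_summable[OF assms]]) (rule norm_adv_term_le)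

lemma adv_term_summable:
  assumes "h1_le a A" "a 0 = 0" "h1_le b B"
  shows "adv_term a b k summable_on UNIV"
  by (rule abs_summable_summable[OF adv_term_abs_summable[OF assms]])

lemma two_pi_powr_le_1: "(2 * pi) powr (- 3 / 2) \<le> 1"
proof -
  have "(2 * pi) powr (- 3 / 2) \<le> (2 * pi) powr 0" using pi_ge_two by (intro powr_mono) auto
  then show ?thesis by simp
qed

lemma norm_bilin_le_infsum:
  assumes "h1_le a A" "a 0 = 0" "h1_le b B"
  shows "norm (bilin a b k) \<le> (2 * pi) powr (- 3 / 2) * (\<Sum>\<^sub>\<infinity>l. norm (a (k - l)) * (norm (real_vec l) * norm (b l)))"
proof -
  have "norm (\<Sum>\<^sub>\<infinity>l. adv_term a b k l) \<le> (\<Sum>\<^sub>\<infinity>l. norm (adv_term a b k l))"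
    by (rule norm_infsum_bound[OF adv_term_abs_summable[OF assms]])
  also have "\<dots> \<le> (\<Sum>\<^sub>\<infinity>l. norm (a (k - l)) * (norm (real_vec l) * norm (b l)))"
    by (intro infsum_mono adv_term_abs_summable[OF assms] adv_majorant_summable[OF assms] norm_adv_term_le)
  finally show ?thesis
    unfolding bilin_def adv_coeff_def
    by (intro order_trans[OF norm_leray_symbol_le]) (auto intro: mult_left_mono)
qed

lemma norm_bilin_le:
  assumes "h1_le a A" "a 0 = 0" "h1_le b B"
  shows "norm (bilin a b k) \<le> A * B"
proof -
  let ?S = "\<Sum>\<^sub>\<infinity>l. norm (a (k - l)) * (norm (real_vec l) * norm (b l))"
  have "?S \<le> A * B" by (intro infsum_le_finite_sums adv_majorant_summable[OF assms] sum_adv_majorant_le[OF assms])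
  moreover have "0 \<le> ?S" by (intro infsum_nonneg) auto
  ultimately have "(2 * pi) powr (- 3 / 2) * ?S \<le> 1 * (A * B)" by (intro mult_mono two_pi_powr_le_1) auto
  then show ?thesis using norm_bilin_le_infsum[OF assms, of k] by linarith
qed

lemma infsum_diff:
  fixes f g :: "'a \<Rightarrow> 'b :: {topological_ab_group_add, t2_space}"
  assumes "f summable_on X" "g summable_on X"
  shows "(\<Sum>\<^sub>\<infinity>x\<in>X. f x - g x) = infsum f X - infsum g X"
  using infsum_add[OF assms(1), of "\<lambda>x. - g x"] assms(2) by (simp add: summable_on_uminus infsum_uminus)

lemma bilin_diff_left:
  assumes "h1_le a A" "a 0 = 0" "h1_le a' A'" "a' 0 = 0" "h1_le b B"
  shows "bilin (\<lambda>k. a k - a' k) b k = bilin a b k - bilin a' b k"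
proof -
  have "adv_term (\<lambda>k. a k - a' k) b k = (\<lambda>l. adv_term a b k l - adv_term a' b k l)"
    by (rule ext) (simp add: adv_term_def cdot_diff_right vec_eq_iff algebra_simps)
  moreover have "(\<Sum>\<^sub>\<infinity>l. adv_term a b k l - adv_term a' b k l) = (\<Sum>\<^sub>\<infinity>l. adv_term a b k l) - (\<Sum>\<^sub>\<infinity>l. adv_term a' b k l)"
    by (rule infsum_diff[OF adv_term_summable[OF assms(1,2,5)] adv_term_summable[OF assms(3,4,5)]])
  ultimately show ?thesis
    by (simp add: bilin_def adv_coeff_def scaleR_diff_right linear_diff[OF bounded_linear.linear[OF bounded_linear_leray_symbol]])
qed

lemma bilin_diff_right:
  assumes "h1_le a A" "a 0 = 0" "h1_le b B" "h1_le b' B'"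
  shows "bilin a (\<lambda>k. b k - b' k) k = bilin a b k - bilin a b' k"
proof -
  have "adv_term a (\<lambda>k. b k - b' k) k = (\<lambda>l. adv_term a b k l - adv_term a b' k l)"
    by (rule ext) (simp add: adv_term_def vec_eq_iff algebra_simps)
  moreover have "(\<Sum>\<^sub>\<infinity>l. adv_term a b k l - adv_term a b' k l) = (\<Sum>\<^sub>\<infinity>l. adv_term a b k l) - (\<Sum>\<^sub>\<infinity>l. adv_term a b' k l)"
    by (rule infsum_diff[OF adv_term_summable[OF assms(1,2,3)] adv_term_summable[OF assms(1,2,4)]])
  ultimately show ?thesis
    by (simp add: bilin_def adv_coeff_def scaleR_diff_right linear_diff[OF bounded_linear.linear[OF bounded_linear_leray_symbol]])
qed

lemma bilin_self_diff:
  assumes "h1_le a A" "a 0 = 0" "h1_le b B" "b 0 = 0"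
  shows "bilin a a k - bilin b b k = bilin (\<lambda>k. a k - b k) a k + bilin b (\<lambda>k. a k - b k) k"
  by (simp add: bilin_diff_left[OF assms(1,2,3,4,1)] bilin_diff_right[OF assms(3,4,1,3)])

definition heat_weight :: "real \<Rightarrow> int^3 \<Rightarrow> real" where
  "heat_weight t k = norm (real_vec k) * exp (- t * (norm (real_vec k))\<^sup>2)"

lemma heat_weight_nonneg: "heat_weight t k \<ge> 0"
  by (simp add: heat_weight_def)

lemma L2_set_kernel_le:
  assumes "t > 0" "finite F"
  shows "L2_set (\<lambda>k. heat_weight t k / norm (real_vec (k - l))) (F - {l}) \<le> (2 * pi) powr (3 / 2) * kernel t"
proof -
  have "(heat_weight t k / norm (real_vec (k - l)))\<^sup>2 = (norm (real_vec k))\<^sup>2 * exp (- 2 * t * (norm (real_vec k))\<^sup>2) / (norm (real_vec (k - l)))\<^sup>2" for k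
    by (simp add: heat_weight_def power_divide power_mult_distrib exp_of_nat_mult[symmetric])
  then have "L2_set (\<lambda>k. heat_weight t k / norm (real_vec (k - l))) (F - {l}) \<le> sqrt ((2 * pi) ^ 3 * (kernel t)\<^sup>2)"
    unfolding L2_set_def using kernel_sum_bound[OF assms, of l] by (intro real_sqrt_le_mono) simp
  also have "\<dots> = sqrt ((2 * pi) ^ 3) * kernel t" by (simp add: real_sqrt_mult kernel_nonneg)
  also have "sqrt ((2 * pi) ^ 3) = ((2 * pi) powr 3) powr (1 / 2)"
    using pi_gt_zero by (subst powr_half_sqrt) (auto simp: powr_numeral)
  also have "\<dots> = (2 * pi) powr (3 / 2)" by (simp only: powr_powr) simp
  finally show ?thesis .
qed

text \<open>The Cauchy-Schwarz inequality is applied twice. For fixed \<open>l\<close> the weight is split as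
\<open>heat_weight t k / |k - l|\<close> times \<open>|k - l|\<close>; the first factor gives the kernel, the second one restores the
\<open>H\<^sup>1\<close> weight of \<open>\<alpha>\<close>. The resulting sequence in \<open>l\<close> is then paired with \<open>\<beta>\<close>.\<close>

lemma weighted_convolution_le:
  fixes \<alpha> \<beta> c :: "int^3 \<Rightarrow> real"
  assumes t: "t > 0" and F: "finite F" and L: "finite L"
    and nn: "\<And>k. \<alpha> k \<ge> 0" "\<And>k. \<beta> k \<ge> 0" "\<And>k. c k \<ge> 0"
    and A: "\<And>G. finite G \<Longrightarrow> L2_set (\<lambda>k. norm (real_vec k) * \<alpha> k) G \<le> A" and a0: "\<alpha> 0 = 0"
    and B: "\<And>G. finite G \<Longrightarrow> L2_set \<beta> G \<le> B"
  shows "(\<Sum>k\<in>F. c k * heat_weight t k * (\<Sum>l\<in>L. \<alpha> (k - l) * \<beta> l)) \<le> ((2 * pi) powr (3 / 2) * kernel t) * A * B * L2_set c F"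
proof -
  let ?G = "(2 * pi) powr (3 / 2) * kernel t"
  let ?al = "\<lambda>k. norm (real_vec k) * \<alpha> k"
  have G: "?G \<ge> 0" by (simp add: kernel_nonneg)
  have A0: "A \<ge> 0" using A[of "{}"] by simp
  have B0: "B \<ge> 0" using B[of "{}"] by simp
  have fixed_l: "(\<Sum>k\<in>F. c k * heat_weight t k * \<alpha> (k - l)) \<le> ?G * L2_set (\<lambda>k. c k * ?al (k - l)) F" for l
  proof -
    have "(\<Sum>k\<in>F. c k * heat_weight t k * \<alpha> (k - l)) = (\<Sum>k\<in>F - {l}. c k * heat_weight t k * \<alpha> (k - l))"
      using F by (intro sum.mono_neutral_right) (auto simp: a0)
    also have "\<dots> = (\<Sum>k\<in>F - {l}. \<bar>heat_weight t k / norm (real_vec (k - l))\<bar> * \<bar>c k * ?al (k - l)\<bar>)"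
    proof (rule sum.cong)
      fix k assume "k \<in> F - {l}"
      then have "norm (real_vec (k - l)) \<noteq> 0" using norm_real_vec_ge_1[of "k - l"] by auto
      then show "c k * heat_weight t k * \<alpha> (k - l) = \<bar>heat_weight t k / norm (real_vec (k - l))\<bar> * \<bar>c k * ?al (k - l)\<bar>"
        using nn heat_weight_nonneg by (simp add: abs_mult)
    qed simp
    also have "\<dots> \<le> L2_set (\<lambda>k. heat_weight t k / norm (real_vec (k - l))) (F - {l}) * L2_set (\<lambda>k. c k * ?al (k - l)) (F - {l})"
      by (rule L2_set_mult_ineq)
    also have "\<dots> \<le> ?G * L2_set (\<lambda>k. c k * ?al (k - l)) F"
    proof (intro mult_mono L2_set_kernel_le t F)
      show "L2_set (\<lambda>k. c k * ?al (k - l)) (F - {l}) \<le> L2_set (\<lambda>k. c k * ?al (k - l)) F"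
        unfolding L2_set_def using F by (intro real_sqrt_le_mono sum_mono2) auto
    qed (use G in \<open>auto simp: L2_set_nonneg\<close>)
    finally show ?thesis .
  qed
  have "(\<Sum>k\<in>F. c k * heat_weight t k * (\<Sum>l\<in>L. \<alpha> (k - l) * \<beta> l))
      = (\<Sum>l\<in>L. \<beta> l * (\<Sum>k\<in>F. c k * heat_weight t k * \<alpha> (k - l)))"
    unfolding sum_distrib_left by (subst sum.swap) (simp add: mult_ac)
  also have "\<dots> \<le> (\<Sum>l\<in>L. \<bar>\<beta> l\<bar> * \<bar>?G * L2_set (\<lambda>k. c k * ?al (k - l)) F\<bar>)"
    using nn fixed_l G by (intro sum_mono mult_mono) (auto intro!: sum_nonneg mult_nonneg_nonneg heat_weight_nonneg order_trans[OF _ abs_ge_self])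
  also have "\<dots> \<le> L2_set \<beta> L * L2_set (\<lambda>l. ?G * L2_set (\<lambda>k. c k * ?al (k - l)) F) L"
    by (rule L2_set_mult_ineq)
  also have "\<dots> \<le> B * (?G * (L2_set c F * A))"
  proof (intro mult_mono B L)
    have "L2_set (\<lambda>l. L2_set (\<lambda>k. c k * ?al (k - l)) F) L = sqrt (\<Sum>l\<in>L. \<Sum>k\<in>F. (c k)\<^sup>2 * (?al (k - l))\<^sup>2)"
      by (simp add: L2_set_def sum_nonneg power_mult_distrib)
    also have "\<dots> = sqrt (\<Sum>k\<in>F. (c k)\<^sup>2 * (\<Sum>l\<in>L. (?al (k - l))\<^sup>2))"
      by (subst sum.swap) (simp add: sum_distrib_left)
    also have "\<dots> \<le> sqrt (\<Sum>k\<in>F. (c k)\<^sup>2 * A\<^sup>2)"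
    proof (intro real_sqrt_le_mono sum_mono mult_left_mono)
      fix k
      have "(\<Sum>l\<in>L. (?al (k - l))\<^sup>2) = (L2_set ?al ((\<lambda>l. k - l) ` L))\<^sup>2"
        unfolding L2_set_def by (subst sum.reindex) (auto simp: inj_on_def sum_nonneg)
      also have "\<dots> \<le> A\<^sup>2" using L by (intro power_mono A) (auto simp: L2_set_nonneg)
      finally show "(\<Sum>l\<in>L. (?al (k - l))\<^sup>2) \<le> A\<^sup>2" .
    qed auto
    also have "\<dots> = L2_set c F * A"
      using A0 by (simp add: L2_set_def sum_distrib_right[symmetric] real_sqrt_mult)
    finally have "?G * L2_set (\<lambda>l. L2_set (\<lambda>k. c k * ?al (k - l)) F) L \<le> ?G * (L2_set c F * A)"
      using G by (intro mult_left_mono)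
    then show "L2_set (\<lambda>l. ?G * L2_set (\<lambda>k. c k * ?al (k - l)) F) L \<le> ?G * (L2_set c F * A)"
      using G by (simp add: L2_set_right_distrib)
  qed (use B0 in \<open>auto simp: L2_set_nonneg\<close>)
  finally show ?thesis by (simp add: mult_ac)
qed

text \<open>The test sequence of the previous lemma is chosen as the sequence to be estimated, and the bound is
divided by its norm.\<close>

lemma heat_bilin_estimate:
  assumes t: "t > 0" and F: "finite F" and a: "h1_le a A" "a 0 = 0" and b: "h1_le b B"
  shows "L2_set (\<lambda>k. heat_weight t k * norm (bilin a b k)) F \<le> kernel t * (A * B)"
proof -
  let ?P = "(2 * pi) powr (3 / 2)" and ?Q = "(2 * pi) powr (- 3 / 2)"
  let ?al = "\<lambda>k. norm (a k)" and ?be = "\<lambda>l. norm (real_vec l) * norm (b l)"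
  define c where "c k = heat_weight t k * norm (bilin a b k)" for k
  have c: "c k \<ge> 0" for k by (simp add: c_def heat_weight_nonneg)
  have lim: "((\<lambda>L. \<Sum>k\<in>F. c k * heat_weight t k * (\<Sum>l\<in>L. ?al (k - l) * ?be l)) \<longlongrightarrow>
     (\<Sum>k\<in>F. c k * heat_weight t k * (\<Sum>\<^sub>\<infinity>l. ?al (k - l) * ?be l))) (finite_subsets_at_top UNIV)"
    by (intro tendsto_sum tendsto_mult_left infsum_tendsto adv_majorant_summable[OF a b])
  have "(\<Sum>k\<in>F. c k * heat_weight t k * (\<Sum>\<^sub>\<infinity>l. ?al (k - l) * ?be l)) \<le> (?P * kernel t) * A * B * L2_set c F"
  proof (rule tendsto_upperbound[OF lim])
    show "\<forall>\<^sub>F L in finite_subsets_at_top UNIV. (\<Sum>k\<in>F. c k * heat_weight t k * (\<Sum>l\<in>L. ?al (k - l) * ?be l)) \<le> (?P * kernel t) * A * B * L2_set c F"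
      unfolding eventually_finite_subsets_at_top
      by (intro exI[of _ "{}"]) (auto intro!: weighted_convolution_le t F c h1_leD[OF a(1)] h1_leD[OF b] simp: a)
  qed simp
  then have main: "?Q * (\<Sum>k\<in>F. c k * heat_weight t k * (\<Sum>\<^sub>\<infinity>l. ?al (k - l) * ?be l)) \<le> ?Q * ((?P * kernel t) * A * B * L2_set c F)"
    by (intro mult_left_mono) auto
  have "(L2_set c F)\<^sup>2 = (\<Sum>k\<in>F. (c k)\<^sup>2)" by (simp add: L2_set_def sum_nonneg)
  also have "\<dots> = (\<Sum>k\<in>F. c k * heat_weight t k * norm (bilin a b k))"
    by (simp only: power2_eq_square c_def mult_ac)
  also have "\<dots> \<le> (\<Sum>k\<in>F. c k * heat_weight t k * (?Q * (\<Sum>\<^sub>\<infinity>l. ?al (k - l) * ?be l)))"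
    by (intro sum_mono mult_left_mono norm_bilin_le_infsum[OF a b] mult_nonneg_nonneg c heat_weight_nonneg)
  also have "\<dots> = ?Q * (\<Sum>k\<in>F. c k * heat_weight t k * (\<Sum>\<^sub>\<infinity>l. ?al (k - l) * ?be l))"
    by (simp add: sum_distrib_left mult_ac)
  also have "\<dots> \<le> ?Q * ((?P * kernel t) * A * B * L2_set c F)" by (rule main)
  also have "\<dots> = (?Q * ?P) * (kernel t * (A * B) * L2_set c F)" by (simp only: mult_ac)
  also have "?Q * ?P = 1" by (simp add: powr_add[symmetric])
  finally have le: "(L2_set c F)\<^sup>2 \<le> kernel t * (A * B) * L2_set c F" by simp
  have nn: "kernel t * (A * B) \<ge> 0" using kernel_nonneg h1_le_nonneg[OF a(1)] h1_le_nonneg[OF b] by simp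
  have "L2_set c F \<le> kernel t * (A * B)"
  proof (cases "L2_set c F = 0")
    case False
    then have "L2_set c F > 0" using L2_set_nonneg[of c F] by linarith
    then show ?thesis using le by (simp add: power2_eq_square)
  qed (use nn in simp)
  moreover have "c = (\<lambda>k. heat_weight t k * norm (bilin a b k))" by (rule ext) (rule c_def)
  ultimately show ?thesis by simp
qed

text \<open>Half of the heat factor is spent on making high frequencies small, the other half on the bilinear
estimate. This makes the tails of the Duhamel term small uniformly in time.\<close>

lemma heat_bilin_tail_estimate:
  assumes t: "t > 0" and F: "finite F" and a: "h1_le a A" "a 0 = 0" and b: "h1_le b B"
    and R: "\<And>k. k \<in> F \<Longrightarrow> R \<le> (norm (real_vec k))\<^sup>2"
  shows "L2_set (\<lambda>k. heat_weight t k * norm (bilin a b k)) F \<le> exp (- (t / 2) * R) * (kernel (t / 2) * (A * B))"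
proof -
  have "L2_set (\<lambda>k. heat_weight t k * norm (bilin a b k)) F \<le> L2_set (\<lambda>k. exp (- (t / 2) * R) * (heat_weight (t / 2) k * norm (bilin a b k))) F"
  proof (rule L2_set_mono)
    fix k assume k: "k \<in> F"
    have "t / 2 * R \<le> t / 2 * (norm (real_vec k))\<^sup>2" using t R[OF k] by (intro mult_left_mono) auto
    then have "exp (- t * (norm (real_vec k))\<^sup>2) \<le> exp (- (t / 2) * R) * exp (- (t / 2) * (norm (real_vec k))\<^sup>2)"
      by (simp add: exp_add[symmetric] field_simps)
    then have "(norm (real_vec k) * norm (bilin a b k)) * exp (- t * (norm (real_vec k))\<^sup>2)
       \<le> (norm (real_vec k) * norm (bilin a b k)) * (exp (- (t / 2) * R) * exp (- (t / 2) * (norm (real_vec k))\<^sup>2))"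
      by (intro mult_left_mono) auto
    then show "heat_weight t k * norm (bilin a b k) \<le> exp (- (t / 2) * R) * (heat_weight (t / 2) k * norm (bilin a b k))"
      by (simp only: heat_weight_def mult_ac)
  qed (simp add: heat_weight_nonneg)
  also have "\<dots> = exp (- (t / 2) * R) * L2_set (\<lambda>k. heat_weight (t / 2) k * norm (bilin a b k)) F"
    by (rule L2_set_right_distrib[symmetric]) simp
  also have "\<dots> \<le> exp (- (t / 2) * R) * (kernel (t / 2) * (A * B))"
    using t by (intro mult_left_mono heat_bilin_estimate F a b) auto
  finally show ?thesis .
qed

section \<open>Real solenoidal sequences\<close>

definition admissible :: "(int^3 \<Rightarrow> complex^3) \<Rightarrow> bool" where
  "admissible a \<longleftrightarrow> a 0 = 0 \<and> (\<forall>k. cdot (complex_vec k) (a k) = 0) \<and> (\<forall>k. a (- k) = cnj_vec (a k))"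

text \<open>The mean of \<open>a \<cdot> \<partial> b\<close> vanishes because \<open>a\<close> is divergence free: the mode \<open>l\<close> of \<open>b\<close> meets the mode
\<open>- l\<close> of \<open>a\<close>, which is orthogonal to \<open>l\<close>.\<close>

lemma bilin_zero:
  assumes "admissible a" shows "bilin a b 0 = 0"
proof -
  have "adv_term a b 0 l = 0" for l
  proof -
    have "cdot (complex_vec l) (a (- l)) = - cdot (complex_vec (- l)) (a (- l))"
      by (simp add: complex_vec_uminus cdot_minus_left)
    moreover have "cdot (complex_vec (- l)) (a (- l)) = 0" using assms unfolding admissible_def by blast
    ultimately show ?thesis by (simp add: adv_term_def)
  qed
  then show ?thesis by (simp add: bilin_def adv_coeff_def leray_symbol_def)
qed

lemma bilin_div_free: "cdot (complex_vec k) (bilin a b k) = 0"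
  by (simp add: bilin_def cdot_leray_symbol)

lemma bilin_cnj:
  assumes "admissible a" "admissible b" "h1_le a A" "h1_le b B"
  shows "bilin a b (- k) = cnj_vec (bilin a b k)"
proof -
  have a0: "a 0 = 0" using assms(1) by (simp add: admissible_def)
  have re: "adv_term a b (- k) (- l) = cnj_vec (adv_term a b k l)" for l
  proof -
    have "a (- k - - l) = a (- (k - l))" by simp
    also have "\<dots> = cnj_vec (a (k - l))" using assms by (simp only: admissible_def)
    finally have "a (- k - - l) = cnj_vec (a (k - l))" .
    moreover have "b (- l) = cnj_vec (b l)" using assms by (simp only: admissible_def)
    ultimately show ?thesis
      by (simp add: adv_term_def complex_vec_uminus cdot_minus_left cdot_cnj_complex_vec cnj_vec_smult)
  qed
  have "(\<Sum>\<^sub>\<infinity>l. adv_term a b (- k) l) = (\<Sum>\<^sub>\<infinity>l. adv_term a b (- k) (- l))"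
    by (rule infsum_reindex_bij_betw[symmetric]) (rule bij_betw_byWitness[where f' = uminus], auto)
  also have "\<dots> = (\<Sum>\<^sub>\<infinity>l. cnj_vec (adv_term a b k l))" by (simp only: re)
  also have "\<dots> = cnj_vec (\<Sum>\<^sub>\<infinity>l. adv_term a b k l)"
    by (rule infsumI[OF has_sum_bounded_linear[OF bounded_linear_cnj_vec has_sum_infsum[OF adv_term_summable[OF assms(3) a0 assms(4)]]]])
  finally show ?thesis
    by (simp add: bilin_def adv_coeff_def leray_symbol_cnj[symmetric] cnj_vec_scaleR)
qed

section \<open>Curves of sequences\<close>

lemma powr_le_exp:
  fixes x :: real assumes "x > 0" "0 \<le> a" "a \<le> 1"
  shows "x powr a \<le> exp x"
proof -
  have "x powr a \<le> (1 + x) powr a" using assms by (intro powr_mono2) auto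
  also have "\<dots> \<le> (1 + x) powr 1" using assms by (intro powr_mono) auto
  also have "\<dots> \<le> exp x" using assms exp_ge_add_one_self[of x] by simp
  finally show ?thesis .
qed

text \<open>The bound \<open>exp (- x) \<le> x powr (- 1 / 8)\<close> trades a large exponent \<open>l\<close> for the small factor
\<open>l powr (- 1 / 8)\<close> and worsens the singularity from \<open>s powr (- 3 / 4)\<close> to \<open>s powr (- 7 / 8)\<close>, which is still
integrable. The estimate with \<open>s\<close> serves for uniqueness, the one with \<open>s / 2\<close> for the tails in
\<open>heat_bilin_tail_estimate\<close>.\<close>

lemma kernel_exp_small_integral:
  fixes T e :: real
  assumes T: "T \<ge> 0" and e: "e > 0"
  obtains R where "R > 0" "\<And>l t. l \<ge> R \<Longrightarrow> 0 \<le> t \<Longrightarrow> t \<le> T \<Longrightarrow>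
     \<exists>h I. (h has_integral I) {0..t} \<and> I \<le> e \<and> (\<forall>s. 0 < s \<longrightarrow> s \<le> t \<longrightarrow> kernel s * exp (- l * s) \<le> h s
        \<and> kernel (s / 2) * exp (- l * (s / 2)) \<le> h s)"
proof -
  obtain K where K: "K \<ge> 0" "\<And>t. t > 0 \<Longrightarrow> kernel t \<le> K * t powr (- 3 / 4)" using kernel_le_powr by blast
  define c where "c = 16 * K * T powr (1 / 8)"
  \<comment> \<open>The integral will be at most \<open>c * R powr (- 1 / 8)\<close>, which this choice makes at most \<open>e\<close>.\<close>
  define R where "R = (c / e + 1) powr 8"
  have c: "c \<ge> 0" using K by (simp add: c_def)
  then have ce: "c / e + 1 > 0" using e by (simp add: add_nonneg_pos)
  have R: "R > 0" unfolding R_def using ce by (subst powr_gt_zero) auto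
  have pt: "kernel s * exp (- l * s) \<le> K * l powr (- 1 / 8) * s powr (- 7 / 8)" if "s > 0" "l > 0" for s l
  proof -
    have "exp (- (l * s)) \<le> (l * s) powr (- 1 / 8)"
      using powr_le_exp[of "l * s" "1 / 8"] that by (simp add: exp_minus powr_minus_divide field_simps)
    then have "kernel s * exp (- l * s) \<le> (K * s powr (- 3 / 4)) * (l * s) powr (- 1 / 8)"
      using that K by (intro mult_mono) auto
    also have "\<dots> = K * l powr (- 1 / 8) * (s powr (- 3 / 4) * s powr (- 1 / 8))"
      using that by (simp add: powr_mult)
    also have "s powr (- 3 / 4) * s powr (- 1 / 8) = s powr (- 7 / 8)" by (simp add: powr_add[symmetric])
    finally show ?thesis .
  qed
  show ?thesis
  proof (rule that[OF R])
    fix l t :: real assume l: "l \<ge> R" and t: "0 \<le> t" "t \<le> T"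
    have l0: "l > 0" using R l by linarith
    let ?h = "\<lambda>s. 2 * K * l powr (- 1 / 8) * s powr (- 7 / 8)"
    let ?I = "2 * K * l powr (- 1 / 8) * (t powr (- 7 / 8 + 1) / (- 7 / 8 + 1))"
    have I: "(?h has_integral ?I) {0..t}"
      using t by (intro has_integral_mult_right has_integral_powr_from_0) auto
    have "?I = 16 * K * t powr (1 / 8) * l powr (- 1 / 8)" by simp
    also have "\<dots> \<le> c * l powr (- 1 / 8)"
      unfolding c_def using K t by (intro mult_right_mono mult_left_mono powr_mono2) auto
    also have "\<dots> \<le> c * R powr (- 1 / 8)"
      using c R l by (intro mult_left_mono powr_mono2') auto
    also have "R powr (- 1 / 8) = (c / e + 1) powr (8 * (- 1 / 8))" unfolding R_def by (rule powr_powr)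
    also have "\<dots> = 1 / (c / e + 1)" using ce by (simp add: powr_minus_divide)
    also have "c * (1 / (c / e + 1)) \<le> e"
      using ce e by (simp add: field_simps)
    finally have Ie: "?I \<le> e" .
    have "kernel s * exp (- l * s) \<le> ?h s \<and> kernel (s / 2) * exp (- l * (s / 2)) \<le> ?h s" if s: "0 < s" for s
    proof
      have nn: "0 \<le> K * l powr (- 1 / 8) * s powr (- 7 / 8)" using K by simp
      show "kernel s * exp (- l * s) \<le> ?h s" using pt[OF s l0] nn by linarith
      have "(s / 2) powr (- 7 / 8) = s powr (- 7 / 8) * 2 powr (7 / 8)"
        using s by (simp add: powr_divide powr_minus_divide)
      also have "\<dots> \<le> s powr (- 7 / 8) * 2 powr 1" by (intro mult_left_mono powr_mono) auto
      finally have "K * l powr (- 1 / 8) * (s / 2) powr (- 7 / 8) \<le> K * l powr (- 1 / 8) * (s powr (- 7 / 8) * 2)"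
        using K by (intro mult_left_mono) auto
      then show "kernel (s / 2) * exp (- l * (s / 2)) \<le> ?h s" using pt[of "s / 2" l] s l0 by simp
    qed
    with I Ie show "\<exists>h I. (h has_integral I) {0..t} \<and> I \<le> e \<and> (\<forall>s. 0 < s \<longrightarrow> s \<le> t \<longrightarrow> kernel s * exp (- l * s) \<le> h s
        \<and> kernel (s / 2) * exp (- l * (s / 2)) \<le> h s)" by blast
  qed
qed

definition h1_cont :: "(real \<Rightarrow> int^3 \<Rightarrow> complex^3) \<Rightarrow> real set \<Rightarrow> bool" where
  "h1_cont u S \<longleftrightarrow> (\<forall>t\<in>S. \<forall>e>0. \<exists>d>0. \<forall>t'\<in>S. \<bar>t' - t\<bar> < d \<longrightarrow> h1_le (\<lambda>k. u t' k - u t k) e)"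

definition curve :: "(real \<Rightarrow> int^3 \<Rightarrow> complex^3) \<Rightarrow> real set \<Rightarrow> bool" where
  "curve u S \<longleftrightarrow> h1_cont u S \<and> (\<forall>t\<in>S. admissible (u t) \<and> h1_finite (u t))"

lemma h1_contE:
  assumes "h1_cont u S" "t \<in> S" "e > 0"
  obtains d where "d > 0" "\<And>t'. t' \<in> S \<Longrightarrow> \<bar>t' - t\<bar> < d \<Longrightarrow> h1_le (\<lambda>k. u t' k - u t k) e"
  using assms unfolding h1_cont_def by blast

lemma h1_cont_subset: "h1_cont u S \<Longrightarrow> S' \<subseteq> S \<Longrightarrow> h1_cont u S'"
  unfolding h1_cont_def by (meson subsetD)

lemma admissible_0: "admissible a \<Longrightarrow> a 0 = 0"
  by (simp add: admissible_def)

lemma admissible_diff: "admissible a \<Longrightarrow> admissible b \<Longrightarrow> admissible (\<lambda>k. a k - b k)"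
  by (simp add: admissible_def cdot_diff_right cnj_vec_diff)

lemma h1_finite_diff: "h1_finite a \<Longrightarrow> h1_finite b \<Longrightarrow> h1_finite (\<lambda>k. a k - b k)"
  using h1_le_diff[OF h1_le_h1_norm h1_le_h1_norm] by (simp add: h1_le_iff)

lemma h1_norm_le_add: assumes "h1_finite b" "h1_le (\<lambda>k. a k - b k) e" shows "h1_norm a \<le> h1_norm b + e"
  using h1_le_add[OF h1_le_h1_norm[OF assms(1)] assms(2)] by (simp add: h1_le_iff)

lemma h1_cont_diff:
  assumes "h1_cont u S" "h1_cont v S" shows "h1_cont (\<lambda>t k. u t k - v t k) S"
  unfolding h1_cont_def
proof (intro ballI allI impI)
  fix t e :: real assume t: "t \<in> S" and e: "e > 0"
  have e2: "e / 2 > 0" using e by simp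
  obtain d1 where d1: "d1 > 0" "\<And>t'. t' \<in> S \<Longrightarrow> \<bar>t' - t\<bar> < d1 \<Longrightarrow> h1_le (\<lambda>k. u t' k - u t k) (e / 2)"
    using h1_contE[OF assms(1) t e2] by blast
  obtain d2 where d2: "d2 > 0" "\<And>t'. t' \<in> S \<Longrightarrow> \<bar>t' - t\<bar> < d2 \<Longrightarrow> h1_le (\<lambda>k. v t' k - v t k) (e / 2)"
    using h1_contE[OF assms(2) t e2] by blast
  note d = d1 d2
  show "\<exists>d>0. \<forall>t'\<in>S. \<bar>t' - t\<bar> < d \<longrightarrow> h1_le (\<lambda>k. u t' k - v t' k - (u t k - v t k)) e"
  proof (intro exI[of _ "min d1 d2"] conjI ballI impI)
    fix t' assume t': "t' \<in> S" "\<bar>t' - t\<bar> < min d1 d2"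
    have "h1_le (\<lambda>k. (u t' k - u t k) - (v t' k - v t k)) (e / 2 + e / 2)"
      using d t' by (intro h1_le_diff) auto
    moreover have "(u t' k - u t k) - (v t' k - v t k) = u t' k - v t' k - (u t k - v t k)" for k by simp
    ultimately show "h1_le (\<lambda>k. u t' k - v t' k - (u t k - v t k)) e" by simp
  qed (use d in auto)
qed

lemma curve_diff: "curve u S \<Longrightarrow> curve v S \<Longrightarrow> curve (\<lambda>t k. u t k - v t k) S"
  by (simp add: curve_def h1_cont_diff admissible_diff h1_finite_diff)

text \<open>The norm is a continuous function on a compact interval.\<close>

lemma curve_bounded:
  assumes u: "curve u {0..T}"
  obtains M where "M > 0" "\<And>t. t \<in> {0..T} \<Longrightarrow> h1_le (u t) M"
proof -
  have "continuous_on {0..T} (\<lambda>t. h1_norm (u t))"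
    unfolding continuous_on_iff
  proof (intro ballI allI impI)
    fix t e :: real assume t: "t \<in> {0..T}" and e: "e > 0"
    have e2: "e / 2 > 0" using e by simp
    have uc: "h1_cont u {0..T}" using u by (simp add: curve_def)
    obtain d where d: "d > 0" "\<And>t'. t' \<in> {0..T} \<Longrightarrow> \<bar>t' - t\<bar> < d \<Longrightarrow> h1_le (\<lambda>k. u t' k - u t k) (e / 2)"
      using h1_contE[OF uc t e2] by blast
    show "\<exists>d>0. \<forall>t'\<in>{0..T}. dist t' t < d \<longrightarrow> dist (h1_norm (u t')) (h1_norm (u t)) < e"
    proof (intro exI[of _ d] conjI ballI impI d)
      fix t' assume t': "t' \<in> {0..T}" "dist t' t < d"
      then have le: "h1_le (\<lambda>k. u t' k - u t k) (e / 2)" using d by (auto simp: dist_real_def)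
      have "h1_norm (u t') \<le> h1_norm (u t) + e / 2" using u t le by (intro h1_norm_le_add) (auto simp: curve_def)
      moreover have "h1_norm (u t) \<le> h1_norm (u t') + e / 2"
        using u t' le[unfolded h1_le_diff_commute[of "u t'"]] by (intro h1_norm_le_add) (auto simp: curve_def)
      ultimately show "dist (h1_norm (u t')) (h1_norm (u t)) < e" using e by (auto simp: dist_real_def)
    qed
  qed
  then have "bounded ((\<lambda>t. h1_norm (u t)) ` {0..T})"
    by (intro compact_imp_bounded compact_continuous_image) auto
  then obtain M where M: "\<forall>t\<in>{0..T}. \<bar>h1_norm (u t)\<bar> \<le> M" unfolding bounded_iff by auto
  show ?thesis
  proof (rule that[of "\<bar>M\<bar> + 1"])
    fix t assume "t \<in> {0..T}"
    then show "h1_le (u t) (\<bar>M\<bar> + 1)" using M u by (force simp: h1_le_iff curve_def)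
  qed simp
qed

lemma curve_continuous_bilin:
  assumes u: "curve u {0..T}" and w: "curve w {0..T}"
  shows "continuous_on {0..T} (\<lambda>t. bilin (u t) (w t) k)"
  unfolding continuous_on_iff
proof (intro ballI allI impI)
  fix t e :: real assume t: "t \<in> {0..T}" and e: "e > 0"
  obtain M where M: "M > 0" "\<And>t. t \<in> {0..T} \<Longrightarrow> h1_le (u t) M" by (rule curve_bounded[OF u]) blast
  obtain N where N: "N > 0" "\<And>t. t \<in> {0..T} \<Longrightarrow> h1_le (w t) N" by (rule curve_bounded[OF w]) blast
  define \<epsilon> where "\<epsilon> = e / (2 * (M + N))"
  have ep: "\<epsilon> > 0" using e M N by (simp add: \<epsilon>_def)
  have uc: "h1_cont u {0..T}" "h1_cont w {0..T}" using u w by (simp_all add: curve_def)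
  obtain d1 where d1: "d1 > 0" "\<And>t'. t' \<in> {0..T} \<Longrightarrow> \<bar>t' - t\<bar> < d1 \<Longrightarrow> h1_le (\<lambda>k. u t' k - u t k) \<epsilon>"
    using h1_contE[OF uc(1) t ep] by blast
  obtain d2 where d2: "d2 > 0" "\<And>t'. t' \<in> {0..T} \<Longrightarrow> \<bar>t' - t\<bar> < d2 \<Longrightarrow> h1_le (\<lambda>k. w t' k - w t k) \<epsilon>"
    using h1_contE[OF uc(2) t ep] by blast
  note d = d1 d2
  show "\<exists>d>0. \<forall>t'\<in>{0..T}. dist t' t < d \<longrightarrow> dist (bilin (u t') (w t') k) (bilin (u t) (w t) k) < e"
  proof (intro exI[of _ "min d1 d2"] conjI ballI impI)
    fix t' assume t': "t' \<in> {0..T}" "dist t' t < min d1 d2"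
    have du: "h1_le (\<lambda>k. u t' k - u t k) \<epsilon>" and dw: "h1_le (\<lambda>k. w t' k - w t k) \<epsilon>"
      using d t' by (auto simp: dist_real_def)
    have z: "u t 0 = 0" "u t' 0 = 0" using u t t' by (auto simp: curve_def admissible_0)
    have "bilin (u t') (w t') k - bilin (u t) (w t) k
        = bilin (\<lambda>k. u t' k - u t k) (w t') k + bilin (u t) (\<lambda>k. w t' k - w t k) k"
      by (simp add: bilin_diff_left[OF M(2)[OF t'(1)] z(2) M(2)[OF t] z(1) N(2)[OF t'(1)]]
          bilin_diff_right[OF M(2)[OF t] z(1) N(2)[OF t'(1)] N(2)[OF t]])
    moreover have "norm (bilin (\<lambda>k. u t' k - u t k) (w t') k) \<le> \<epsilon> * N"
      using z by (intro norm_bilin_le du N t') auto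
    moreover have "norm (bilin (u t) (\<lambda>k. w t' k - w t k) k) \<le> M * \<epsilon>"
      using z by (intro norm_bilin_le dw M t) auto
    ultimately have "norm (bilin (u t') (w t') k - bilin (u t) (w t) k) \<le> \<epsilon> * N + M * \<epsilon>"
      by (simp only:) (rule order_trans[OF norm_triangle_ineq add_mono])
    also have "\<dots> = e / 2"
    proof -
      have "\<epsilon> * (2 * (M + N)) = e" using M(1) N(1) by (simp add: \<epsilon>_def)
      then show ?thesis by (simp add: algebra_simps)
    qed
    finally show "dist (bilin (u t') (w t') k) (bilin (u t) (w t) k) < e" using e by (simp add: dist_norm)
  qed (use d in auto)
qed

lemma L2_set_Un_le:
  assumes "finite F" shows "L2_set f F \<le> L2_set f (F \<inter> K) + L2_set f (F - K)"
proof -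
  have "(\<Sum>k\<in>F. (f k)\<^sup>2) = (\<Sum>k\<in>F \<inter> K. (f k)\<^sup>2) + (\<Sum>k\<in>F - K. (f k)\<^sup>2)"
    using assms by (subst sum.union_disjoint[symmetric]) (auto intro!: sum.cong)
  then show ?thesis unfolding L2_set_def by (simp add: sqrt_add_le_add_sqrt sum_nonneg)
qed

text \<open>Finitely many components are continuous together, and the tails are uniformly small.\<close>

lemma h1_cont_criterion:
  assumes cont: "\<And>k. continuous_on S (\<lambda>t. u t k)"
    and tail: "\<And>e. e > 0 \<Longrightarrow> \<exists>K. finite K \<and> (\<forall>t\<in>S. \<forall>F. finite F \<longrightarrow> F \<inter> K = {} \<longrightarrow> L2_set (\<lambda>k. norm (real_vec k) * norm (u t k)) F \<le> e)"
  shows "h1_cont u S"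
  unfolding h1_cont_def
proof (intro ballI allI impI)
  fix t e :: real assume t: "t \<in> S" and e: "e > 0"
  obtain K where K: "finite K" "\<And>t F. t \<in> S \<Longrightarrow> finite F \<Longrightarrow> F \<inter> K = {} \<Longrightarrow> L2_set (\<lambda>k. norm (real_vec k) * norm (u t k)) F \<le> e / 3"
    using tail[of "e / 3"] e by auto
  define g where "g t' = (\<Sum>k\<in>K. norm (real_vec k) * norm (u t' k - u t k))" for t'
  have "continuous_on S g"
    unfolding g_def by (intro continuous_intros cont)
  moreover have "e / 3 > 0" using e by simp
  ultimately obtain d where d: "d > 0" "\<And>t'. t' \<in> S \<Longrightarrow> dist t' t < d \<Longrightarrow> dist (g t') (g t) < e / 3"
    using t unfolding continuous_on_iff by blast
  show "\<exists>d>0. \<forall>t'\<in>S. \<bar>t' - t\<bar> < d \<longrightarrow> h1_le (\<lambda>k. u t' k - u t k) e"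
  proof (intro exI[of _ d] conjI ballI impI d(1) h1_leI)
    fix t' and F :: "(int^3) set" assume t': "t' \<in> S" "\<bar>t' - t\<bar> < d" and F: "finite F"
    let ?f = "\<lambda>k. norm (real_vec k) * norm (u t' k - u t k)"
    have "L2_set ?f (F \<inter> K) \<le> sum ?f (F \<inter> K)" by (rule L2_set_le_sum) auto
    also have "\<dots> \<le> sum ?f K" using K by (intro sum_mono2) auto
    also have "\<dots> \<le> e / 3" using d(2)[OF t'(1)] t'(2) by (simp add: dist_real_def g_def)
    finally have 1: "L2_set ?f (F \<inter> K) \<le> e / 3" .
    have "L2_set ?f (F - K) \<le> L2_set (\<lambda>k. norm (real_vec k) * norm (u t' k)) (F - K) + L2_set (\<lambda>k. norm (real_vec k) * norm (- u t k)) (F - K)"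
      using L2_set_norm_triangle[of "u t'" "\<lambda>k. - u t k" "F - K"] by simp
    also have "\<dots> \<le> e / 3 + e / 3"
      using K(2)[of t' "F - K"] K(2)[of t "F - K"] t t' F by (intro add_mono) auto
    finally show "L2_set ?f F \<le> e" using 1 L2_set_Un_le[OF F, of ?f K] by linarith
  qed
qed

lemma h1_cont_atLeast: assumes "\<And>T. h1_cont u {0..T}" shows "h1_cont u {0..}"
  unfolding h1_cont_def
proof (intro ballI allI impI)
  fix t e :: real assume t: "t \<in> {0..}" and e: "e > 0"
  have "t \<in> {0..t + 1}" using t by auto
  then obtain d where d: "d > 0" "\<And>t'. t' \<in> {0..t+1} \<Longrightarrow> \<bar>t' - t\<bar> < d \<Longrightarrow> h1_le (\<lambda>k. u t' k - u t k) e"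
    using h1_contE[OF assms[of "t + 1"] _ e] by blast
  show "\<exists>d>0. \<forall>t'\<in>{0..}. \<bar>t' - t\<bar> < d \<longrightarrow> h1_le (\<lambda>k. u t' k - u t k) e"
    using d by (intro exI[of _ "min d 1"]) auto
qed

text \<open>The usual \<open>e / 3\<close> argument; the Picard iterates converge uniformly in time.\<close>

lemma h1_cont_uniform_limit:
  assumes "\<And>n. h1_cont (u n) S" and le: "\<And>n t. t \<in> S \<Longrightarrow> h1_le (\<lambda>k. v t k - u n t k) (r n)" and r: "r \<longlonglongrightarrow> (0::real)"
  shows "h1_cont v S"
  unfolding h1_cont_def
proof (intro ballI allI impI)
  fix t e :: real assume t: "t \<in> S" and e: "e > 0"
  from order_tendstoD(2)[OF r, of "e / 3"] e obtain n where n: "r n < e / 3" by (auto simp: eventually_sequentially)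
  have e3: "e / 3 > 0" using e by simp
  obtain d where d: "d > 0" "\<And>t'. t' \<in> S \<Longrightarrow> \<bar>t' - t\<bar> < d \<Longrightarrow> h1_le (\<lambda>k. u n t' k - u n t k) (e / 3)"
    using h1_contE[OF assms(1) t e3] by blast
  show "\<exists>d>0. \<forall>t'\<in>S. \<bar>t' - t\<bar> < d \<longrightarrow> h1_le (\<lambda>k. v t' k - v t k) e"
  proof (intro exI[of _ d] conjI ballI impI d(1))
    fix t' assume t': "t' \<in> S" "\<bar>t' - t\<bar> < d"
    have "h1_le (\<lambda>k. (v t' k - u n t' k) + (u n t' k - u n t k) - (v t k - u n t k)) (r n + e / 3 + r n)"
      using d t' t by (intro h1_le_diff h1_le_add le) auto
    then have "h1_le (\<lambda>k. v t' k - v t k) (r n + e / 3 + r n)" by (simp add: algebra_simps)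
    then show "h1_le (\<lambda>k. v t' k - v t k) e" by (rule h1_le_mono) (use n in linarith)
  qed
qed

section \<open>The Duhamel term\<close>

text \<open>Minkowski's integral inequality: the square of the norm of the integral is the integral of the inner
product with a fixed vector, namely the integral itself. The end point \<open>t\<close> is exempt from the bound since the
kernel is singular there.\<close>

lemma L2_set_integral_le:
  fixes g :: "real \<Rightarrow> int^3 \<Rightarrow> complex^3" and w :: "int^3 \<Rightarrow> real"
  assumes F: "finite F" and cont: "\<And>k. k \<in> F \<Longrightarrow> continuous_on {0..t} (\<lambda>s. g s k)" and w: "\<And>k. w k \<ge> 0"
    and h: "(h has_integral I) {0..t}" and le: "\<And>s. 0 \<le> s \<Longrightarrow> s < t \<Longrightarrow> L2_set (\<lambda>k. w k * norm (g s k)) F \<le> h s"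
  shows "L2_set (\<lambda>k. w k * norm (integral {0..t} (\<lambda>s. g s k))) F \<le> I"
proof -
  define v where "v k = integral {0..t} (\<lambda>s. g s k)" for k
  define S where "S = L2_set (\<lambda>k. w k * norm (v k)) F"
  \<comment> \<open>Changing the majorant at one point extends the bound to the end point.\<close>
  define h' where "h' s = (if s = t then L2_set (\<lambda>k. w k * norm (g t k)) F else h s)" for s
  have h': "(h' has_integral I) {0..t}"
    by (rule has_integral_spike_finite[OF _ _ h, of "{t}"]) (auto simp: h'_def)
  have le': "L2_set (\<lambda>k. w k * norm (g s k)) F \<le> h' s" if "s \<in> {0..t}" for s
    using le that by (auto simp: h'_def)
  have h0: "h' s \<ge> 0" if "s \<in> {0..t}" for s
    using le'[OF that] L2_set_nonneg[of "\<lambda>k. w k * norm (g s k)" F] by linarith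
  have I0: "I \<ge> 0" by (rule has_integral_nonneg[OF h' h0])
  have S0: "S \<ge> 0" by (simp add: S_def L2_set_nonneg)
  have "((\<lambda>s. \<Sum>k\<in>F. (w k)\<^sup>2 * (v k \<bullet> g s k)) has_integral (\<Sum>k\<in>F. (w k)\<^sup>2 * (v k \<bullet> v k))) {0..t}"
  proof (intro has_integral_sum F has_integral_mult_right)
    fix k assume k: "k \<in> F"
    have "((\<lambda>s. g s k) has_integral v k) {0..t}"
      unfolding v_def by (intro integrable_integral integrable_continuous_interval cont k)
    from has_integral_linear[OF this bounded_linear_inner_right[of "v k"]]
    show "((\<lambda>s. v k \<bullet> g s k) has_integral v k \<bullet> v k) {0..t}" by (simp add: o_def)
  qed
  moreover have "(\<Sum>k\<in>F. (w k)\<^sup>2 * (v k \<bullet> v k)) = S\<^sup>2"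
    by (simp add: S_def L2_set_def sum_nonneg power_mult_distrib power2_norm_eq_inner)
  ultimately have LHS: "((\<lambda>s. \<Sum>k\<in>F. (w k)\<^sup>2 * (v k \<bullet> g s k)) has_integral S\<^sup>2) {0..t}" by simp
  have "S\<^sup>2 \<le> S * I"
  proof (rule has_integral_le[OF LHS has_integral_mult_right[OF h', of S]])
    fix s assume s: "s \<in> {0..t}"
    have "(\<Sum>k\<in>F. (w k)\<^sup>2 * (v k \<bullet> g s k)) \<le> (\<Sum>k\<in>F. \<bar>w k * norm (v k)\<bar> * \<bar>w k * norm (g s k)\<bar>)"
    proof (rule sum_mono)
      fix k
      have "(w k)\<^sup>2 * (v k \<bullet> g s k) \<le> (w k)\<^sup>2 * (norm (v k) * norm (g s k))"
        by (intro mult_left_mono norm_cauchy_schwarz) auto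
      then show "(w k)\<^sup>2 * (v k \<bullet> g s k) \<le> \<bar>w k * norm (v k)\<bar> * \<bar>w k * norm (g s k)\<bar>"
        using w[of k] by (simp add: abs_mult power2_eq_square mult_ac)
    qed
    also have "\<dots> \<le> S * L2_set (\<lambda>k. w k * norm (g s k)) F"
      unfolding S_def by (rule L2_set_mult_ineq)
    also have "\<dots> \<le> S * h' s" by (intro mult_left_mono le' s S0)
    finally show "(\<Sum>k\<in>F. (w k)\<^sup>2 * (v k \<bullet> g s k)) \<le> S * h' s" .
  qed
  then have "S \<le> I"
    using I0 S0 by (cases "S = 0") (auto simp: power2_eq_square mult_le_cancel_left)
  then show ?thesis by (simp add: S_def v_def)
qed

text \<open>The coefficients of the time integral of \<open>exp ((t - s) \<Delta>) \<LL> (u s \<cdot> \<partial> w s)\<close>.\<close>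

definition duhamel :: "(real \<Rightarrow> int^3 \<Rightarrow> complex^3) \<Rightarrow> (real \<Rightarrow> int^3 \<Rightarrow> complex^3) \<Rightarrow> real \<Rightarrow> int^3 \<Rightarrow> complex^3" where
  "duhamel u w t k = integral {0..t} (\<lambda>s. exp (- (t - s) * (norm (real_vec k))\<^sup>2) *\<^sub>R bilin (u s) (w s) k)"

lemma continuous_duhamel_integrand:
  assumes "curve u {0..T}" "curve w {0..T}" "t \<le> T"
  shows "continuous_on {0..t} (\<lambda>s. exp (- (r - s) * (norm (real_vec k))\<^sup>2) *\<^sub>R bilin (u s) (w s) k)"
  using assms by (intro continuous_intros continuous_on_subset[OF curve_continuous_bilin[OF assms(1,2)]]) auto

lemma has_integral_reversed:
  fixes h :: "real \<Rightarrow> real"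
  assumes "(h has_integral I) {0..t}" shows "((\<lambda>s. h (t - s)) has_integral I) {0..t}"
proof -
  have "(((\<lambda>x. h (- x)) \<circ> (+) (- t)) has_integral I) {0..t}"
    unfolding has_integral_shift_Icc_real using has_integral_reflect_lemma_real[OF assms] by simp
  then show ?thesis by (simp add: o_def)
qed

text \<open>The exponent \<open>\<mu>\<close> allows two uses: \<open>\<mu> = - 2\<close> for the decaying global solution and large positive
\<open>\<mu>\<close> for uniqueness.\<close>

lemma duhamel_bound:
  assumes u: "curve u {0..T}" and w: "curve w {0..T}" and t: "0 \<le> t" "t \<le> T"
    and A: "\<And>s. 0 \<le> s \<Longrightarrow> s < t \<Longrightarrow> h1_le (u s) (A s)" and B: "\<And>s. 0 \<le> s \<Longrightarrow> s < t \<Longrightarrow> h1_le (w s) (B s)"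
    and M: "M \<ge> 0" "\<And>s. 0 \<le> s \<Longrightarrow> s < t \<Longrightarrow> A s * B s \<le> M * exp (\<mu> * s)"
    and h: "(h has_integral I) {0..t}" "\<And>s. 0 < s \<Longrightarrow> s \<le> t \<Longrightarrow> kernel s * exp (- \<mu> * s) \<le> h s"
  shows "h1_le (duhamel u w t) (M * exp (\<mu> * t) * I)"
proof (rule h1_leI)
  fix F :: "(int^3) set" assume F: "finite F"
  show "L2_set (\<lambda>k. norm (real_vec k) * norm (duhamel u w t k)) F \<le> M * exp (\<mu> * t) * I"
    unfolding duhamel_def
  proof (rule L2_set_integral_le[OF F])
    show "((\<lambda>s. M * exp (\<mu> * t) * h (t - s)) has_integral M * exp (\<mu> * t) * I) {0..t}"
      by (intro has_integral_mult_right has_integral_reversed h)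
    fix s assume s: "0 \<le> s" "s < t"
    have "L2_set (\<lambda>k. norm (real_vec k) * norm (exp (- (t - s) * (norm (real_vec k))\<^sup>2) *\<^sub>R bilin (u s) (w s) k)) F
        = L2_set (\<lambda>k. heat_weight (t - s) k * norm (bilin (u s) (w s) k)) F"
      by (simp add: heat_weight_def mult_ac)
    also have "\<dots> \<le> kernel (t - s) * (A s * B s)"
      using s u t by (intro heat_bilin_estimate F A B) (auto simp: curve_def admissible_0)
    also have "\<dots> \<le> kernel (t - s) * (M * exp (\<mu> * s))"
      using s by (intro mult_left_mono M kernel_nonneg)
    also have "\<dots> = M * exp (\<mu> * t) * (kernel (t - s) * exp (- \<mu> * (t - s)))"
    proof -
      have "exp (\<mu> * s) = exp (\<mu> * t) * exp (- \<mu> * (t - s))" by (simp add: exp_add[symmetric] algebra_simps)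
      then show ?thesis by (simp only: mult_ac)
    qed
    also have "\<dots> \<le> M * exp (\<mu> * t) * h (t - s)"
      using s M by (intro mult_left_mono h) auto
    finally show "L2_set (\<lambda>k. norm (real_vec k) * norm (exp (- (t - s) * (norm (real_vec k))\<^sup>2) *\<^sub>R bilin (u s) (w s) k)) F
        \<le> M * exp (\<mu> * t) * h (t - s)" .
  qed (use continuous_duhamel_integrand[OF u w t(2)] in auto)
qed

lemma finite_int_vec_ball: "finite {k :: int^3. (norm (real_vec k))\<^sup>2 < R}"
proof -
  define n where "n = \<lceil>\<bar>R\<bar>\<rceil> + 1"
  have "{k :: int^3. (norm (real_vec k))\<^sup>2 < R} \<subseteq> vec_lambda ` (PiE UNIV (\<lambda>_. {-n..n}))"
  proof
    fix k :: "int^3" assume k: "k \<in> {k. (norm (real_vec k))\<^sup>2 < R}"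
    have "k $ r \<in> {-n..n}" for r
    proof -
      have "real_of_int \<bar>k $ r\<bar> \<le> real_of_int (\<bar>k $ r\<bar> * \<bar>k $ r\<bar>)"
        unfolding of_int_le_iff using mult_left_mono[of 1 "\<bar>k $ r\<bar>" "\<bar>k $ r\<bar>"] by (cases "k $ r = 0") auto
      also have "\<dots> = (real_vec k $ r)\<^sup>2" by (simp add: real_vec_def power2_eq_square)
      also have "\<dots> \<le> (norm (real_vec k))\<^sup>2"
        using power_mono[OF component_le_norm_cart[of "real_vec k" r], of 2] by simp
      also have "\<dots> \<le> \<bar>R\<bar>" using k by simp
      also have "\<dots> \<le> of_int \<lceil>\<bar>R\<bar>\<rceil>" by (rule le_of_int_ceiling)
      finally have "\<bar>k $ r\<bar> \<le> \<lceil>\<bar>R\<bar>\<rceil>" by linarith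
      then show ?thesis by (auto simp: n_def)
    qed
    then have "vec_nth k \<in> PiE UNIV (\<lambda>_. {-n..n})" by auto
    then show "k \<in> vec_lambda ` (PiE UNIV (\<lambda>_. {-n..n}))" by (metis image_eqI vec_nth_inverse)
  qed
  then show ?thesis by (rule finite_subset) (auto intro!: finite_imageI finite_PiE)
qed

lemma continuous_duhamel:
  assumes u: "curve u {0..T}" and w: "curve w {0..T}"
  shows "continuous_on {0..T} (\<lambda>t. duhamel u w t k)"
proof -
  let ?K = "(norm (real_vec k))\<^sup>2"
  have eq: "duhamel u w t k = exp (- t * ?K) *\<^sub>R integral {0..t} (\<lambda>s. exp (- (0 - s) * ?K) *\<^sub>R bilin (u s) (w s) k)" for t
  proof -
    have "exp (- (t - s) * ?K) = exp (- t * ?K) * exp (- (0 - s) * ?K)" for s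
      by (simp add: exp_add[symmetric] algebra_simps)
    then show ?thesis unfolding duhamel_def by (simp only: scaleR_scaleR[symmetric] integral_cmul)
  qed
  show ?thesis unfolding eq
    by (intro continuous_intros indefinite_integral_continuous_1 integrable_continuous_interval continuous_duhamel_integrand[OF u w order_refl])
qed

text \<open>The components are continuous, and by the tail estimate the high frequencies are bounded by the
integral of the kernel against \<open>exp (- R * s / 2)\<close>, which is small for large \<open>R\<close> uniformly in time.\<close>

lemma h1_cont_duhamel:
  assumes u: "curve u {0..T}" and w: "curve w {0..T}" and T: "T \<ge> 0"
  shows "h1_cont (duhamel u w) {0..T}"
proof (rule h1_cont_criterion[OF continuous_duhamel[OF u w]])
  fix e :: real assume e: "e > 0"
  obtain M where M: "M > 0" "\<And>t. t \<in> {0..T} \<Longrightarrow> h1_le (u t) M" by (rule curve_bounded[OF u]) blast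
  obtain N where N: "N > 0" "\<And>t. t \<in> {0..T} \<Longrightarrow> h1_le (w t) N" by (rule curve_bounded[OF w]) blast
  obtain R where R: "R > 0" "\<And>l t. l \<ge> R \<Longrightarrow> 0 \<le> t \<Longrightarrow> t \<le> T \<Longrightarrow>
     \<exists>h I. (h has_integral I) {0..t} \<and> I \<le> e / (M * N) \<and> (\<forall>s. 0 < s \<longrightarrow> s \<le> t \<longrightarrow> kernel s * exp (- l * s) \<le> h s
        \<and> kernel (s / 2) * exp (- l * (s / 2)) \<le> h s)"
    using kernel_exp_small_integral[OF T, of "e / (M * N)"] e M N by (metis divide_pos_pos mult_pos_pos)
  let ?K = "{k :: int^3. (norm (real_vec k))\<^sup>2 < R}"
  show "\<exists>K. finite K \<and> (\<forall>t\<in>{0..T}. \<forall>F. finite F \<longrightarrow> F \<inter> K = {} \<longrightarrow> L2_set (\<lambda>k. norm (real_vec k) * norm (duhamel u w t k)) F \<le> e)"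
  proof (intro exI[of _ ?K] conjI finite_int_vec_ball ballI allI impI)
    fix t and F :: "(int^3) set" assume t: "t \<in> {0..T}" and F: "finite F" and disj: "F \<inter> ?K = {}"
    obtain h I where h: "(h has_integral I) {0..t}" "I \<le> e / (M * N)"
      "\<And>s. 0 < s \<Longrightarrow> s \<le> t \<Longrightarrow> kernel (s / 2) * exp (- R * (s / 2)) \<le> h s"
      using R(2)[OF order_refl, of t] t by auto
    have "L2_set (\<lambda>k. norm (real_vec k) * norm (duhamel u w t k)) F \<le> M * N * I"
      unfolding duhamel_def
    proof (rule L2_set_integral_le[OF F])
      show "((\<lambda>s. M * N * h (t - s)) has_integral M * N * I) {0..t}"
        by (intro has_integral_mult_right has_integral_reversed h)
      fix s assume s: "0 \<le> s" "s < t"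
      have "L2_set (\<lambda>k. norm (real_vec k) * norm (exp (- (t - s) * (norm (real_vec k))\<^sup>2) *\<^sub>R bilin (u s) (w s) k)) F
        = L2_set (\<lambda>k. heat_weight (t - s) k * norm (bilin (u s) (w s) k)) F"
        by (simp add: heat_weight_def mult_ac)
      also have "\<dots> \<le> exp (- ((t - s) / 2) * R) * (kernel ((t - s) / 2) * (M * N))"
        using s t u disj by (intro heat_bilin_tail_estimate F M N) (auto simp: curve_def admissible_0 disjoint_iff not_less)
      also have "\<dots> = M * N * (kernel ((t - s) / 2) * exp (- R * ((t - s) / 2)))" by (simp add: mult_ac)
      also have "\<dots> \<le> M * N * h (t - s)" using s M N by (intro mult_left_mono h) auto
      finally show "L2_set (\<lambda>k. norm (real_vec k) * norm (exp (- (t - s) * (norm (real_vec k))\<^sup>2) *\<^sub>R bilin (u s) (w s) k)) F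
          \<le> M * N * h (t - s)" .
    qed (use continuous_duhamel_integrand[OF u w] t in auto)
    also have "\<dots> \<le> M * N * (e / (M * N))" using h M N by (intro mult_left_mono) auto
    also have "\<dots> = e" using M N by simp
    finally show "L2_set (\<lambda>k. norm (real_vec k) * norm (duhamel u w t k)) F \<le> e" .
  qed
qed

lemma curve_duhamel:
  assumes u: "curve u {0..T}" and w: "curve w {0..T}" and T: "T \<ge> 0"
  shows "curve (duhamel u w) {0..T}"
  unfolding curve_def
proof (intro conjI ballI h1_cont_duhamel assms)
  fix t assume t: "t \<in> {0..T}"
  have t': "t \<le> T" using t by simp
  note int = integrable_integral[OF integrable_continuous_interval[OF continuous_duhamel_integrand[OF u w t']], of t, folded duhamel_def]
  show "admissible (duhamel u w t)"
    unfolding admissible_def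
  proof (intro conjI allI)
    have "duhamel u w t 0 = integral {0..t} (\<lambda>s. 0)"
      unfolding duhamel_def by (rule integral_cong) (use u t in \<open>auto simp: curve_def bilin_zero\<close>)
    then show "duhamel u w t 0 = 0" by simp
    fix k
    have "(cdot (complex_vec k) \<circ> (\<lambda>s. exp (- (t - s) * (norm (real_vec k))\<^sup>2) *\<^sub>R bilin (u s) (w s) k)) = (\<lambda>s. 0)"
      by (simp add: fun_eq_iff cdot_scaleR_right bilin_div_free)
    with has_integral_linear[OF int bounded_linear_cdot[of "complex_vec k"], of k]
    show "cdot (complex_vec k) (duhamel u w t k) = 0" by (simp add: has_integral_0_eq)
    have "((\<lambda>s. cnj_vec (exp (- (t - s) * (norm (real_vec k))\<^sup>2) *\<^sub>R bilin (u s) (w s) k)) has_integral cnj_vec (duhamel u w t k)) {0..t}"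
      using has_integral_linear[OF int bounded_linear_cnj_vec, of k] by (simp add: o_def)
    moreover have "cnj_vec (exp (- (t - s) * (norm (real_vec k))\<^sup>2) *\<^sub>R bilin (u s) (w s) k)
        = exp (- (t - s) * (norm (real_vec (- k)))\<^sup>2) *\<^sub>R bilin (u s) (w s) (- k)" if "s \<in> {0..t}" for s
      using that t u w bilin_cnj[of "u s" "w s", OF _ _ h1_le_h1_norm h1_le_h1_norm, of k]
      by (simp add: cnj_vec_scaleR real_vec_uminus curve_def)
    ultimately have "((\<lambda>s. exp (- (t - s) * (norm (real_vec (- k)))\<^sup>2) *\<^sub>R bilin (u s) (w s) (- k)) has_integral cnj_vec (duhamel u w t k)) {0..t}"
      by (rule has_integral_eq[rotated])
    then show "duhamel u w t (- k) = cnj_vec (duhamel u w t k)" unfolding duhamel_def by (rule integral_unique)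
  qed
  obtain M where M: "M > 0" "\<And>t. t \<in> {0..T} \<Longrightarrow> h1_le (u t) M" by (rule curve_bounded[OF u]) blast
  obtain N where N: "N > 0" "\<And>t. t \<in> {0..T} \<Longrightarrow> h1_le (w t) N" by (rule curve_bounded[OF w]) blast
  obtain R where R: "\<And>l t. l \<ge> R \<Longrightarrow> 0 \<le> t \<Longrightarrow> t \<le> T \<Longrightarrow>
     \<exists>h I. (h has_integral I) {0..t} \<and> I \<le> 1 \<and> (\<forall>s. 0 < s \<longrightarrow> s \<le> t \<longrightarrow> kernel s * exp (- l * s) \<le> h s
        \<and> kernel (s / 2) * exp (- l * (s / 2)) \<le> h s)"
    by (rule kernel_exp_small_integral[OF T, of 1]) auto
  define l where "l = max R 0"
  obtain h I where h: "(h has_integral I) {0..t}" "\<And>s. 0 < s \<Longrightarrow> s \<le> t \<Longrightarrow> kernel s * exp (- l * s) \<le> h s"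
    using R[of l t] t by (auto simp: l_def)
  have "h1_le (duhamel u w t) (M * N * exp (l * t) * I)"
  proof (rule duhamel_bound[OF u w _ _ _ _ _ _ h])
    show "M * N \<le> M * N * exp (l * s)" if "0 \<le> s" for s
      using M N that by (simp add: l_def)
  qed (use t M N in auto)
  then show "h1_finite (duhamel u w t)" by (simp add: h1_le_iff)
qed

text \<open>Polarisation of the quadratic term; this form is used both for uniqueness and for the increments of the
Picard iteration.\<close>

lemma duhamel_self_diff:
  assumes u: "curve u {0..T}" and v: "curve v {0..T}" and t: "0 \<le> t" "t \<le> T"
  shows "duhamel u u t k - duhamel v v t k = duhamel (\<lambda>t k. u t k - v t k) u t k + duhamel v (\<lambda>t k. u t k - v t k) t k"
proof -
  let ?z = "\<lambda>t k. u t k - v t k"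
  have z: "curve ?z {0..T}" by (rule curve_diff[OF u v])
  note i = integrable_continuous_interval[OF continuous_duhamel_integrand]
  have "duhamel u u t k - duhamel v v t k
     = integral {0..t} (\<lambda>s. exp (- (t - s) * (norm (real_vec k))\<^sup>2) *\<^sub>R bilin (u s) (u s) k - exp (- (t - s) * (norm (real_vec k))\<^sup>2) *\<^sub>R bilin (v s) (v s) k)"
    unfolding duhamel_def by (rule integral_diff[symmetric]) (rule i[OF u u t(2)] i[OF v v t(2)])+
  also have "\<dots> = integral {0..t} (\<lambda>s. exp (- (t - s) * (norm (real_vec k))\<^sup>2) *\<^sub>R bilin (?z s) (u s) k + exp (- (t - s) * (norm (real_vec k))\<^sup>2) *\<^sub>R bilin (v s) (?z s) k)"
  proof (rule integral_cong)
    fix s assume "s \<in> {0..t}"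
    then have "bilin (u s) (u s) k - bilin (v s) (v s) k = bilin (?z s) (u s) k + bilin (v s) (?z s) k"
      using t u v by (intro bilin_self_diff[of _ "h1_norm (u s)" _ "h1_norm (v s)"] h1_le_h1_norm) (auto simp: curve_def admissible_0)
    then show "exp (- (t - s) * (norm (real_vec k))\<^sup>2) *\<^sub>R bilin (u s) (u s) k - exp (- (t - s) * (norm (real_vec k))\<^sup>2) *\<^sub>R bilin (v s) (v s) k
      = exp (- (t - s) * (norm (real_vec k))\<^sup>2) *\<^sub>R bilin (?z s) (u s) k + exp (- (t - s) * (norm (real_vec k))\<^sup>2) *\<^sub>R bilin (v s) (?z s) k"
      by (simp only: scaleR_diff_right[symmetric] scaleR_add_right[symmetric])
  qed
  also have "\<dots> = duhamel ?z u t k + duhamel v ?z t k"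
    unfolding duhamel_def by (rule integral_add) (rule i[OF z u t(2)] i[OF v z t(2)])+
  finally show ?thesis .
qed

section \<open>Uniqueness\<close>

lemma duhamel_bilinear_diff_bound:
  assumes u: "curve u {0..T}" and v: "curve v {0..T}" and t: "0 \<le> t" "t \<le> T"
    and "h1_le (duhamel (\<lambda>t k. u t k - v t k) u t) a" "h1_le (duhamel v (\<lambda>t k. u t k - v t k) t) b"
  shows "h1_le (\<lambda>k. duhamel u u t k - duhamel v v t k) (a + b)"
  unfolding duhamel_self_diff[OF u v t] by (intro h1_le_add assms)

text \<open>If the difference is bounded by \<open>Z * exp (R * t)\<close> with a sufficiently large \<open>R\<close>, then both bilinear
terms in the difference of the Duhamel terms are bounded by \<open>Z / 4 * exp (R * t)\<close>. Iterating this
halving shows that the difference vanishes.\<close>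

theorem coeff_solution_unique:
  assumes u: "curve u {0..T}" and v: "curve v {0..T}" and T: "T \<ge> 0"
    and eu: "\<And>t k. t \<in> {0..T} \<Longrightarrow> u t k = E t k - duhamel u u t k"
    and ev: "\<And>t k. t \<in> {0..T} \<Longrightarrow> v t k = E t k - duhamel v v t k"
    and t: "t \<in> {0..T}"
  shows "u t = v t"
proof -
  let ?z = "\<lambda>t k. u t k - v t k"
  have z: "curve ?z {0..T}" by (rule curve_diff[OF u v])
  obtain M1 where M1: "M1 > 0" "\<And>t. t \<in> {0..T} \<Longrightarrow> h1_le (u t) M1" by (rule curve_bounded[OF u]) blast
  obtain M2 where M2: "M2 > 0" "\<And>t. t \<in> {0..T} \<Longrightarrow> h1_le (v t) M2" by (rule curve_bounded[OF v]) blast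
  define M where "M = max M1 M2"
  have M: "M > 0" "\<And>t. t \<in> {0..T} \<Longrightarrow> h1_le (u t) M" "\<And>t. t \<in> {0..T} \<Longrightarrow> h1_le (v t) M"
    using M1(1) h1_le_mono[OF M1(2)] h1_le_mono[OF M2(2)] by (simp_all add: M_def)
  have pos: "1 / (4 * M) > 0" using M by simp
  obtain R where R: "R > 0" "\<And>l t. l \<ge> R \<Longrightarrow> 0 \<le> t \<Longrightarrow> t \<le> T \<Longrightarrow>
     \<exists>h I. (h has_integral I) {0..t} \<and> I \<le> 1 / (4 * M) \<and> (\<forall>s. 0 < s \<longrightarrow> s \<le> t \<longrightarrow> kernel s * exp (- l * s) \<le> h s
        \<and> kernel (s / 2) * exp (- l * (s / 2)) \<le> h s)"
    by (rule kernel_exp_small_integral[OF T pos]) blast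
  \<comment> \<open>Each of the two bilinear terms contributes \<open>Z * M * I\<close>, which is at most \<open>Z / 4\<close>.\<close>
  have halve: "h1_le (?z t) (Z / 2 * exp (R * t))"
    if Z: "Z \<ge> 0" "\<And>t. t \<in> {0..T} \<Longrightarrow> h1_le (?z t) (Z * exp (R * t))" and t: "t \<in> {0..T}" for Z t
  proof -
    have t': "0 \<le> t" "t \<le> T" using t by auto
    obtain h I where h: "(h has_integral I) {0..t}" "I \<le> 1 / (4 * M)"
      "\<And>s. 0 < s \<Longrightarrow> s \<le> t \<Longrightarrow> kernel s * exp (- R * s) \<le> h s"
      using R(2)[OF order_refl t'] by blast
    have ZM: "Z * M \<ge> 0" using Z M by simp
    have 1: "h1_le (duhamel ?z u t) (Z * M * exp (R * t) * I)"
      by (rule duhamel_bound[OF z u t' Z(2) M(2) ZM _ h(1,3)]) (use t' in auto)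
    have 2: "h1_le (duhamel v ?z t) (Z * M * exp (R * t) * I)"
      by (rule duhamel_bound[OF v z t' M(3) Z(2) ZM _ h(1,3)]) (use t' in auto)
    have "h1_le (\<lambda>k. duhamel u u t k - duhamel v v t k) (Z * M * exp (R * t) * I + Z * M * exp (R * t) * I)"
      by (rule duhamel_bilinear_diff_bound[OF u v t' 1 2])
    moreover have "Z * M * exp (R * t) * I \<le> Z * M * exp (R * t) * (1 / (4 * M))"
      using h(2) ZM by (intro mult_left_mono) auto
    moreover have "Z * M * exp (R * t) * (1 / (4 * M)) = Z / 4 * exp (R * t)" using M by simp
    ultimately have "h1_le (\<lambda>k. duhamel u u t k - duhamel v v t k) (Z / 2 * exp (R * t))"
      by (elim h1_le_mono) linarith
    moreover have "?z t = (\<lambda>k. - (duhamel u u t k - duhamel v v t k))"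
      using eu[OF t] ev[OF t] by (intro ext) simp
    ultimately show ?thesis by (simp only: h1_le_minus)
  qed
  have bound: "h1_le (?z t) (2 * M / 2 ^ n * exp (R * t))" if "t \<in> {0..T}" for t n
    using that
  proof (induction n arbitrary: t)
    case 0
    have "h1_le (?z t) (M + M)" using 0 by (intro h1_le_diff M)
    moreover have "2 * M * 1 \<le> 2 * M * exp (R * t)" using R(1) M(1) 0 by (intro mult_left_mono) auto
    ultimately show ?case by (elim h1_le_mono) simp
  next
    case (Suc n)
    have "h1_le (?z t) (2 * M / 2 ^ n / 2 * exp (R * t))"
      using M(1) by (intro halve Suc) auto
    then show ?case by (simp add: mult.commute)
  qed
  show ?thesis
  proof
    fix k
    have z0: "u t 0 - v t 0 = 0" using admissible_0[of "?z t"] z t by (simp add: curve_def)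
    have "norm (?z t k) \<le> 2 * M * exp (R * t) * (1 / 2) ^ n" for n
      using h1_le_component'[OF bound[OF t, of n] z0, of k] by (simp add: power_one_over mult_ac)
    moreover have "(\<lambda>n. 2 * M * exp (R * t) * (1 / 2) ^ n) \<longlonglongrightarrow> 2 * M * exp (R * t) * 0"
      by (intro tendsto_mult_left LIMSEQ_power_zero) auto
    ultimately have "norm (?z t k) \<le> 2 * M * exp (R * t) * 0"
      by (intro LIMSEQ_le_const) auto
    then show "u t k = v t k" by simp
  qed
qed

section \<open>Linear flow and decay\<close>

definition heat_flow :: "(int^3 \<Rightarrow> complex^3) \<Rightarrow> real \<Rightarrow> int^3 \<Rightarrow> complex^3" where
  "heat_flow a t k = exp (- t * (norm (real_vec k))\<^sup>2) *\<^sub>R a k"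

lemma heat_flow_decay:
  assumes "h1_le a N" "t \<ge> 0" shows "h1_le (heat_flow a t) (N * exp (- t))"
proof (rule h1_leI)
  fix F :: "(int^3) set" assume F: "finite F"
  have "L2_set (\<lambda>k. norm (real_vec k) * norm (heat_flow a t k)) F \<le> L2_set (\<lambda>k. exp (- t) * (norm (real_vec k) * norm (a k))) F"
  proof (rule L2_set_mono)
    fix k
    show "norm (real_vec k) * norm (heat_flow a t k) \<le> exp (- t) * (norm (real_vec k) * norm (a k))"
    proof (cases "k = 0")
      case False
      then have "1 \<le> (norm (real_vec k))\<^sup>2" by (simp add: norm_real_vec_ge_1 one_le_power)
      then have "t * 1 \<le> t * (norm (real_vec k))\<^sup>2" using assms by (intro mult_left_mono)
      then have "exp (- t * (norm (real_vec k))\<^sup>2) * (norm (real_vec k) * norm (a k)) \<le> exp (- t) * (norm (real_vec k) * norm (a k))"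
        by (intro mult_right_mono) auto
      then show ?thesis by (simp add: heat_flow_def mult_ac)
    qed simp
  qed simp
  also have "\<dots> = exp (- t) * L2_set (\<lambda>k. norm (real_vec k) * norm (a k)) F"
    by (rule L2_set_right_distrib[symmetric]) simp
  also have "\<dots> \<le> exp (- t) * N" by (intro mult_left_mono h1_leD assms F) simp
  finally show "L2_set (\<lambda>k. norm (real_vec k) * norm (heat_flow a t k)) F \<le> N * exp (- t)" by (simp add: mult.commute)
qed

lemma curve_heat_flow:
  assumes "admissible a" "h1_finite a" shows "curve (heat_flow a) {0..T}"
  unfolding curve_def
proof (intro conjI ballI)
  show "h1_cont (heat_flow a) {0..T}"
  proof (rule h1_cont_criterion)
    show "continuous_on {0..T} (\<lambda>t. heat_flow a t k)" for k
      unfolding heat_flow_def by (intro continuous_intros)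
    fix e :: real assume "e > 0"
    then obtain K where K: "finite K" "\<And>F. finite F \<Longrightarrow> F \<inter> K = {} \<Longrightarrow> L2_set (\<lambda>k. norm (real_vec k) * norm (a k)) F \<le> e"
      using h1_tail[OF assms(2)] by blast
    show "\<exists>K. finite K \<and> (\<forall>t\<in>{0..T}. \<forall>F. finite F \<longrightarrow> F \<inter> K = {} \<longrightarrow> L2_set (\<lambda>k. norm (real_vec k) * norm (heat_flow a t k)) F \<le> e)"
    proof (intro exI[of _ K] conjI K(1) ballI allI impI)
      fix t and F :: "(int^3) set" assume t: "t \<in> {0..T}" and F: "finite F" "F \<inter> K = {}"
      have "L2_set (\<lambda>k. norm (real_vec k) * norm (heat_flow a t k)) F \<le> L2_set (\<lambda>k. norm (real_vec k) * norm (a k)) F"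
        using t by (intro L2_set_mono mult_left_mono) (auto simp: heat_flow_def mult_left_le_one_le)
      then show "L2_set (\<lambda>k. norm (real_vec k) * norm (heat_flow a t k)) F \<le> e" using K(2)[OF F] by linarith
    qed
  qed
  fix t assume "t \<in> {0..T}"
  show "admissible (heat_flow a t)" using assms(1)
    by (simp add: admissible_def heat_flow_def cdot_scaleR_right cnj_vec_scaleR real_vec_uminus)
  show "h1_finite (heat_flow a t)"
    using heat_flow_decay[OF h1_le_h1_norm[OF assms(2)], of t] \<open>t \<in> {0..T}\<close> by (simp add: h1_le_iff)
qed

lemma duhamel_decay_bound:
  assumes u: "curve u {0..t}" and w: "curve w {0..t}" and t: "0 \<le> t"
    and A: "\<And>s. 0 \<le> s \<Longrightarrow> s < t \<Longrightarrow> h1_le (u s) (\<alpha> * exp (- s))" and B: "\<And>s. 0 \<le> s \<Longrightarrow> s < t \<Longrightarrow> h1_le (w s) (\<beta> * exp (- s))"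
    and nn: "\<alpha> \<ge> 0" "\<beta> \<ge> 0"
  shows "h1_le (duhamel u w t) (250 / 407 * (\<alpha> * \<beta>) * exp (- t))"
proof -
  obtain h I where h: "(h has_integral I) {0..t}" "I \<le> 250 / 407" "\<And>s. 0 < s \<Longrightarrow> s \<le> t \<Longrightarrow> kernel s * exp (2 * s - t) \<le> h s"
    using kernel_weighted_integral[OF t] by blast
  have "h1_le (duhamel u w t) (\<alpha> * \<beta> * exp (- 2 * t) * (exp t * I))"
  proof (rule duhamel_bound[OF u w t order_refl A B])
    show "\<alpha> * exp (- s) * (\<beta> * exp (- s)) \<le> \<alpha> * \<beta> * exp (- 2 * s)" for s
      by (simp add: exp_add[symmetric] mult_ac)
    show "((\<lambda>s. exp t * h s) has_integral exp t * I) {0..t}" by (intro has_integral_mult_right h)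
    fix s assume s: "0 < s" "s \<le> t"
    have "kernel s * exp (- (- 2) * s) = exp t * (kernel s * exp (2 * s - t))" by (simp add: exp_diff)
    also have "\<dots> \<le> exp t * h s" using s by (intro mult_left_mono h) auto
    finally show "kernel s * exp (- (- 2) * s) \<le> exp t * h s" .
  qed (use nn in auto)
  moreover have "\<alpha> * \<beta> * exp (- 2 * t) * (exp t * I) \<le> 250 / 407 * (\<alpha> * \<beta>) * exp (- t)"
  proof -
    have "exp (- 2 * t) * exp t = exp (- t)" by (simp add: exp_add[symmetric])
    then have "\<alpha> * \<beta> * exp (- 2 * t) * (exp t * I) = (\<alpha> * \<beta> * exp (- t)) * I" by (simp only: mult_ac)
    also have "\<dots> \<le> (\<alpha> * \<beta> * exp (- t)) * (250 / 407)" using nn h by (intro mult_left_mono) auto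
    finally show ?thesis by (simp add: mult_ac)
  qed
  ultimately show ?thesis by (rule h1_le_mono)
qed

section \<open>Picard iteration\<close>

text \<open>The value is the smaller root of the quadratic equation \<open>x = N + x\<^sup>2 / (4 * 0.407)\<close>.\<close>

lemma chi_fun_fixed_point:
  assumes "0 \<le> N" "N \<le> 0.407"
  shows "N + 250 / 407 * (N * chi_fun (N / 0.407))\<^sup>2 = N * chi_fun (N / 0.407)" "N * chi_fun (N / 0.407) \<ge> 0"
proof -
  define s where "s = sqrt (1 - N / 0.407)"
  have s: "s\<^sup>2 = 1 - N / 0.407" "s \<ge> 0" "s \<le> 1" using assms by (auto simp: s_def)
  have X: "N * chi_fun (N / 0.407) = 0.814 * (1 - s)"
  proof (cases "N = 0")
    case False
    then show ?thesis by (simp add: chi_fun_def s_def field_simps)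
  qed (simp add: s_def)
  have N: "N = 0.407 * (1 - s\<^sup>2)" using s by simp
  have sq: "(0.814 * (1 - s))\<^sup>2 = 0.814\<^sup>2 * (1 - 2 * s + s\<^sup>2)" by (simp only: power_mult_distrib) (simp add: power2_eq_square algebra_simps)
  have "0.407 * (1 - q) + 250 / 407 * (0.814\<^sup>2 * (1 - 2 * s + q)) = 0.814 * (1 - s)" for q :: real
    by (simp add: power2_eq_square field_simps)
  from this[of "s\<^sup>2"] show "N + 250 / 407 * (N * chi_fun (N / 0.407))\<^sup>2 = N * chi_fun (N / 0.407)"
    unfolding X sq using N by (simp only:)
  show "N * chi_fun (N / 0.407) \<ge> 0" unfolding X using s by simp
qed

primrec majorant_seq :: "real \<Rightarrow> nat \<Rightarrow> real" where
  "majorant_seq N 0 = N"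
| "majorant_seq N (Suc n) = N + 250 / 407 * (majorant_seq N n)\<^sup>2"

lemma majorant_seq_bounds:
  assumes N: "0 \<le> N" and X: "N + 250 / 407 * X\<^sup>2 = X" "X \<ge> 0"
  shows "0 \<le> majorant_seq N n" "majorant_seq N n \<le> majorant_seq N (Suc n)" "majorant_seq N n \<le> X"
proof -
  show nn: "0 \<le> majorant_seq N n" for n by (induction n) (use N in auto)
  show "majorant_seq N n \<le> majorant_seq N (Suc n)"
  proof (induction n)
    case (Suc n)
    then have "(majorant_seq N n)\<^sup>2 \<le> (majorant_seq N (Suc n))\<^sup>2" by (intro power_mono nn)
    then show ?case by simp
  qed simp
  show "majorant_seq N n \<le> X"
  proof (induction n)
    case 0 then show ?case using X(1) zero_le_power2[of X] by (simp only: majorant_seq.simps)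
  next
    case (Suc n)
    then have "(majorant_seq N n)\<^sup>2 \<le> X\<^sup>2" by (intro power_mono nn)
    then show ?case using X by simp
  qed
qed

primrec picard :: "(int^3 \<Rightarrow> complex^3) \<Rightarrow> nat \<Rightarrow> real \<Rightarrow> int^3 \<Rightarrow> complex^3" where
  "picard a 0 = heat_flow a"
| "picard a (Suc n) = (\<lambda>t k. heat_flow a t k - duhamel (picard a n) (picard a n) t k)"

lemma curve_picard:
  assumes "admissible a" "h1_finite a" "T \<ge> 0" shows "curve (picard a n) {0..T}"
proof (induction n)
  case (Suc n)
  then show ?case by (simp add: curve_diff curve_heat_flow curve_duhamel assms)
qed (simp add: curve_heat_flow assms)

lemma picard_bound:
  assumes a: "admissible a" "h1_le a N" and t: "t \<ge> 0"
  shows "h1_le (picard a n t) (majorant_seq N n * exp (- t))"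
  using t
proof (induction n arbitrary: t)
  case 0
  then show ?case using heat_flow_decay[OF a(2)] by simp
next
  case (Suc n)
  have f: "h1_finite a" using a by (simp add: h1_le_iff)
  have N: "N \<ge> 0" by (rule h1_le_nonneg[OF a(2)])
  have nn: "0 \<le> majorant_seq N n" for n by (induction n) (use N in auto)
  have "h1_le (duhamel (picard a n) (picard a n) t) (250 / 407 * (majorant_seq N n * majorant_seq N n) * exp (- t))"
    using Suc by (intro duhamel_decay_bound curve_picard a f nn) auto
  then have "h1_le (\<lambda>k. heat_flow a t k - duhamel (picard a n) (picard a n) t k)
      (N * exp (- t) + 250 / 407 * (majorant_seq N n * majorant_seq N n) * exp (- t))"
    by (intro h1_le_diff heat_flow_decay a Suc)
  then show ?case by (simp add: algebra_simps power2_eq_square)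
qed

text \<open>With the scalar values \<open>x\<close> and \<open>y\<close> at the steps \<open>n\<close> and \<open>n + 1\<close>, the two bilinear terms contribute
\<open>(y - x) * y + x * (y - x) = y\<^sup>2 - x\<^sup>2\<close>, which is the increment of the scalar iteration up to the
factor \<open>250 / 407\<close>.\<close>

lemma picard_step_bound:
  assumes a: "admissible a" "h1_le a N" and t: "t \<ge> 0" and mono: "\<And>n. majorant_seq N n \<le> majorant_seq N (Suc n)"
  shows "h1_le (\<lambda>k. picard a (Suc n) t k - picard a n t k) ((majorant_seq N (Suc n) - majorant_seq N n) * exp (- t))"
  using t
proof (induction n arbitrary: t)
  have f: "h1_finite a" using a by (simp add: h1_le_iff)
  have N: "N \<ge> 0" by (rule h1_le_nonneg[OF a(2)])
  have nn: "0 \<le> majorant_seq N n" for n by (induction n) (use N in auto)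
  note cp = curve_picard[OF a(1) f]
  {
    case 0
    have "h1_le (duhamel (picard a 0) (picard a 0) t) (250 / 407 * (majorant_seq N 0 * majorant_seq N 0) * exp (- t))"
      using 0 by (intro duhamel_decay_bound cp nn picard_bound a) auto
    then have "h1_le (\<lambda>k. - duhamel (picard a 0) (picard a 0) t k) (250 / 407 * (majorant_seq N 0 * majorant_seq N 0) * exp (- t))"
      by (simp only: h1_le_minus)
    then show ?case by (simp add: power2_eq_square)
  next
    case (Suc n)
    let ?u = "picard a (Suc n)" and ?v = "picard a n"
    let ?x = "majorant_seq N n" and ?y = "majorant_seq N (Suc n)"
    have z: "curve (\<lambda>t k. ?u t k - ?v t k) {0..t}" using Suc by (intro curve_diff cp)
    have d: "?y - ?x \<ge> 0" using mono[of n] by simp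
    have 1: "h1_le (duhamel (\<lambda>t k. ?u t k - ?v t k) ?u t) (250 / 407 * ((?y - ?x) * ?y) * exp (- t))"
      by (rule duhamel_decay_bound[OF z cp Suc.prems Suc.IH picard_bound[OF a] d nn]) (use Suc.prems in auto)
    have 2: "h1_le (duhamel ?v (\<lambda>t k. ?u t k - ?v t k) t) (250 / 407 * (?x * (?y - ?x)) * exp (- t))"
      by (rule duhamel_decay_bound[OF cp z Suc.prems picard_bound[OF a] Suc.IH nn d]) (use Suc.prems in auto)
    have "h1_le (\<lambda>k. - (duhamel ?u ?u t k - duhamel ?v ?v t k)) (250 / 407 * ((?y - ?x) * ?y) * exp (- t) + 250 / 407 * (?x * (?y - ?x)) * exp (- t))"
      unfolding h1_le_minus by (rule duhamel_bilinear_diff_bound[OF cp cp Suc.prems order_refl 1 2]) (use Suc.prems in auto)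
    moreover have "picard a (Suc (Suc n)) t k - picard a (Suc n) t k = - (duhamel ?u ?u t k - duhamel ?v ?v t k)" for k
      by (simp only: picard.simps) simp
    moreover have "250 / 407 * ((?y - ?x) * ?y) * exp (- t) + 250 / 407 * (?x * (?y - ?x)) * exp (- t)
        = (majorant_seq N (Suc (Suc n)) - majorant_seq N (Suc n)) * exp (- t)"
    proof -
      have "majorant_seq N (Suc (Suc n)) - majorant_seq N (Suc n) = 250 / 407 * (?y\<^sup>2 - ?x\<^sup>2)"
        by (simp only: majorant_seq.simps(2)[of N "Suc n"] majorant_seq.simps(2)[of N n]) (simp add: algebra_simps)
      also have "\<dots> = 250 / 407 * ((?y - ?x) * ?y) + 250 / 407 * (?x * (?y - ?x))"
        by (simp only: power2_eq_square) algebra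
      finally show ?thesis by (simp only: distrib_right)
    qed
    ultimately show ?case by (simp only:)
  }
qed

text \<open>The increments of the iteration are summable because they are dominated by those of a bounded
increasing scalar sequence. The limit inherits all properties of the iterates, and passing to the limit in
the Duhamel term uses the bilinear bound on the differences.\<close>

theorem coeff_global_solution:
  assumes a: "admissible a" "h1_le a N" and N: "N \<le> 0.407"
  obtains u where "\<And>T. T \<ge> 0 \<Longrightarrow> curve u {0..T}" "\<And>t. t \<ge> 0 \<Longrightarrow> h1_le (u t) (N * chi_fun (N / 0.407) * exp (- t))"
    "\<And>t k. t \<ge> 0 \<Longrightarrow> u t k = heat_flow a t k - duhamel u u t k"
proof -
  have f: "h1_finite a" using a by (simp add: h1_le_iff)
  have N0: "N \<ge> 0" by (rule h1_le_nonneg[OF a(2)])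
  define X where "X = N * chi_fun (N / 0.407)"
  define x where "x = majorant_seq N"
  note X = chi_fun_fixed_point[OF N0 N, folded X_def]
  note xb = majorant_seq_bounds[OF N0 X, folded x_def]
  note cp = curve_picard[OF a(1) f]
  have inc: "incseq x" using xb(2) by (rule incseq_SucI)
  obtain L where L: "x \<longlonglongrightarrow> L" "\<And>n. x n \<le> L"
    using incseq_convergent[OF inc, of X] xb(3) by auto
  have LX: "L \<le> X" using L(1) xb(3) by (intro LIMSEQ_le_const2[OF L(1)]) auto
  have L0: "L \<ge> 0" using L(2)[of 0] xb(1)[of 0] by linarith
  have step: "h1_le (\<lambda>k. picard a (n + d) t k - picard a n t k) ((x (n + d) - x n) * exp (- t))" if "t \<ge> 0" for n d t
  proof (induction d)
    case (Suc d)
    have "h1_le (\<lambda>k. (picard a (Suc (n + d)) t k - picard a (n + d) t k) + (picard a (n + d) t k - picard a n t k))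
        ((x (Suc (n + d)) - x (n + d)) * exp (- t) + (x (n + d) - x n) * exp (- t))"
      by (intro h1_le_add Suc picard_step_bound[OF a that xb(2)[unfolded x_def], folded x_def])
    then show ?case by (simp add: algebra_simps del: picard.simps)
  qed (simp add: h1_le_zero)
  have p0: "picard a n t 0 = 0" if "t \<ge> 0" for n t
    using cp[OF that, of n] that by (auto simp: curve_def admissible_0)
  have conv: "convergent (\<lambda>n. picard a n t k)" if t: "t \<ge> 0" for t k
  proof (rule Cauchy_convergent, rule metric_CauchyI)
    fix e :: real assume "e > 0"
    then obtain M where M: "\<And>m n. m \<ge> M \<Longrightarrow> n \<ge> M \<Longrightarrow> dist (x m) (x n) < e"
      using LIMSEQ_imp_Cauchy[OF L(1)] unfolding Cauchy_def by blast
    have d: "dist (picard a (n + d) t k) (picard a n t k) < e" if "n \<ge> M" for n d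
    proof -
      have "norm (picard a (n + d) t k - picard a n t k) \<le> (x (n + d) - x n) * exp (- t)"
        using h1_le_component'[OF step[OF t, of n d]] p0[OF t] by simp
      also have "\<dots> \<le> (x (n + d) - x n) * 1"
        using t incseqD[OF inc, of n "n + d"] by (intro mult_left_mono) auto
      also have "\<dots> < e" using M[of "n + d" n] that by (simp add: dist_real_def)
      finally show ?thesis by (simp add: dist_norm)
    qed
    show "\<exists>M. \<forall>m\<ge>M. \<forall>n\<ge>M. dist (picard a m t k) (picard a n t k) < e"
    proof (intro exI[of _ M] allI impI)
      fix m n assume mn: "M \<le> m" "M \<le> n"
      show "dist (picard a m t k) (picard a n t k) < e"
      proof (cases "n \<le> m")
        case True
        then show ?thesis using d[OF mn(2), of "m - n"] by simp
      next
        case False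
        then show ?thesis using d[OF mn(1), of "n - m"] by (simp add: dist_commute)
      qed
    qed
  qed
  define u where "u t k = lim (\<lambda>n. picard a n t k)" for t k
  have lim: "(\<lambda>n. picard a n t k) \<longlonglongrightarrow> u t k" if "t \<ge> 0" for t k
    using conv[OF that] unfolding u_def by (simp add: convergent_LIMSEQ_iff)
  have err: "h1_le (\<lambda>k. u t k - picard a n t k) ((L - x n) * exp (- t))" if t: "t \<ge> 0" for t n
  proof (rule h1_le_limit[where G = sequentially])
    show "(\<lambda>m. picard a m t k - picard a n t k) \<longlonglongrightarrow> u t k - picard a n t k" for k
      by (intro tendsto_diff lim t tendsto_const)
    show "(\<lambda>m. (x m - x n) * exp (- t)) \<longlonglongrightarrow> (L - x n) * exp (- t)"
      by (intro tendsto_intros L)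
    show "\<forall>\<^sub>F m in sequentially. h1_le (\<lambda>k. picard a m t k - picard a n t k) ((x m - x n) * exp (- t))"
      unfolding eventually_sequentially
    proof (intro exI[of _ n] allI impI)
      fix m assume "n \<le> m"
      then show "h1_le (\<lambda>k. picard a m t k - picard a n t k) ((x m - x n) * exp (- t))"
        using step[OF t, of n "m - n"] by simp
    qed
  qed simp
  have ub: "h1_le (u t) (L * exp (- t))" if t: "t \<ge> 0" for t
  proof (rule h1_le_limit[where G = sequentially])
    show "(\<lambda>n. picard a n t k) \<longlonglongrightarrow> u t k" for k by (rule lim[OF t])
    show "(\<lambda>n. x n * exp (- t)) \<longlonglongrightarrow> L * exp (- t)" by (intro tendsto_intros L)
  qed (simp_all add: x_def picard_bound a t)
  have cu: "curve u {0..T}" if T: "T \<ge> 0" for T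
    unfolding curve_def
  proof (intro conjI ballI)
    show "h1_cont u {0..T}"
    proof (rule h1_cont_uniform_limit)
      show "h1_cont (picard a n) {0..T}" for n using cp[OF T] by (simp add: curve_def)
      show "(\<lambda>n. L - x n) \<longlonglongrightarrow> 0" using tendsto_diff[OF tendsto_const L(1), of L] by simp
      fix n t assume t: "t \<in> {0..T}"
      have "(L - x n) * exp (- t) \<le> (L - x n) * 1" using t L(2)[of n] by (intro mult_left_mono) auto
      then show "h1_le (\<lambda>k. u t k - picard a n t k) (L - x n)"
        using err[of t n] t by (auto elim: h1_le_mono)
    qed
    fix t assume "t \<in> {0..T}"
    then have t: "t \<ge> 0" by simp
    have ap: "admissible (picard a n t)" for n using cp[OF t, of n] t by (simp add: curve_def)
    show "h1_finite (u t)" using ub[OF t] by (simp add: h1_le_iff)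
    show "admissible (u t)"
      unfolding admissible_def
    proof (intro conjI allI)
      show "u t 0 = 0" using LIMSEQ_unique[OF lim[OF t, of 0]] p0[OF t] by simp
      fix k
      show "cdot (complex_vec k) (u t k) = 0"
        using bounded_linear.tendsto[OF bounded_linear_cdot[of "complex_vec k"] lim[OF t, of k]] ap
        by (simp add: admissible_def LIMSEQ_const_iff)
      have "(\<lambda>n. picard a n t (- k)) \<longlonglongrightarrow> cnj_vec (u t k)"
        using bounded_linear.tendsto[OF bounded_linear_cnj_vec lim[OF t, of k]] ap by (simp add: admissible_def)
      then show "u t (- k) = cnj_vec (u t k)" using LIMSEQ_unique[OF lim[OF t, of "- k"]] by blast
    qed
  qed
  have eq: "u t k = heat_flow a t k - duhamel u u t k" if t: "t \<ge> 0" for t k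
  proof -
    have le: "norm (duhamel u u t k - duhamel (picard a n) (picard a n) t k) \<le> 250 / 407 * ((L - x n) * L) * exp (- t) + 250 / 407 * (x n * (L - x n)) * exp (- t)" for n
    proof -
      let ?z = "\<lambda>t k. u t k - picard a n t k"
      have z: "curve ?z {0..t}" by (intro curve_diff cu cp t)
      have d: "L - x n \<ge> 0" using L(2)[of n] by simp
      have 1: "h1_le (duhamel ?z u t) (250 / 407 * ((L - x n) * L) * exp (- t))"
        by (rule duhamel_decay_bound[OF z cu[OF t] t err ub d L0]) auto
      have 2: "h1_le (duhamel (picard a n) ?z t) (250 / 407 * (x n * (L - x n)) * exp (- t))"
        by (rule duhamel_decay_bound[OF cp[OF t] z t picard_bound[OF a, folded x_def] err xb(1) d]) auto
      have "curve (\<lambda>t k. duhamel u u t k - duhamel (picard a n) (picard a n) t k) {0..t}"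
        by (intro curve_diff curve_duhamel cu cp t)
      then have "admissible (\<lambda>k. duhamel u u t k - duhamel (picard a n) (picard a n) t k)" using t by (simp add: curve_def)
      from h1_le_component'[OF duhamel_bilinear_diff_bound[OF cu[OF t] cp[OF t] t order_refl 1 2] admissible_0[OF this]]
      show ?thesis .
    qed
    have "(\<lambda>n. 250 / 407 * ((L - x n) * L) * exp (- t) + 250 / 407 * (x n * (L - x n)) * exp (- t)) \<longlonglongrightarrow>
        250 / 407 * ((L - L) * L) * exp (- t) + 250 / 407 * (L * (L - L)) * exp (- t)"
      by (intro tendsto_intros L)
    then have g: "(\<lambda>n. 250 / 407 * ((L - x n) * L) * exp (- t) + 250 / 407 * (x n * (L - x n)) * exp (- t)) \<longlonglongrightarrow> 0"
      by simp
    have "(\<lambda>n. duhamel u u t k - duhamel (picard a n) (picard a n) t k) \<longlonglongrightarrow> 0"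
      by (rule Lim_null_comparison[OF always_eventually g]) (rule allI, rule le)
    then have "(\<lambda>n. duhamel u u t k - (duhamel u u t k - duhamel (picard a n) (picard a n) t k)) \<longlonglongrightarrow> duhamel u u t k - 0"
      by (rule tendsto_diff[OF tendsto_const])
    then have "(\<lambda>n. duhamel (picard a n) (picard a n) t k) \<longlonglongrightarrow> duhamel u u t k" by simp
    then have "(\<lambda>n. picard a (Suc n) t k) \<longlonglongrightarrow> heat_flow a t k - duhamel u u t k"
      unfolding picard.simps by (intro tendsto_intros)
    with LIMSEQ_Suc[OF lim[OF t, of k]] show ?thesis by (rule LIMSEQ_unique)
  qed
  have ub': "h1_le (u t) (X * exp (- t))" if "t \<ge> 0" for t
    using ub[OF that] by (rule h1_le_mono) (simp add: LX)
  show ?thesis by (rule that[OF cu ub'[unfolded X_def] eq])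
qed

section \<open>Integrals of periodic functions\<close>

lemma period_cell_iff: "x \<in> period_cell \<longleftrightarrow> (\<forall>r. 0 \<le> x $ r \<and> x $ r \<le> 2 * pi)"
  by (simp add: period_cell_def mem_box_cart)

lemma periodic_int:
  assumes "periodic f" shows "f (x + (2 * pi * of_int n) *\<^sub>R axis r 1) = f x"
proof (induction n rule: int_induct[where k = 0])
  case (step1 i)
  have "x + (2 * pi * of_int (i + 1)) *\<^sub>R axis r 1 = (x + (2 * pi * of_int i) *\<^sub>R axis r 1) + (2 * pi) *\<^sub>R axis r 1"
    by (simp add: algebra_simps)
  then show ?case using step1 assms unfolding periodic_def by (simp only:)
next
  case (step2 i)
  have "x + (2 * pi * of_int i) *\<^sub>R axis r 1 = (x + (2 * pi * of_int (i - 1)) *\<^sub>R axis r 1) + (2 * pi) *\<^sub>R axis r 1"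
    by (simp add: algebra_simps)
  then show ?case using step2 assms unfolding periodic_def by (simp only:)
qed simp

text \<open>A representative of \<open>x\<close> modulo the period lattice, common to all periodic functions.\<close>

lemma periodic_reduce:
  fixes x :: "real^3"
  obtains y where "\<And>r. 0 \<le> y $ r \<and> y $ r < 2 * pi" "\<And>f. periodic f \<Longrightarrow> f x = f y"
proof -
  define n where "n r = - \<lfloor>x $ r / (2 * pi)\<rfloor>" for r
  define y where "y = x + (\<Sum>r\<in>UNIV. (2 * pi * of_int (n r)) *\<^sub>R axis r 1)"
  have fin: "f (x + (\<Sum>r\<in>R. (2 * pi * of_int (n r)) *\<^sub>R axis r 1)) = f x" if "finite R" "periodic f" for f R
    using that(1)
  proof (induction R)
    case (insert r R)
    then have "x + (\<Sum>r\<in>insert r R. (2 * pi * of_int (n r)) *\<^sub>R axis r 1)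
       = (x + (\<Sum>r\<in>R. (2 * pi * of_int (n r)) *\<^sub>R axis r 1)) + (2 * pi * of_int (n r)) *\<^sub>R axis r 1" by simp
    then show ?case using insert.IH periodic_int[OF that(2)] by (simp only:)
  qed simp
  show ?thesis
  proof (rule that)
    fix r
    have "(\<Sum>s\<in>UNIV. (2 * pi * of_int (n s)) * (axis s 1 :: real^3) $ r) = (\<Sum>s\<in>{r}. (2 * pi * of_int (n s)) * (axis s 1 :: real^3) $ r)"
      by (rule sum.mono_neutral_right) (auto simp: axis_def)
    then have y: "y $ r = x $ r - 2 * pi * of_int \<lfloor>x $ r / (2 * pi)\<rfloor>"
      by (simp add: y_def n_def axis_def)
    have "of_int \<lfloor>x $ r / (2 * pi)\<rfloor> \<le> x $ r / (2 * pi)" "x $ r / (2 * pi) < of_int \<lfloor>x $ r / (2 * pi)\<rfloor> + 1"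
      by linarith+
    then have "2 * pi * of_int \<lfloor>x $ r / (2 * pi)\<rfloor> \<le> x $ r" "x $ r < 2 * pi * (of_int \<lfloor>x $ r / (2 * pi)\<rfloor> + 1)"
      using pi_gt_zero by (simp_all only: pos_le_divide_eq pos_divide_less_eq mult.commute[of "2 * pi"])
    then show "0 \<le> y $ r \<and> y $ r < 2 * pi" unfolding y by (simp add: algebra_simps)
  next
    fix f assume "periodic f"
    then show "f x = f y" using fin[of UNIV f] by (simp add: y_def)
  qed
qed

text \<open>The shifted cell is cut along the hyperplane where the coordinate \<open>r\<close> equals \<open>2 * pi\<close>, and the protruding
slab is moved back by one period.\<close>

lemma cell_shift_integral:
  fixes f :: "real^3 \<Rightarrow> complex"
  assumes f: "continuous_on UNIV f" "periodic f" and a: "0 \<le> a" "a \<le> 2 * pi"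
  shows "integral period_cell (\<lambda>x. f (x + a *\<^sub>R axis r 1)) = integral period_cell f"
proof -
  let ?P = "(\<chi> i. 2 * pi) :: real^3" and ?c = "a *\<^sub>R axis r 1 :: real^3" and ?p = "(2 * pi) *\<^sub>R axis r 1 :: real^3"
  let ?A = "(\<chi> i. if i = r then a else 2 * pi) :: real^3"
  have int: "f integrable_on cbox u v" for u v
    by (intro integrable_continuous continuous_on_subset[OF f(1)]) auto
  have B: "axis r (1::real) \<in> (Basis :: (real^3) set)" by (auto simp: Basis_vec_def)
  have ax: "x \<bullet> axis r 1 = x $ r" for x :: "real^3" by (simp add: inner_axis)
  have shift: "integral (cbox u v) (\<lambda>x. f (x + c)) = integral (cbox (u + c) (v + c)) f" for u v c
    using integral_shift_cbox_plus[of u v f c] by (simp add: o_def add.commute)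
  have axr: "(axis r y :: real^3) $ i = (if i = r then y else 0)" for y i by (simp add: axis_def)
  have 1: "cbox ?c (?P + ?c) \<inter> {x. x \<bullet> axis r 1 \<le> 2 * pi} = period_cell \<inter> {x. x \<bullet> axis r 1 \<ge> a}"
    unfolding period_cell_def
  proof (rule set_eqI)
    fix x :: "real^3"
    have spl: "(\<forall>i. Q i) \<longleftrightarrow> Q r \<and> (\<forall>i. i \<noteq> r \<longrightarrow> Q i)" for Q by metis
    show "x \<in> cbox ?c (?P + ?c) \<inter> {x. x \<bullet> axis r 1 \<le> 2 * pi} \<longleftrightarrow> x \<in> cbox 0 ?P \<inter> {x. x \<bullet> axis r 1 \<ge> a}"
      unfolding Int_iff mem_box_cart mem_Collect_eq ax spl[of "\<lambda>i. _ i \<and> _ i"] using a by (auto simp: axr)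
  qed
  have 2: "cbox ?c (?P + ?c) \<inter> {x. x \<bullet> axis r 1 \<ge> 2 * pi} = cbox (0 + ?p) (?A + ?p)"
    unfolding period_cell_def
  proof (rule set_eqI)
    fix x :: "real^3"
    have spl: "(\<forall>i. Q i) \<longleftrightarrow> Q r \<and> (\<forall>i. i \<noteq> r \<longrightarrow> Q i)" for Q by metis
    show "x \<in> cbox ?c (?P + ?c) \<inter> {x. x \<bullet> axis r 1 \<ge> 2 * pi} \<longleftrightarrow> x \<in> cbox (0 + ?p) (?A + ?p)"
      unfolding Int_iff mem_box_cart mem_Collect_eq ax spl[of "\<lambda>i. _ i \<and> _ i"] using a by (auto simp: axr)
  qed
  have 3: "cbox 0 ?A = period_cell \<inter> {x. x \<bullet> axis r 1 \<le> a}"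
    unfolding period_cell_def
  proof (rule set_eqI)
    fix x :: "real^3"
    have spl: "(\<forall>i. Q i) \<longleftrightarrow> Q r \<and> (\<forall>i. i \<noteq> r \<longrightarrow> Q i)" for Q by metis
    show "x \<in> cbox 0 ?A \<longleftrightarrow> x \<in> cbox 0 ?P \<inter> {x. x \<bullet> axis r 1 \<le> a}"
      unfolding Int_iff mem_box_cart mem_Collect_eq ax spl[of "\<lambda>i. _ i \<and> _ i"] using a by (auto simp: axr)
  qed
  have "integral period_cell (\<lambda>x. f (x + ?c)) = integral (cbox ?c (?P + ?c)) f"
    unfolding period_cell_def shift by simp
  also have "\<dots> = integral (cbox ?c (?P + ?c) \<inter> {x. x \<bullet> axis r 1 \<le> 2 * pi}) f + integral (cbox ?c (?P + ?c) \<inter> {x. x \<bullet> axis r 1 \<ge> 2 * pi}) f"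
    by (rule integral_split[OF int B])
  also have "integral (cbox ?c (?P + ?c) \<inter> {x. x \<bullet> axis r 1 \<ge> 2 * pi}) f = integral (cbox 0 ?A) (\<lambda>x. f (x + ?p))"
    unfolding 2 shift ..
  also have "(\<lambda>x. f (x + ?p)) = f" using f(2) by (auto simp: periodic_def)
  also have "integral (cbox ?c (?P + ?c) \<inter> {x. x \<bullet> axis r 1 \<le> 2 * pi}) f + integral (cbox 0 ?A) f
      = integral period_cell f"
    unfolding 1 3 using integral_split[OF int B, of 0 ?P a] by (simp add: period_cell_def add.commute)
  finally show ?thesis .
qed

section \<open>Test functions\<close>

lemma has_derivative_imp_partial: "(f has_derivative D) (at x) \<Longrightarrow> partial r f x = D (axis r 1)"
  unfolding partial_def using frechet_derivative_at by metis

lemma differentiable_partial: "f differentiable (at x) \<Longrightarrow> (f has_derivative frechet_derivative f (at x)) (at x)"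
  using frechet_derivative_works by blast

lemma smoothD: "smooth f \<Longrightarrow> foldr partial rs f differentiable (at x)"
  by (simp add: smooth_def)

lemma smooth_continuous: "smooth f \<Longrightarrow> continuous_on UNIV (foldr partial rs f)"
  by (intro continuous_at_imp_continuous_on ballI differentiable_imp_continuous_within smoothD)

lemma smooth_partial: "smooth f \<Longrightarrow> smooth (partial r f)"
  unfolding smooth_def
proof (intro allI)
  fix rs x assume "\<forall>rs x. foldr partial rs f differentiable (at x)"
  then have "foldr partial (rs @ [r]) f differentiable (at x)" by blast
  then show "foldr partial rs (partial r f) differentiable (at x)" by simp
qed

lemma periodic_partial:
  assumes "periodic f" "\<And>x. f differentiable (at x)" shows "periodic (partial r f)"
  unfolding periodic_def
proof (intro allI)
  fix x s
  let ?p = "(2 * pi) *\<^sub>R axis s 1 :: real^3"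
  have "(f has_derivative frechet_derivative f (at (x + ?p))) (at (x + ?p))"
    by (intro differentiable_partial assms)
  then have "((\<lambda>x. f (x + ?p)) has_derivative frechet_derivative f (at (x + ?p))) (at x)"
    by (rule has_derivative_compose[OF has_derivative_add_const[OF has_derivative_ident], simplified])
  then have "(f has_derivative frechet_derivative f (at (x + ?p))) (at x)"
    using assms(1) by (simp add: periodic_def)
  then show "partial r f (x + ?p) = partial r f x"
    by (simp add: has_derivative_imp_partial) (simp add: partial_def)
qed

lemma test_functionsD: "\<phi> \<in> test_functions \<Longrightarrow> smooth \<phi>" "\<phi> \<in> test_functions \<Longrightarrow> periodic \<phi>"
  by (simp_all add: test_functions_def)

lemma test_partial: "\<phi> \<in> test_functions \<Longrightarrow> partial r \<phi> \<in> test_functions"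
  using smoothD[of \<phi> "[]"] by (simp add: test_functions_def smooth_partial periodic_partial)

lemma test_foldr_partial: "\<phi> \<in> test_functions \<Longrightarrow> foldr partial rs \<phi> \<in> test_functions"
  by (induction rs) (auto intro: test_partial)

lemma test_continuous: "\<phi> \<in> test_functions \<Longrightarrow> continuous_on S \<phi>"
  using smooth_continuous[of \<phi> "[]"] by (auto simp: test_functions_def intro: continuous_on_subset)

lemma test_differentiable: "\<phi> \<in> test_functions \<Longrightarrow> \<phi> differentiable (at x)"
  using smoothD[of \<phi> "[]"] by (simp add: test_functions_def)

lemma partial_lincomb:
  assumes "f differentiable (at x)" "g differentiable (at x)"
  shows "partial r (\<lambda>x. c * f x + d * g x) x = c * partial r f x + d * partial r g x"
proof -
  have "((\<lambda>x. c * f x + d * g x) has_derivative (\<lambda>h. c * frechet_derivative f (at x) h + d * frechet_derivative g (at x) h)) (at x)"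
    by (intro has_derivative_add has_derivative_mult_right differentiable_partial assms)
  from has_derivative_imp_partial[OF this] show ?thesis by (simp add: partial_def)
qed

lemma foldr_partial_lincomb:
  assumes "smooth f" "smooth g"
  shows "foldr partial rs (\<lambda>x. c * f x + d * g x) = (\<lambda>x. c * foldr partial rs f x + d * foldr partial rs g x)"
proof (induction rs)
  case (Cons r rs)
  have "partial r (\<lambda>x. c * foldr partial rs f x + d * foldr partial rs g x) x = c * partial r (foldr partial rs f) x + d * partial r (foldr partial rs g) x" for x
    by (intro partial_lincomb smoothD assms)
  then show ?case by (simp only: foldr_Cons o_apply Cons.IH)
qed simp

lemma test_lincomb:
  assumes "f \<in> test_functions" "g \<in> test_functions"
  shows "(\<lambda>x. c * f x + d * g x) \<in> test_functions"
proof -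
  have s: "smooth f" "smooth g" using assms by (simp_all add: test_functions_def)
  have "smooth (\<lambda>x. c * f x + d * g x)"
    unfolding smooth_def foldr_partial_lincomb[OF s]
  proof (intro allI)
    fix rs x
    have "((\<lambda>x. c * foldr partial rs f x + d * foldr partial rs g x) has_derivative
        (\<lambda>h. c * frechet_derivative (foldr partial rs f) (at x) h + d * frechet_derivative (foldr partial rs g) (at x) h)) (at x)"
      by (intro has_derivative_add has_derivative_mult_right differentiable_partial smoothD s)
    then show "(\<lambda>x. c * foldr partial rs f x + d * foldr partial rs g x) differentiable (at x)" by (rule differentiableI)
  qed
  then show ?thesis using assms by (simp add: test_functions_def periodic_def)
qed

lemma test_add: "f \<in> test_functions \<Longrightarrow> g \<in> test_functions \<Longrightarrow> (\<lambda>x. f x + g x) \<in> test_functions"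
  using test_lincomb[of f g 1 1] by simp
lemma test_cmult: "f \<in> test_functions \<Longrightarrow> (\<lambda>x. c * f x) \<in> test_functions"
  using test_lincomb[of f f c 0] by simp
text \<open>The integral of the translates of \<open>f\<close> does not depend on the translation, and its derivative at \<open>0\<close>,
computed under the integral sign, is the integral of the partial derivative.\<close>

lemma cell_integral_partial:
  assumes f: "periodic f" "\<And>x. f differentiable (at x)" "continuous_on UNIV (partial r f)"
  shows "integral period_cell (partial r f) = 0"
proof -
  let ?g = "\<lambda>t x. f (x + t *\<^sub>R axis r 1)" and ?g' = "\<lambda>t x. partial r f (x + t *\<^sub>R axis r 1)"
  have cont: "continuous_on UNIV f" "continuous_on UNIV (partial r f)"
    using f by (auto intro!: continuous_at_imp_continuous_on differentiable_imp_continuous_within)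
  have "((\<lambda>t. integral (cbox 0 (\<chi> r. 2 * pi)) (?g t)) has_vector_derivative integral (cbox 0 (\<chi> r. 2 * pi)) (?g' 0)) (at 0 within {0..2 * pi})"
  proof (rule leibniz_rule_vector_derivative)
    fix t x
    have "(f has_derivative frechet_derivative f (at (x + t *\<^sub>R axis r 1))) (at (x + t *\<^sub>R axis r 1))"
      by (intro differentiable_partial f)
    then have "((\<lambda>t. f (x + t *\<^sub>R axis r 1)) has_derivative (\<lambda>h. frechet_derivative f (at (x + t *\<^sub>R axis r 1)) (h *\<^sub>R axis r 1))) (at t within {0..2 * pi})"
      by (rule has_derivative_compose[rotated]) (auto intro!: derivative_eq_intros)
    moreover have "linear (frechet_derivative f (at (x + t *\<^sub>R axis r 1)))"
      by (intro linear_frechet_derivative f)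
    ultimately show "((\<lambda>t. f (x + t *\<^sub>R axis r 1)) has_vector_derivative partial r f (x + t *\<^sub>R axis r 1)) (at t within {0..2 * pi})"
      by (simp add: has_vector_derivative_def partial_def linear_cmul)
  next
    fix t show "?g t integrable_on cbox 0 (\<chi> r. 2 * pi)"
      by (intro integrable_continuous continuous_on_compose2[OF cont(1)] continuous_intros) auto
  next
    show "continuous_on ({0..2 * pi} \<times> cbox 0 (\<chi> r. 2 * pi)) (\<lambda>(t, x). ?g' t x)"
      unfolding case_prod_beta by (intro continuous_on_compose2[OF cont(2)] continuous_intros) auto
  qed auto
  moreover have "integral (cbox 0 (\<chi> r. 2 * pi)) (?g t) = integral period_cell f" if "t \<in> {0..2 * pi}" for t
    using cell_shift_integral[OF cont(1) f(1), of t r] that by (simp add: period_cell_def)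
  ultimately have "((\<lambda>t. integral period_cell f) has_vector_derivative integral (cbox 0 (\<chi> r. 2 * pi)) (?g' 0)) (at 0 within {0..2 * pi})"
    by (elim has_vector_derivative_transform[rotated 2]) auto
  moreover have "((\<lambda>t. integral period_cell f) has_vector_derivative 0) (at 0 within {0..2 * pi})"
    by (rule has_vector_derivative_const)
  moreover have "at (0::real) within {0..2 * pi} \<noteq> bot"
    using pi_gt_zero by (simp add: trivial_limit_within islimpt_Icc)
  ultimately have "integral (cbox 0 (\<chi> r. 2 * pi)) (?g' 0) = 0"
    using vector_derivative_unique_within by metis
  then show ?thesis by (simp add: period_cell_def)
qed

section \<open>The Fourier basis\<close>

lemma basis_fun_has_derivative:
  "(basis_fun k has_derivative (\<lambda>h. \<i> * complex_of_real (real_vec k \<bullet> h) * basis_fun k x)) (at x)"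
proof -
  have "((\<lambda>x. \<i> * complex_of_real (real_vec k \<bullet> x)) has_derivative (\<lambda>h. \<i> * complex_of_real (real_vec k \<bullet> h))) (at x)"
    by (auto intro!: derivative_eq_intros)
  then have "((\<lambda>x. exp (\<i> * complex_of_real (real_vec k \<bullet> x))) has_derivative
     (\<lambda>h. exp (\<i> * complex_of_real (real_vec k \<bullet> x)) * (\<i> * complex_of_real (real_vec k \<bullet> h)))) (at x)"
    by (rule has_derivative_compose) (use DERIV_exp[of "\<i> * complex_of_real (real_vec k \<bullet> x)", unfolded has_field_derivative_def] in simp)
  then have "((\<lambda>x. complex_of_real ((2 * pi) powr (- 3 / 2)) * exp (\<i> * complex_of_real (real_vec k \<bullet> x))) has_derivative
     (\<lambda>h. complex_of_real ((2 * pi) powr (- 3 / 2)) * (exp (\<i> * complex_of_real (real_vec k \<bullet> x)) * (\<i> * complex_of_real (real_vec k \<bullet> h))))) (at x)"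
    by (rule has_derivative_mult_right)
  then show ?thesis by (simp add: basis_fun_def[abs_def] mult_ac)
qed

lemma partial_basis_fun: "partial r (basis_fun k) = (\<lambda>x. \<i> * of_int (k $ r) * basis_fun k x)"
  by (rule ext) (simp add: has_derivative_imp_partial[OF basis_fun_has_derivative] inner_axis real_vec_def)

lemma foldr_partial_basis_fun:
  "foldr partial rs (basis_fun k) = (\<lambda>x. (\<Prod>r\<leftarrow>rs. \<i> * of_int (k $ r)) * basis_fun k x)"
proof (induction rs)
  case (Cons r rs)
  have "partial r (\<lambda>x. c * basis_fun k x) x = c * partial r (basis_fun k) x" for c x
    using has_derivative_imp_partial[OF has_derivative_mult_right[OF basis_fun_has_derivative], of r c k x]
      has_derivative_imp_partial[OF basis_fun_has_derivative, of r k x] by simp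
  then have "partial r (\<lambda>x. c * basis_fun k x) = (\<lambda>x. \<i> * of_int (k $ r) * c * basis_fun k x)" for c
    by (simp add: fun_eq_iff partial_basis_fun mult_ac)
  then show ?case by (simp only: foldr_Cons o_apply Cons.IH list.map prod_list.Cons)
qed simp

lemma basis_fun_test: "basis_fun k \<in> test_functions"
proof -
  have "smooth (basis_fun k)"
    unfolding smooth_def foldr_partial_basis_fun
    by (intro allI, rule differentiableI, rule has_derivative_mult_right, rule basis_fun_has_derivative)
  moreover have "periodic (basis_fun k)"
    unfolding periodic_def
  proof (intro allI)
    fix x r
    have "\<i> * complex_of_real (real_vec k \<bullet> (x + (2 * pi) *\<^sub>R axis r 1)) = \<i> * complex_of_real (real_vec k \<bullet> x) + 2 * of_int (k $ r) * of_real pi * \<i>"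
      by (simp add: inner_add_right inner_axis real_vec_def algebra_simps)
    moreover have "exp (2 * of_int (k $ r) * of_real pi * \<i>) = 1"
      by (auto simp: exp_eq_1 intro!: exI[of _ "k $ r"])
    ultimately show "basis_fun k (x + (2 * pi) *\<^sub>R axis r 1) = basis_fun k x"
      unfolding basis_fun_def by (simp only: exp_add mult_1_right)
  qed
  ultimately show ?thesis by (simp add: test_functions_def)
qed

lemma basis_fun_mult: "basis_fun k x * basis_fun j x = complex_of_real ((2 * pi) powr (- 3 / 2)) * basis_fun (k + j) x"
proof -
  have "real_vec (k + j) = real_vec k + real_vec j" by (simp add: real_vec_def vec_eq_iff)
  then show ?thesis by (simp add: basis_fun_def inner_add_left exp_add[symmetric] algebra_simps)
qed

lemma norm_basis_fun: "norm (basis_fun k x) = (2 * pi) powr (- 3 / 2)"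
  by (simp add: basis_fun_def norm_mult)

lemma cnj_basis_fun: "cnj (basis_fun k x) = basis_fun (- k) x"
  by (simp add: basis_fun_def exp_cnj real_vec_uminus)

lemma content_period_cell: "measure lborel period_cell = (2 * pi) ^ 3"
proof -
  have "(0 :: real^3) \<in> cbox 0 (\<chi> r. 2 * pi)" by (simp add: mem_box_cart)
  then have "cbox (0 :: real^3) (\<chi> r. 2 * pi) \<noteq> {}" by blast
  from content_cbox_cart[OF this] show ?thesis by (simp add: period_cell_def)
qed

text \<open>A nonconstant basis function is a multiple of one of its own partial derivatives.\<close>

lemma cell_integral_basis_fun:
  "integral period_cell (basis_fun k) = (if k = 0 then complex_of_real ((2 * pi) powr (3 / 2)) else 0)"
proof (cases "k = 0")
  case True
  have "basis_fun 0 = (\<lambda>x. complex_of_real ((2 * pi) powr (- 3 / 2)))" by (simp add: basis_fun_def fun_eq_iff)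
  then have "integral period_cell (basis_fun 0) = measure lborel period_cell *\<^sub>R complex_of_real ((2 * pi) powr (- 3 / 2))"
    unfolding period_cell_def by simp
  also have "\<dots> = complex_of_real ((2 * pi) powr 3 * (2 * pi) powr (- 3 / 2))"
  proof -
    have "(2 * pi) powr 3 = (2 * pi) ^ 3" by (intro powr_numeral) simp
    then show ?thesis unfolding content_period_cell by (simp only: scaleR_conv_of_real of_real_mult)
  qed
  also have "(2 * pi) powr 3 * (2 * pi) powr (- 3 / 2) = (2 * pi) powr (3 / 2)" by (simp only: powr_add[symmetric]) simp
  finally show ?thesis using True by simp
next
  case False
  then obtain r where r: "k $ r \<noteq> 0" by (auto simp: vec_eq_iff)
  have "0 = integral period_cell (partial r (basis_fun k))"
    by (intro cell_integral_partial[symmetric] test_functionsD test_differentiable test_continuous test_partial basis_fun_test)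
  also have "\<dots> = \<i> * of_int (k $ r) * integral period_cell (basis_fun k)" unfolding partial_basis_fun by simp
  finally show ?thesis using r False by simp
qed

section \<open>Fourier coefficients determine integrable functions\<close>

abbreviation torus_measure :: "(real^3) measure" where "torus_measure \<equiv> restrict_space lborel period_cell"

lemma period_cell_sets [measurable, simp]: "period_cell \<in> sets borel"
  by (simp add: period_cell_def)

lemma compact_period_cell: "compact period_cell"
  by (simp add: period_cell_def)

lemma space_torus_measure [simp]: "space torus_measure = period_cell"
  by (simp add: space_restrict_space)

lemma emeasure_torus_measure: "emeasure torus_measure period_cell < \<infinity>"
  using emeasure_lborel_cbox_finite[of 0 "(\<chi> r. 2 * pi) :: real^3"] by (simp add: emeasure_restrict_space period_cell_def)

lemma finite_measure_torus_measure: "finite_measure torus_measure"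
  by (rule finite_measureI) (use emeasure_torus_measure in auto)

lemma measure_torus_measure: "measure torus_measure period_cell = (2 * pi) ^ 3"
  by (simp add: measure_restrict_space content_period_cell)

lemma integrable_torus_measure_iff: "integrable torus_measure f \<longleftrightarrow> set_integrable lborel period_cell (f :: _ \<Rightarrow> 'b::{banach, second_countable_topology})"
  by (subst integrable_restrict_space) (auto simp: set_integrable_def)

lemma LINT_torus_measure: "(LINT x|torus_measure. f x) = (LINT x:period_cell|lborel. (f x :: 'b::{banach, second_countable_topology}))"
  by (subst integral_restrict_space) (auto simp: set_lebesgue_integral_def)

lemma measurable_torus_measure: "f \<in> borel_measurable borel \<Longrightarrow> f \<in> borel_measurable torus_measure"
  by (rule measurable_restrict_space1) simp

lemma continuous_integrable_torus_measure:
  fixes f :: "real^3 \<Rightarrow> 'b::{banach, second_countable_topology}"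
  assumes "continuous_on UNIV f" shows "integrable torus_measure f"
  unfolding integrable_torus_measure_iff set_integrable_def
  by (rule borel_integrable_compact[OF compact_period_cell continuous_on_subset[OF assms]]) simp

lemma LINT_torus_measure_eq_integral:
  fixes f :: "real^3 \<Rightarrow> complex"
  assumes "continuous_on UNIV f" shows "(LINT x|torus_measure. f x) = integral period_cell f"
  using continuous_integrable_torus_measure[OF assms] unfolding LINT_torus_measure integrable_torus_measure_iff by (rule set_borel_integral_eq_integral)

lemma integrable_torus_measure_mult_bounded:
  fixes f g :: "real^3 \<Rightarrow> complex"
  assumes f: "integrable torus_measure f" and g: "g \<in> borel_measurable torus_measure" and b: "\<And>x. x \<in> period_cell \<Longrightarrow> norm (g x) \<le> B"
  shows "integrable torus_measure (\<lambda>x. f x * g x)"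
proof (rule Bochner_Integration.integrable_bound[where f = "\<lambda>x. B * norm (f x)"])
  show "integrable torus_measure (\<lambda>x. B * norm (f x))" using f by simp
  show "(\<lambda>x. f x * g x) \<in> borel_measurable torus_measure" using f g by simp
  show "AE x in torus_measure. norm (f x * g x) \<le> norm (B * norm (f x))"
  proof (rule AE_I2)
    fix x assume "x \<in> space torus_measure"
    then have "norm (g x) \<le> B" using b by simp
    moreover from this have "0 \<le> B" using norm_ge_zero order_trans by blast
    ultimately show "norm (f x * g x) \<le> norm (B * norm (f x))"
      by (simp add: norm_mult mult.commute[of B] mult_left_mono)
  qed
qed

inductive_set trig_poly :: "(real^3 \<Rightarrow> complex) set" where
  base: "(\<lambda>x. c * basis_fun k x) \<in> trig_poly"
| add: "f \<in> trig_poly \<Longrightarrow> g \<in> trig_poly \<Longrightarrow> (\<lambda>x. f x + g x) \<in> trig_poly"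

lemma trig_poly_mult: "f \<in> trig_poly \<Longrightarrow> g \<in> trig_poly \<Longrightarrow> (\<lambda>x. f x * g x) \<in> trig_poly"
proof (induction arbitrary: g rule: trig_poly.induct)
  case (base c k)
  then show ?case
  proof (induction rule: trig_poly.induct)
    case (base d j)
    have "(\<lambda>x. c * basis_fun k x * (d * basis_fun j x)) = (\<lambda>x. (c * d * complex_of_real ((2 * pi) powr (- 3 / 2))) * basis_fun (k + j) x)"
      by (rule ext) (metis basis_fun_mult mult.assoc mult.left_commute)
    then show ?case by (simp only: trig_poly.base)
  next
    case (add f g)
    then show ?case by (simp only: distrib_left trig_poly.add)
  qed
next
  case (add f1 f2)
  then show ?case by (simp only: distrib_right trig_poly.add)
qed

lemma basis_fun_0: "basis_fun 0 x = complex_of_real ((2 * pi) powr (- 3 / 2))"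
  by (simp add: basis_fun_def)

lemma powr_cancel: "complex_of_real ((2 * pi) powr (3 / 2)) * complex_of_real ((2 * pi) powr (- 3 / 2)) = 1"
  by (simp only: of_real_mult[symmetric] powr_add[symmetric]) simp

lemma trig_poly_const: "(\<lambda>x. c) \<in> trig_poly"
proof -
  have "(\<lambda>x. c) = (\<lambda>x. (c * complex_of_real ((2 * pi) powr (3 / 2))) * basis_fun 0 x)"
    unfolding basis_fun_0 mult.assoc powr_cancel by simp
  then show ?thesis by (simp only: trig_poly.base)
qed

lemma trig_poly_cis: "(\<lambda>x. exp (\<i> * complex_of_real (real_vec k \<bullet> x))) \<in> trig_poly"
proof -
  have "(\<lambda>x. exp (\<i> * complex_of_real (real_vec k \<bullet> x))) = (\<lambda>x. complex_of_real ((2 * pi) powr (3 / 2)) * basis_fun k x)"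
    unfolding basis_fun_def mult.assoc[symmetric] powr_cancel by simp
  then show ?thesis by (simp only: trig_poly.base)
qed

text \<open>Measurability and integrability are carried along because the induction needs them to split the integral
of a sum.\<close>

lemma trig_poly_integral_zero:
  assumes "g \<in> trig_poly" and f: "integrable torus_measure f" and z: "\<And>k. (LINT x|torus_measure. f x * basis_fun k x) = 0"
  shows "g \<in> borel_measurable torus_measure \<and> integrable torus_measure (\<lambda>x. f x * g x) \<and> (LINT x|torus_measure. f x * g x) = 0"
  using assms(1)
proof (induction rule: trig_poly.induct)
  case (base c k)
  have m: "basis_fun k \<in> borel_measurable torus_measure"
    by (intro measurable_torus_measure borel_measurable_continuous_onI test_continuous basis_fun_test)
  have i: "integrable torus_measure (\<lambda>x. f x * basis_fun k x)"
    by (rule integrable_torus_measure_mult_bounded[OF f m, of "(2 * pi) powr (- 3 / 2)"]) (simp add: norm_basis_fun)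
  have e: "(\<lambda>x. f x * (c * basis_fun k x)) = (\<lambda>x. c * (f x * basis_fun k x))" by (simp add: mult_ac)
  show ?case unfolding e using i m z[of k] by simp
next
  case (add g h)
  then show ?case by (simp add: distrib_left borel_measurable_add)
qed

text \<open>The torus as a compact subset of \<open>\<complex>\<^sup>3\<close>. Opposite faces of the cell are identified, so continuous
functions of \<open>torus_map x\<close> are periodic and trigonometric polynomials separate the points of the image.\<close>

definition torus_map :: "real^3 \<Rightarrow> complex^3" where "torus_map x = (\<chi> r. cis (x $ r))"

lemma continuous_torus_map: "continuous_on S torus_map"
  unfolding torus_map_def cis_conv_exp by (intro continuous_on_vec_lambda continuous_intros)

text \<open>The functions on the image of the torus that pull back to real trigonometric polynomials.\<close>

definition trig_poly_ring :: "(complex^3 \<Rightarrow> real) set" where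
  "trig_poly_ring = {h. continuous_on (torus_map ` period_cell) h \<and> (\<lambda>x. complex_of_real (h (torus_map x))) \<in> trig_poly}"

lemma cos_trig_poly: "(\<lambda>x. complex_of_real (cos (x $ r))) \<in> trig_poly" and sin_trig_poly: "(\<lambda>x. complex_of_real (sin (x $ r))) \<in> trig_poly"
proof -
  define k where "k = (axis r 1 :: int^3)"
  have rv: "real_vec k \<bullet> x = x $ r" "real_vec (- k) \<bullet> x = - (x $ r)" for x
  proof -
    have "real_vec k = axis r 1" by (simp add: real_vec_def k_def axis_def vec_eq_iff)
    then show "real_vec k \<bullet> x = x $ r" "real_vec (- k) \<bullet> x = - (x $ r)"
      by (simp_all add: inner_commute[of "axis r 1"] inner_axis real_vec_uminus)
  qed
  have p: "(\<lambda>x. exp (\<i> * complex_of_real (x $ r))) \<in> trig_poly" using trig_poly_cis[of k] by (simp only: rv)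
  have m: "(\<lambda>x. exp (\<i> * complex_of_real (- (x $ r)))) \<in> trig_poly" using trig_poly_cis[of "- k"] by (simp only: rv)
  have "(\<lambda>x. (1 / 2) * exp (\<i> * complex_of_real (x $ r)) + (1 / 2) * exp (\<i> * complex_of_real (- (x $ r)))) \<in> trig_poly"
    by (intro trig_poly.add trig_poly_mult trig_poly_const p m)
  moreover have "(1 / 2) * exp (\<i> * complex_of_real y) + (1 / 2) * exp (\<i> * complex_of_real (- y)) = complex_of_real (cos y)" for y
    by (simp only: cis_conv_exp[symmetric]) (simp add: complex_eq_iff)
  ultimately show "(\<lambda>x. complex_of_real (cos (x $ r))) \<in> trig_poly" by (simp only:)
  have "(\<lambda>x. (- \<i> / 2) * exp (\<i> * complex_of_real (x $ r)) + (\<i> / 2) * exp (\<i> * complex_of_real (- (x $ r)))) \<in> trig_poly"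
    by (intro trig_poly.add trig_poly_mult trig_poly_const p m)
  moreover have "(- \<i> / 2) * exp (\<i> * complex_of_real y) + (\<i> / 2) * exp (\<i> * complex_of_real (- y)) = complex_of_real (sin y)" for y
    by (simp only: cis_conv_exp[symmetric]) (simp add: complex_eq_iff)
  ultimately show "(\<lambda>x. complex_of_real (sin (x $ r))) \<in> trig_poly" by (simp only:)
qed

lemma function_ring_trig_poly: "function_ring_on trig_poly_ring (torus_map ` period_cell)"
proof
  show "compact (torus_map ` period_cell)" by (intro compact_continuous_image continuous_torus_map compact_period_cell)
  show "continuous_on (torus_map ` period_cell) f" if "f \<in> trig_poly_ring" for f using that by (simp add: trig_poly_ring_def)
  show "(\<lambda>x. f x + g x) \<in> trig_poly_ring" if "f \<in> trig_poly_ring" "g \<in> trig_poly_ring" for f g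
    using that by (simp add: trig_poly_ring_def continuous_on_add trig_poly.add)
  show "(\<lambda>x. f x * g x) \<in> trig_poly_ring" if "f \<in> trig_poly_ring" "g \<in> trig_poly_ring" for f g
    using that by (simp add: trig_poly_ring_def continuous_on_mult trig_poly_mult)
  show "(\<lambda>_. c) \<in> trig_poly_ring" for c by (simp add: trig_poly_ring_def trig_poly_const)
  fix z w :: "complex^3" assume "z \<noteq> w"
  then obtain r where "z $ r \<noteq> w $ r" by (auto simp: vec_eq_iff)
  then consider "Re (z $ r) \<noteq> Re (w $ r)" | "Im (z $ r) \<noteq> Im (w $ r)" by (auto simp: complex_eq_iff)
  then show "\<exists>f\<in>trig_poly_ring. f z \<noteq> f w"
  proof cases
    case 1
    have "(\<lambda>x. complex_of_real (Re (torus_map x $ r))) = (\<lambda>x. complex_of_real (cos (x $ r)))"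
      by (rule ext) (simp only: torus_map_def vec_lambda_beta cis.sel)
    then have "(\<lambda>z. Re (z $ r)) \<in> trig_poly_ring"
      using cos_trig_poly[of r] unfolding trig_poly_ring_def
      by (simp only: mem_Collect_eq continuous_on_Re[OF bounded_linear.continuous_on[OF bounded_linear_vec_nth continuous_on_id]])
    then show ?thesis by (rule bexI[rotated]) (rule 1)
  next
    case 2
    have "(\<lambda>x. complex_of_real (Im (torus_map x $ r))) = (\<lambda>x. complex_of_real (sin (x $ r)))"
      by (rule ext) (simp only: torus_map_def vec_lambda_beta cis.sel)
    then have "(\<lambda>z. Im (z $ r)) \<in> trig_poly_ring"
      using sin_trig_poly[of r] unfolding trig_poly_ring_def
      by (simp only: mem_Collect_eq continuous_on_Im[OF bounded_linear.continuous_on[OF bounded_linear_vec_nth continuous_on_id]])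
    then show ?thesis by (rule bexI[rotated]) (rule 2)
  qed
qed

text \<open>By the Stone-Weierstrass theorem \<open>h\<close> is uniformly close to some function in the ring, against which
\<open>f\<close> integrates to zero.\<close>

lemma continuous_torus_integral_zero:
  assumes f: "integrable torus_measure f" and z: "\<And>k. (LINT x|torus_measure. f x * basis_fun k x) = 0"
    and h: "continuous_on UNIV (h :: complex^3 \<Rightarrow> real)"
  shows "(LINT x|torus_measure. f x * complex_of_real (h (torus_map x))) = 0"
proof -
  interpret function_ring_on trig_poly_ring "torus_map ` period_cell" by (rule function_ring_trig_poly)
  let ?H = "\<lambda>x. complex_of_real (h (torus_map x))"
  have Hc: "continuous_on UNIV ?H"
    by (intro continuous_on_of_real continuous_on_compose2[OF h continuous_torus_map]) auto
  have bnd: "bounded (?H ` period_cell)"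
    by (intro compact_imp_bounded compact_continuous_image compact_period_cell continuous_on_subset[OF Hc]) auto
  then obtain B where B: "\<And>x. x \<in> period_cell \<Longrightarrow> norm (?H x) \<le> B" unfolding bounded_iff by blast
  have Hi: "integrable torus_measure (\<lambda>x. f x * ?H x)"
    by (rule integrable_torus_measure_mult_bounded[OF f _ B]) (auto intro!: measurable_torus_measure borel_measurable_continuous_onI Hc)
  have "norm (LINT x|torus_measure. f x * ?H x) \<le> e * (LINT x|torus_measure. norm (f x))" if e: "e > 0" for e
  proof -
    obtain g where g: "g \<in> trig_poly_ring" "\<And>y. y \<in> torus_map ` period_cell \<Longrightarrow> \<bar>h y - g y\<bar> < e"
      using Stone_Weierstrass_basic[OF continuous_on_subset[OF h] e] by blast
    let ?G = "\<lambda>x. complex_of_real (g (torus_map x))"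
    have G: "?G \<in> borel_measurable torus_measure" "integrable torus_measure (\<lambda>x. f x * ?G x)" "(LINT x|torus_measure. f x * ?G x) = 0"
      using trig_poly_integral_zero[OF _ f z, of ?G] g(1) by (simp_all add: trig_poly_ring_def)
    have "(LINT x|torus_measure. f x * ?H x) = (LINT x|torus_measure. f x * ?H x - f x * ?G x)"
      using Bochner_Integration.integral_diff[OF Hi G(2)] G(3) by simp
    also have "norm \<dots> \<le> (LINT x|torus_measure. e * norm (f x))"
    proof (rule Bochner_Integration.integral_norm_bound_integral)
      show "integrable torus_measure (\<lambda>x. f x * ?H x - f x * ?G x)" using Hi G by simp
      show "integrable torus_measure (\<lambda>x. e * norm (f x))" using f by simp
      fix x assume "x \<in> space torus_measure"
      then have "\<bar>h (torus_map x) - g (torus_map x)\<bar> < e" using g(2) by simp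
      then have "norm (f x) * \<bar>h (torus_map x) - g (torus_map x)\<bar> \<le> norm (f x) * e" by (intro mult_left_mono) auto
      then show "norm (f x * ?H x - f x * ?G x) \<le> e * norm (f x)"
        by (simp only: right_diff_distrib[symmetric] of_real_diff[symmetric] norm_mult norm_of_real mult.commute[of e])
    qed
    finally show ?thesis by simp
  qed
  note small = this
  have "norm (LINT x|torus_measure. f x * ?H x) \<le> 0"
  proof (rule field_le_epsilon)
    fix e :: real assume e: "e > 0"
    let ?I = "LINT x|torus_measure. norm (f x)"
    have I: "?I \<ge> 0" by simp
    have "norm (LINT x|torus_measure. f x * ?H x) \<le> e / (?I + 1) * ?I" using e I by (intro small divide_pos_pos add_nonneg_pos) auto
    also have "\<dots> = e * (?I / (?I + 1))" by simp
    also have "\<dots> \<le> e * 1" using e I divide_le_eq_1_pos[of "?I + 1" ?I] by (intro mult_left_mono) linarith+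
    finally show "norm (LINT x|torus_measure. f x * ?H x) \<le> 0 + e" by simp
  qed
  then show ?thesis by simp
qed

text \<open>Coordinates with equal image differ by a multiple of \<open>2 * pi\<close>, and the difference is smaller than
\<open>2 * pi\<close> because \<open>x\<close> is an interior point.\<close>

lemma torus_map_interior_inj:
  assumes x: "x \<in> box 0 (\<chi> r. 2 * pi)" and y: "y \<in> period_cell" and eq: "torus_map x = torus_map y"
  shows "x = y"
proof -
  have "x $ r = y $ r" for r
  proof -
    have "cis (x $ r) = cis (y $ r)" using eq by (simp add: torus_map_def vec_eq_iff)
    then obtain n :: int where n: "x $ r = y $ r + 2 * of_int n * pi"
      using sin_cos_eq_iff[of "x $ r" "y $ r"] by (auto simp: complex_eq_iff mult_ac)
    have b: "0 < x $ r" "x $ r < 2 * pi" "0 \<le> y $ r" "y $ r \<le> 2 * pi"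
      using x y by (auto simp: mem_box_cart period_cell_iff)
    then have m: "2 * of_int n * pi < 2 * 1 * pi" "2 * (-1) * pi < 2 * of_int n * pi" using n by linarith+
    have "n < 1"
    proof (rule ccontr)
      assume "\<not> n < 1"
      then have "2 * 1 * pi \<le> 2 * of_int n * pi" by (intro mult_right_mono mult_left_mono) auto
      with m(1) show False by linarith
    qed
    moreover have "n > -1"
    proof (rule ccontr)
      assume "\<not> n > -1"
      then have "of_int n \<le> (-1 :: real)" by linarith
      then have "2 * of_int n * pi \<le> 2 * (-1) * pi" by (intro mult_right_mono mult_left_mono) auto
      with m(2) show False by linarith
    qed
    ultimately have "n = 0" by linarith
    then show ?thesis using n by simp
  qed
  then show ?thesis by (simp add: vec_eq_iff)
qed

text \<open>The indicator of an open set inside the cell is the pointwise limit of continuous functions of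
\<open>torus_map x\<close>, namely truncated multiples of the distance from the image of the complement. These
vanish outside the set and are positive on it because \<open>torus_map\<close> does not identify interior points
with other points of the cell.\<close>

lemma open_interior_integral_zero:
  assumes f: "integrable torus_measure f" and z: "\<And>k. (LINT x|torus_measure. f x * basis_fun k x) = 0"
    and V: "open V" "V \<subseteq> box 0 (\<chi> r. 2 * pi)"
  shows "(LINT x:V|torus_measure. f x) = 0"
proof (cases "period_cell - V = {}")
  case True
  then have "period_cell \<subseteq> box 0 (\<chi> r. 2 * pi)" using V by auto
  moreover have "(0 :: real^3) \<in> period_cell" by (simp add: period_cell_iff)
  ultimately have "(0 :: real^3) \<in> box 0 (\<chi> r. 2 * pi)" by blast
  then show ?thesis by (simp add: mem_box_cart)
next
  case False
  define K where "K = torus_map ` (period_cell - V)"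
  have K: "compact K" "K \<noteq> {}"
    unfolding K_def using False V(1)
    by (auto intro!: compact_continuous_image continuous_torus_map compact_diff compact_period_cell)
  define g where "g n z = min 1 (real n * infdist z K)" for n z
  have gc: "continuous_on UNIV (g n)" for n unfolding g_def by (intro continuous_intros)
  let ?G = "\<lambda>n x. f x * complex_of_real (g n (torus_map x))"
  have lim: "(\<lambda>n. g n (torus_map x)) \<longlonglongrightarrow> indicator V x" if x: "x \<in> period_cell" for x
  proof (cases "x \<in> V")
    case True
    have "torus_map x \<notin> K"
    proof
      assume "torus_map x \<in> K"
      then obtain y where y: "y \<in> period_cell - V" "torus_map x = torus_map y" by (auto simp: K_def)
      then have "x = y" using True V by (intro torus_map_interior_inj) auto
      then show False using y True by simp
    qed
    then have pos: "infdist (torus_map x) K > 0"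
      using K by (simp add: infdist_pos_not_in_closed compact_imp_closed)
    obtain N where N: "1 / infdist (torus_map x) K < real N" using reals_Archimedean2 by blast
    have "g n (torus_map x) = 1" if "n \<ge> N" for n
    proof -
      have "1 \<le> real N * infdist (torus_map x) K" using N pos by (simp add: field_simps)
      also have "\<dots> \<le> real n * infdist (torus_map x) K" using that pos by (intro mult_right_mono) auto
      finally show ?thesis by (simp add: g_def)
    qed
    then show ?thesis using True by (intro tendsto_eventually) (auto simp: eventually_sequentially)
  next
    case False
    then have "torus_map x \<in> K" using x by (auto simp: K_def)
    then show ?thesis using False by (simp add: g_def)
  qed
  have "(\<lambda>n. LINT x|torus_measure. ?G n x) \<longlonglongrightarrow> (LINT x|torus_measure. indicator V x *\<^sub>R f x)"
  proof (rule integral_dominated_convergence[where w = "\<lambda>x. norm (f x)"])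
    have [measurable]: "f \<in> borel_measurable torus_measure" using f by simp
    have [measurable]: "V \<in> sets borel" using V by simp
    show "(\<lambda>x. indicator V x *\<^sub>R f x) \<in> borel_measurable torus_measure"
      by (intro borel_measurable_scaleR measurable_torus_measure[of "indicator V"]) auto
    have "(\<lambda>x. complex_of_real (g n (torus_map x))) \<in> borel_measurable torus_measure" for n
      by (intro measurable_torus_measure borel_measurable_continuous_onI continuous_on_of_real continuous_on_compose2[OF gc continuous_torus_map]) auto
    then show "?G n \<in> borel_measurable torus_measure" for n by simp
    show "integrable torus_measure (\<lambda>x. norm (f x))" using f by simp
    show "AE x in torus_measure. (\<lambda>n. ?G n x) \<longlonglongrightarrow> indicator V x *\<^sub>R f x"
    proof (rule AE_I2)
      fix x assume "x \<in> space torus_measure"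
      then have "(\<lambda>n. f x * complex_of_real (g n (torus_map x))) \<longlonglongrightarrow> f x * complex_of_real (indicator V x)"
        by (intro tendsto_mult_left tendsto_of_real lim) simp
      then show "(\<lambda>n. ?G n x) \<longlonglongrightarrow> indicator V x *\<^sub>R f x" by (simp add: scaleR_conv_of_real mult.commute)
    qed
    show "AE x in torus_measure. norm (?G n x) \<le> norm (f x)" for n
    proof (rule AE_I2)
      fix x
      have "\<bar>g n (torus_map x)\<bar> \<le> 1" by (simp add: g_def infdist_nonneg)
      then show "norm (?G n x) \<le> norm (f x)" by (simp add: norm_mult mult_left_le)
    qed
  qed
  moreover have "(LINT x|torus_measure. ?G n x) = 0" for n
    by (rule continuous_torus_integral_zero[OF f z gc])
  ultimately show ?thesis by (simp add: set_lebesgue_integral_def LIMSEQ_const_iff)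
qed

lemma AE_torus_measure_interior: "AE x in torus_measure. x \<in> box 0 (\<chi> r. 2 * pi)"
proof -
  have "AE x in lborel. x \<notin> cbox 0 (\<chi> r. 2 * pi) - box (0::real^3) (\<chi> r. 2 * pi)"
  proof -
    have "negligible (cbox 0 (\<chi> r. 2 * pi) - box (0::real^3) (\<chi> r. 2 * pi))" by (rule negligible_frontier_interval)
    then have "AE x in lebesgue. x \<notin> cbox 0 (\<chi> r. 2 * pi) - box (0::real^3) (\<chi> r. 2 * pi)"
      by (intro AE_not_in) (simp only: negligible_iff_null_sets)
    then show ?thesis by (simp add: AE_completion_iff)
  qed
  then show ?thesis
    by (subst AE_restrict_space_iff) (auto simp: period_cell_def elim: eventually_mono)
qed

text \<open>The open sets form a generator of the Borel sets that is stable under intersection, so the vanishing of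
the integral extends from open sets to all Borel sets.\<close>

theorem fourier_coefficients_zero_imp_AE_zero:
  assumes f: "integrable torus_measure f" and z: "\<And>k. (LINT x|torus_measure. f x * basis_fun k x) = 0"
  shows "AE x in torus_measure. f x = 0"
proof -
  interpret finite_measure torus_measure by (rule finite_measure_torus_measure)
  have si: "set_integrable torus_measure A f" if "A \<in> sets borel" for A
  proof -
    have "A \<inter> period_cell \<in> sets torus_measure" using that by (auto simp: sets_restrict_space)
    then have "set_integrable torus_measure (A \<inter> period_cell) f"
      unfolding set_integrable_def using f by (intro integrable_mult_indicator)
    then show ?thesis unfolding set_integrable_def
      by (rule Bochner_Integration.integrable_cong[THEN iffD1, rotated 2]) (auto simp: indicator_def)
  qed
  have full: "(LINT x|torus_measure. f x) = 0"
  proof -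
    have "0 = complex_of_real ((2 * pi) powr (3 / 2)) * (LINT x|torus_measure. f x * basis_fun 0 x)" using z by simp
    also have "\<dots> = (LINT x|torus_measure. f x * (complex_of_real ((2 * pi) powr (3 / 2)) * basis_fun 0 x))"
      by (subst integral_mult_right_zero[symmetric]) (simp add: mult_ac)
    finally show ?thesis by (simp only: basis_fun_0 powr_cancel mult_1_right)
  qed
  have borel_zero: "(LINT x:A|torus_measure. f x) = 0" if "A \<in> sigma_sets UNIV {S :: (real^3) set. open S}" for A
  proof (rule sigma_sets_induct_disjoint[OF _ _ that])
    show "Int_stable {S :: (real^3) set. open S}" by (auto simp: Int_stable_def)
    show "{S :: (real^3) set. open S} \<subseteq> Pow UNIV" by auto
    show "(LINT x:{}|torus_measure. f x) = 0" by (simp add: set_lebesgue_integral_def)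
    show "(LINT x:A|torus_measure. f x) = 0" if "A \<in> {S. open S}" for A
    proof -
      have "(LINT x:A|torus_measure. f x) = (LINT x:A \<inter> box 0 (\<chi> r. 2 * pi)|torus_measure. f x)"
        unfolding set_lebesgue_integral_def
      proof (rule integral_cong_AE)
        show "(\<lambda>x. indicat_real A x *\<^sub>R f x) \<in> borel_measurable torus_measure"
          using si[of A] that by (auto simp: set_integrable_def)
        show "(\<lambda>x. indicat_real (A \<inter> box 0 (\<chi> r. 2 * pi)) x *\<^sub>R f x) \<in> borel_measurable torus_measure"
          using si[of "A \<inter> box 0 (\<chi> r. 2 * pi)"] that by (auto simp: set_integrable_def)
        show "AE x in torus_measure. indicat_real A x *\<^sub>R f x = indicat_real (A \<inter> box 0 (\<chi> r. 2 * pi)) x *\<^sub>R f x"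
          using AE_torus_measure_interior by eventually_elim (simp add: indicator_def)
      qed
      also have "\<dots> = 0"
        using that by (intro open_interior_integral_zero[OF f z] open_Int) auto
      finally show ?thesis .
    qed
    show "(LINT x:UNIV - A|torus_measure. f x) = 0" if A: "A \<in> sigma_sets UNIV {S. open S}" and 0: "(LINT x:A|torus_measure. f x) = 0" for A
    proof -
      have A': "A \<in> sets borel" using A by (simp add: borel_def)
      have "(LINT x:UNIV - A|torus_measure. f x) = (LINT x|torus_measure. f x - indicat_real A x *\<^sub>R f x)"
        unfolding set_lebesgue_integral_def by (rule Bochner_Integration.integral_cong) (auto simp: indicator_def)
      also have "\<dots> = 0"
        using 0 full si[OF A'] f by (subst Bochner_Integration.integral_diff) (auto simp: set_integrable_def set_lebesgue_integral_def)
      finally show ?thesis .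
    qed
    show "(LINT x:(\<Union>i. A i)|torus_measure. f x) = 0"
      if disj: "disjoint_family A" and A: "range A \<subseteq> sigma_sets UNIV {S. open S}" and 0: "\<And>i. (LINT x:A i|torus_measure. f x) = 0" for A :: "nat \<Rightarrow> _"
    proof -
      have A': "A i \<in> sets borel" for i using A by (auto simp: borel_def)
      have eq: "(LINT x:B|torus_measure. f x) = (LINT x:B \<inter> period_cell|torus_measure. f x)" for B
        unfolding set_lebesgue_integral_def by (rule Bochner_Integration.integral_cong) (auto simp: indicator_def)
      have "(LINT x:(\<Union>i. A i \<inter> period_cell)|torus_measure. f x) = (\<Sum>i. LINT x:A i \<inter> period_cell|torus_measure. f x)"
      proof (rule lebesgue_integral_countable_add)
        show "A i \<inter> period_cell \<in> sets torus_measure" for i using A' by (auto simp: sets_restrict_space)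
        show "A i \<inter> period_cell \<inter> (A j \<inter> period_cell) = {}" if "i \<noteq> j" for i j
          using disj that by (auto simp: disjoint_family_on_def)
        show "set_integrable torus_measure (\<Union>i. A i \<inter> period_cell) f"
          using A' by (intro si sets.countable_UN) auto
      qed
      also have "\<dots> = 0" using 0 by (simp add: eq[symmetric])
      finally show ?thesis by (simp add: eq[of "\<Union>i. A i"] Int_UN_distrib2)
    qed
  qed
  show ?thesis
  proof (rule density_zero[OF f])
    fix A assume "A \<in> sets torus_measure"
    then have "A \<in> sets borel" by (auto simp: sets_restrict_space)
    then show "(LINT x:A|torus_measure. f x) = 0" by (intro borel_zero) (simp add: borel_def)
  qed
qed

section \<open>Fourier coefficients of test functions\<close>

text \<open>The same number, with the sign of \<open>k\<close> reversed, is the value at \<open>\<phi>\<close> of the distribution given by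
a basis function.\<close>

definition fhat :: "(real^3 \<Rightarrow> complex) \<Rightarrow> int^3 \<Rightarrow> complex" where
  "fhat \<phi> k = (LINT x|torus_measure. \<phi> x * basis_fun (- k) x)"

abbreviation sup_norm :: "(real^3 \<Rightarrow> complex) \<Rightarrow> real" where
  "sup_norm \<phi> \<equiv> (SUP x. cmod (\<phi> x))"

lemma continuous_basis_fun: "continuous_on S (basis_fun k)"
  by (rule test_continuous[OF basis_fun_test])

lemma distribution_of_basis_fun: "\<phi> \<in> test_functions \<Longrightarrow> distribution_of (basis_fun k) \<phi> = fhat \<phi> (- k)"
  by (simp add: distribution_of_def fhat_def LINT_torus_measure mult.commute)

lemma fhat_eq_integral: "\<phi> \<in> test_functions \<Longrightarrow> fhat \<phi> k = integral period_cell (\<lambda>x. \<phi> x * basis_fun (- k) x)"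
  unfolding fhat_def by (intro LINT_torus_measure_eq_integral continuous_on_mult test_continuous continuous_basis_fun)

lemma integral_basis_fun_mult: "(LINT x|torus_measure. basis_fun j x * basis_fun k x) = (if j + k = 0 then 1 else 0)"
proof -
  have "(LINT x|torus_measure. basis_fun j x * basis_fun k x) = complex_of_real ((2 * pi) powr (- 3 / 2)) * (LINT x|torus_measure. basis_fun (j + k) x)"
    unfolding basis_fun_mult by simp
  also have "(LINT x|torus_measure. basis_fun (j + k) x) = (if j + k = 0 then complex_of_real ((2 * pi) powr (3 / 2)) else 0)"
    unfolding LINT_torus_measure_eq_integral[OF continuous_basis_fun] by (rule cell_integral_basis_fun)
  finally show ?thesis using powr_cancel by (simp add: mult.commute)
qed

lemma fhat_basis_fun: "fhat (basis_fun j) k = (if j = k then 1 else 0)"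
  unfolding fhat_def integral_basis_fun_mult by simp

lemma fhat_partial:
  assumes \<phi>: "\<phi> \<in> test_functions" shows "fhat (partial r \<phi>) k = \<i> * of_int (k $ r) * fhat \<phi> k"
proof -
  let ?e = "basis_fun (- k)"
  have d: "((\<lambda>x. \<phi> x * ?e x) has_derivative
      (\<lambda>h. \<phi> x * (\<i> * complex_of_real (real_vec (- k) \<bullet> h) * ?e x) + frechet_derivative \<phi> (at x) h * ?e x)) (at x)" for x
    by (rule has_derivative_mult[OF differentiable_partial[OF test_differentiable[OF \<phi>]] basis_fun_has_derivative])
  have p: "partial r (\<lambda>x. \<phi> x * ?e x) = (\<lambda>x. partial r \<phi> x * ?e x - \<i> * of_int (k $ r) * (\<phi> x * ?e x))"
    by (rule ext) (simp add: has_derivative_imp_partial[OF d] partial_def inner_axis real_vec_def algebra_simps)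
  have c1: "continuous_on UNIV (\<lambda>x. partial r \<phi> x * ?e x)" and c2: "continuous_on UNIV (\<lambda>x. \<phi> x * ?e x)"
    by (intro continuous_on_mult test_continuous test_partial \<phi> basis_fun_test)+
  have i: "(\<lambda>x. partial r \<phi> x * ?e x) integrable_on period_cell" "(\<lambda>x. \<phi> x * ?e x) integrable_on period_cell"
    unfolding period_cell_def by (intro integrable_continuous continuous_on_subset[OF c1] continuous_on_subset[OF c2] subset_UNIV)+
  have "integral period_cell (partial r (\<lambda>x. \<phi> x * ?e x)) = 0"
  proof (rule cell_integral_partial)
    show "periodic (\<lambda>x. \<phi> x * ?e x)" using test_functionsD(2)[OF \<phi>] test_functionsD(2)[OF basis_fun_test, of "- k"] by (simp add: periodic_def)
    show "(\<lambda>x. \<phi> x * ?e x) differentiable (at x)" for x using d by (rule differentiableI)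
    show "continuous_on UNIV (partial r (\<lambda>x. \<phi> x * ?e x))" unfolding p by (intro continuous_intros c1 c2)
  qed
  then have "integral period_cell (\<lambda>x. partial r \<phi> x * ?e x) - integral period_cell (\<lambda>x. \<i> * of_int (k $ r) * (\<phi> x * ?e x)) = 0"
    unfolding p using i by (subst (asm) integral_diff) (auto intro: integrable_on_mult_right)
  then show ?thesis by (simp add: fhat_eq_integral test_partial \<phi>)
qed

lemma fhat_foldr_partial:
  assumes \<phi>: "\<phi> \<in> test_functions" shows "fhat (foldr partial rs \<phi>) k = (\<Prod>r\<leftarrow>rs. \<i> * of_int (k $ r)) * fhat \<phi> k"
  by (induction rs) (simp_all add: fhat_partial test_foldr_partial \<phi> mult_ac)

section \<open>Norms of test functions and decay\<close>

lemma periodic_continuous_bounded: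
  assumes "periodic f" "continuous_on UNIV f" shows "bdd_above (range (\<lambda>x. cmod (f x)))"
proof -
  have "bounded (f ` period_cell)"
    by (intro compact_imp_bounded compact_continuous_image compact_period_cell continuous_on_subset[OF assms(2)] subset_UNIV)
  then obtain B where B: "\<And>x. x \<in> period_cell \<Longrightarrow> cmod (f x) \<le> B" unfolding bounded_iff by blast
  show ?thesis
  proof (rule bdd_aboveI2)
    fix x
    obtain y where y: "\<And>r. 0 \<le> y $ r \<and> y $ r < 2 * pi" "\<And>f. periodic f \<Longrightarrow> f x = f y" by (rule periodic_reduce[of x]) blast
    have "y \<in> period_cell" using y(1) by (simp add: period_cell_iff less_imp_le)
    then show "cmod (f x) \<le> B" using B y(2)[OF assms(1)] by simp
  qed
qed

lemma test_bdd: "\<phi> \<in> test_functions \<Longrightarrow> bdd_above (range (\<lambda>x. cmod (\<phi> x)))"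
  by (intro periodic_continuous_bounded test_functionsD test_continuous)

lemma norm_le_sup_norm: "\<phi> \<in> test_functions \<Longrightarrow> cmod (\<phi> x) \<le> sup_norm \<phi>"
  by (rule cSUP_upper[OF UNIV_I test_bdd])

lemma sup_norm_nonneg: "\<phi> \<in> test_functions \<Longrightarrow> 0 \<le> sup_norm \<phi>"
  using norm_le_sup_norm[of \<phi> 0] norm_ge_zero order_trans by blast

lemma finite_multi_indices: "finite {rs :: 3 list. length rs \<le> m}"
  using finite_lists_length_le[of "UNIV :: 3 set" m] by simp

lemma sup_norm_le_C_norm:
  assumes \<phi>: "\<phi> \<in> test_functions" and "length rs \<le> m" shows "sup_norm (foldr partial rs \<phi>) \<le> C_norm m \<phi>"
  unfolding C_norm_def using assms(2)
  by (intro member_le_sum[where f = "\<lambda>rs. sup_norm (foldr partial rs \<phi>)"] finite_multi_indices) (auto intro!: sup_norm_nonneg test_foldr_partial \<phi>)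

lemma C_norm_nonneg: "\<phi> \<in> test_functions \<Longrightarrow> 0 \<le> C_norm m \<phi>"
  unfolding C_norm_def by (intro sum_nonneg sup_norm_nonneg test_foldr_partial)

lemma norm_fhat_le:
  assumes \<phi>: "\<phi> \<in> test_functions" shows "cmod (fhat \<phi> k) \<le> (2 * pi) ^ 3 * sup_norm \<phi>"
proof -
  interpret finite_measure torus_measure by (rule finite_measure_torus_measure)
  have "cmod (fhat \<phi> k) \<le> (LINT x|torus_measure. sup_norm \<phi>)"
    unfolding fhat_def
  proof (rule Bochner_Integration.integral_norm_bound_integral)
    show "integrable torus_measure (\<lambda>x. \<phi> x * basis_fun (- k) x)"
      by (intro continuous_integrable_torus_measure continuous_on_mult test_continuous \<phi> basis_fun_test)
    show "cmod (\<phi> x * basis_fun (- k) x) \<le> sup_norm \<phi>" for x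
      using mult_mono[OF norm_le_sup_norm[OF \<phi>, of x] two_pi_powr_le_1] sup_norm_nonneg[OF \<phi>] by (simp add: norm_mult norm_basis_fun)
  qed simp
  also have "\<dots> = (2 * pi) ^ 3 * sup_norm \<phi>" using measure_torus_measure by simp
  finally show ?thesis .
qed

text \<open>The product of three nonnegative numbers is at most the sum of their cubes, and
\<open>(1 + a) ^ 3 \<le> 4 + 4 * a ^ 3\<close> for \<open>a \<ge> 0\<close>.\<close>

lemma prod_one_add_square_le:
  fixes x :: "3 \<Rightarrow> real"
  shows "(\<Prod>r\<in>UNIV. 1 + (x r)\<^sup>2) \<le> 12 + 4 * (\<Sum>r\<in>UNIV. \<bar>x r\<bar> ^ 6)"
proof -
  have cube: "(1 + a) ^ 3 \<le> 4 + 4 * a ^ 3" if "a \<ge> 0" for a :: real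
  proof -
    have "4 + 4 * a ^ 3 - (1 + a) ^ 3 = 3 * ((1 - a)\<^sup>2 * (1 + a))" by (simp add: power2_eq_square power3_eq_cube algebra_simps)
    also have "\<dots> \<ge> 0" using that by simp
    finally show ?thesis by simp
  qed
  have three: "p * q * s \<le> p ^ 3 + q ^ 3 + s ^ 3" if "p \<ge> 0" "q \<ge> 0" "s \<ge> 0" for p q s :: real
  proof -
    define m where "m = max p (max q s)"
    have m: "p \<le> m" "q \<le> m" "s \<le> m" "m \<ge> 0" using that by (auto simp: m_def)
    have "p * q * s \<le> m * m * m" using that m by (intro mult_mono) auto
    also have "\<dots> = m ^ 3" by (simp add: power3_eq_cube)
    also have "\<dots> \<le> p ^ 3 + q ^ 3 + s ^ 3" unfolding m_def max_def using that by auto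
    finally show ?thesis .
  qed
  have "(\<Prod>r\<in>UNIV. 1 + (x r)\<^sup>2) \<le> (1 + (x 1)\<^sup>2) ^ 3 + (1 + (x 2)\<^sup>2) ^ 3 + (1 + (x 3)\<^sup>2) ^ 3"
    unfolding UNIV_3 using three[of "1 + (x 1)\<^sup>2" "1 + (x 2)\<^sup>2" "1 + (x 3)\<^sup>2"] by (simp add: mult.assoc)
  also have "\<dots> \<le> (4 + 4 * ((x 1)\<^sup>2) ^ 3) + (4 + 4 * ((x 2)\<^sup>2) ^ 3) + (4 + 4 * ((x 3)\<^sup>2) ^ 3)"
    by (intro add_mono cube) auto
  also have "\<dots> = 12 + 4 * (\<Sum>r\<in>UNIV. \<bar>x r\<bar> ^ 6)"
    unfolding UNIV_3 by (simp add: power_mult[symmetric])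
  finally show ?thesis .
qed

text \<open>Derivatives of order six suffice: they bound \<open>(1 + |k|) ^ 6\<close> times the coefficient up to constants, and this
dominates the product of the three one-dimensional weights, whose inverses have a finite sum over
\<open>\<int>\<^sup>3\<close>.\<close>

lemma fhat_decay:
  assumes \<phi>: "\<phi> \<in> test_functions"
  shows "(\<Prod>r\<in>UNIV. 1 + (real_of_int (k $ r))\<^sup>2) * cmod (fhat \<phi> k) \<le> 24 * (2 * pi) ^ 3 * C_norm 6 \<phi>"
proof -
  let ?c = "(2 * pi) ^ 3 * C_norm 6 \<phi>"
  have le: "cmod (fhat (foldr partial rs \<phi>) k) \<le> ?c" if "length rs \<le> 6" for rs
    by (rule order_trans[OF norm_fhat_le[OF test_foldr_partial[OF \<phi>]]]) (intro mult_left_mono sup_norm_le_C_norm \<phi> that, simp)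
  have 0: "cmod (fhat \<phi> k) \<le> ?c" using le[of "[]"] by simp
  have 6: "\<bar>real_of_int (k $ r)\<bar> ^ 6 * cmod (fhat \<phi> k) \<le> ?c" for r
  proof -
    have "cmod (fhat (foldr partial (replicate 6 r) \<phi>) k) = \<bar>real_of_int (k $ r)\<bar> ^ 6 * cmod (fhat \<phi> k)"
      unfolding fhat_foldr_partial[OF \<phi>] by (simp add: norm_mult norm_power power_mult_distrib)
    then show ?thesis using le[of "replicate 6 r"] by simp
  qed
  \<comment> \<open>The weight is dominated by terms that are coefficients of derivatives of order \<open>0\<close> and \<open>6\<close>.\<close>
  have "(\<Prod>r\<in>UNIV. 1 + (real_of_int (k $ r))\<^sup>2) * cmod (fhat \<phi> k) \<le> (12 + 4 * (\<Sum>r\<in>UNIV. \<bar>real_of_int (k $ r)\<bar> ^ 6)) * cmod (fhat \<phi> k)"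
    by (intro mult_right_mono prod_one_add_square_le) simp
  also have "\<dots> = 12 * cmod (fhat \<phi> k) + 4 * (\<Sum>r\<in>UNIV. \<bar>real_of_int (k $ r)\<bar> ^ 6 * cmod (fhat \<phi> k))"
    by (simp add: distrib_right sum_distrib_right)
  also have "\<dots> \<le> 12 * ?c + 4 * (\<Sum>r\<in>(UNIV::3 set). ?c)"
    by (intro add_mono mult_left_mono sum_mono 0 6) auto
  also have "\<dots> = 24 * (2 * pi) ^ 3 * C_norm 6 \<phi>" by simp
  finally show ?thesis .
qed

lemma sum_inverse_one_add_square_int: "\<exists>b. \<forall>G. finite G \<longrightarrow> (\<Sum>m\<in>G. 1 / (1 + (real_of_int m)\<^sup>2)) \<le> b"
proof -
  have s: "summable (\<lambda>n. 1 / (1 + (real n)\<^sup>2))"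
  proof (rule summable_comparison_test)
    show "summable (\<lambda>n. inverse (real n ^ 2))" by (rule inverse_power_summable) simp
    show "\<exists>N. \<forall>n\<ge>N. norm (1 / (1 + (real n)\<^sup>2)) \<le> inverse (real n ^ 2)"
      by (intro exI[of _ 1]) (auto simp: field_simps power2_eq_square add_pos_nonneg intro!: frac_le)
  qed
  let ?f = "\<lambda>m. 1 / (1 + (real_of_int m)\<^sup>2)" and ?b = "\<Sum>n. 1 / (1 + (real n)\<^sup>2)"
  have half: "(\<Sum>m\<in>G. ?f m) \<le> ?b" if G: "finite G" "inj_on (\<lambda>m. nat \<bar>m\<bar>) G" for G
  proof -
    have "(\<Sum>m\<in>G. ?f m) = (\<Sum>n\<in>(\<lambda>m. nat \<bar>m\<bar>) ` G. 1 / (1 + (real n)\<^sup>2))"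
      by (subst sum.reindex[OF G(2)]) simp
    also have "\<dots> \<le> ?b" using G by (intro sum_le_suminf s) auto
    finally show ?thesis .
  qed
  show ?thesis
  proof (intro exI[of _ "?b + ?b"] allI impI)
    fix G :: "int set" assume G: "finite G"
    have "(\<Sum>m\<in>G. ?f m) = (\<Sum>m\<in>{m\<in>G. m \<ge> 0}. ?f m) + (\<Sum>m\<in>{m\<in>G. m < 0}. ?f m)"
      using G by (subst sum.union_disjoint[symmetric]) (auto intro!: sum.cong)
    also have "\<dots> \<le> ?b + ?b" using G by (intro add_mono half) (auto simp: inj_on_def)
    finally show "(\<Sum>m\<in>G. ?f m) \<le> ?b + ?b" .
  qed
qed

lemma fhat_sum_le: "\<exists>K\<ge>0. \<forall>\<phi>\<in>test_functions. \<forall>F. finite F \<longrightarrow> (\<Sum>k\<in>F. cmod (fhat \<phi> k)) \<le> K * C_norm 6 \<phi>"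
proof -
  obtain b where b: "\<And>G. finite G \<Longrightarrow> (\<Sum>m\<in>G. 1 / (1 + (real_of_int m)\<^sup>2)) \<le> b"
    using sum_inverse_one_add_square_int by blast
  have b0: "b \<ge> 0" using b[of "{}"] by simp
  let ?W = "\<lambda>k :: int^3. \<Prod>r\<in>UNIV. 1 + (real_of_int (k $ r))\<^sup>2"
  show ?thesis
  proof (intro exI[of _ "24 * (2 * pi) ^ 3 * b ^ 3"] conjI ballI allI impI)
    fix \<phi> and F :: "(int^3) set" assume \<phi>: "\<phi> \<in> test_functions" and F: "finite F"
    let ?c = "24 * (2 * pi) ^ 3 * C_norm 6 \<phi>"
    have c: "?c \<ge> 0" using C_norm_nonneg[OF \<phi>] by simp
    have "(\<Sum>k\<in>F. cmod (fhat \<phi> k)) \<le> (\<Sum>k\<in>F. ?c * (\<Prod>r\<in>UNIV. 1 / (1 + (real_of_int (k $ r))\<^sup>2)))"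
    proof (rule sum_mono)
      fix k
      have W: "?W k > 0" by (intro prod_pos) (simp add: add_pos_nonneg)
      have "cmod (fhat \<phi> k) \<le> ?c / ?W k"
        using fhat_decay[OF \<phi>, of k] W by (simp add: pos_le_divide_eq mult.commute)
      also have "\<dots> = ?c * (\<Prod>r\<in>UNIV. 1 / (1 + (real_of_int (k $ r))\<^sup>2))" by (simp add: prod_dividef)
      finally show "cmod (fhat \<phi> k) \<le> ?c * (\<Prod>r\<in>UNIV. 1 / (1 + (real_of_int (k $ r))\<^sup>2))" .
    qed
    also have "\<dots> = ?c * (\<Sum>k\<in>F. \<Prod>r\<in>UNIV. 1 / (1 + (real_of_int (k $ r))\<^sup>2))" by (rule sum_distrib_left[symmetric])
    also have "\<dots> \<le> ?c * (\<Prod>r\<in>(UNIV::3 set). b)"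
      by (intro mult_left_mono c sum_prod_vec_le[OF F, where f = "\<lambda>r m. 1 / (1 + (real_of_int m)\<^sup>2)"] b) auto
    finally show "(\<Sum>k\<in>F. cmod (fhat \<phi> k)) \<le> 24 * (2 * pi) ^ 3 * b ^ 3 * C_norm 6 \<phi>" by (simp add: mult_ac)
  qed (use b0 in simp)
qed

lemma fhat_abs_summable: "\<phi> \<in> test_functions \<Longrightarrow> (\<lambda>k. cmod (fhat \<phi> k)) summable_on UNIV"
proof (rule nonneg_bdd_above_summable_on)
  assume \<phi>: "\<phi> \<in> test_functions"
  obtain K where K: "\<And>\<phi> F. \<phi> \<in> test_functions \<Longrightarrow> finite F \<Longrightarrow> (\<Sum>k\<in>F. cmod (fhat \<phi> k)) \<le> K * C_norm 6 \<phi>"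
    using fhat_sum_le by blast
  show "bdd_above (sum (\<lambda>k. cmod (fhat \<phi> k)) ` {F. F \<subseteq> UNIV \<and> finite F})"
    by (rule bdd_aboveI2[where M = "K * C_norm 6 \<phi>"]) (use K[OF \<phi>] in simp)
qed simp

lemma fhat_infsum_le: "\<exists>K\<ge>0. \<forall>\<phi>\<in>test_functions. (\<Sum>\<^sub>\<infinity>k. cmod (fhat \<phi> k)) \<le> K * C_norm 6 \<phi>"
proof -
  obtain K where K: "K \<ge> 0" "\<And>\<phi> F. \<phi> \<in> test_functions \<Longrightarrow> finite F \<Longrightarrow> (\<Sum>k\<in>F. cmod (fhat \<phi> k)) \<le> K * C_norm 6 \<phi>"
    using fhat_sum_le by blast
  show ?thesis using K by (intro exI[of _ K] conjI ballI infsum_le_finite_sums fhat_abs_summable) auto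
qed

section \<open>Fourier inversion\<close>

text \<open>The exceptional set inside the cell is open, and a nonempty open set is not negligible; the boundary
is reached by taking the closure.\<close>

lemma continuous_AE_eq_imp_eq_cell:
  fixes f g :: "real^3 \<Rightarrow> complex"
  assumes c: "continuous_on UNIV f" "continuous_on UNIV g" and ae: "AE x in torus_measure. f x = g x" and x: "x \<in> period_cell"
  shows "f x = g x"
proof -
  let ?b = "box 0 (\<chi> r. 2 * pi) :: (real^3) set"
  let ?U = "{x. f x \<noteq> g x} \<inter> ?b"
  have oU: "open ?U"
    by (intro open_Int open_box open_Collect_neq c)
  have "AE x in lborel. x \<in> period_cell \<longrightarrow> f x = g x"
    using ae by (subst (asm) AE_restrict_space_iff) auto
  then have "AE x in lborel. x \<notin> ?U"
    by eventually_elim (auto simp: period_cell_def box_subset_cbox[THEN subsetD])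
  then have "?U \<in> null_sets lborel"
    using oU by (subst (asm) AE_iff_null_sets[symmetric]) auto
  then have "negligible ?U" by (simp add: negligible_iff_null_sets null_sets_completionI)
  then have "?U = {}" using open_not_negligible[OF oU] by blast
  then have "?b \<subseteq> {x. f x = g x}" by blast
  then have "closure ?b \<subseteq> {x. f x = g x}"
    by (rule closure_minimal) (intro closed_Collect_eq c)
  moreover have "?b \<noteq> {}"
  proof -
    have "(\<chi> r. pi) \<in> ?b" by (simp add: mem_box_cart)
    then show ?thesis by blast
  qed
  ultimately show ?thesis using x by (auto simp: closure_box period_cell_def)
qed

lemma fourier_partial_sums_uniform:
  assumes \<phi>: "\<phi> \<in> test_functions"
  shows "uniform_limit UNIV (\<lambda>F x. \<Sum>k\<in>F. fhat \<phi> k * basis_fun k x) (\<lambda>x. \<Sum>\<^sub>\<infinity>k. fhat \<phi> k * basis_fun k x) (finite_subsets_at_top UNIV)"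
proof (rule Weierstrass_m_test_general[OF _ fhat_abs_summable[OF \<phi>]])
  show "norm (fhat \<phi> k * basis_fun k x) \<le> cmod (fhat \<phi> k)" for k x
    using mult_left_mono[OF two_pi_powr_le_1, of "cmod (fhat \<phi> k)"] by (simp add: norm_mult norm_basis_fun)
qed

lemma fourier_summable:
  assumes \<phi>: "\<phi> \<in> test_functions" shows "(\<lambda>k. norm (fhat \<phi> k * basis_fun k x)) summable_on UNIV"
proof (rule Infinite_Sum.abs_summable_on_comparison_test'[OF fhat_abs_summable[OF \<phi>]])
  show "norm (fhat \<phi> k * basis_fun k x) \<le> cmod (fhat \<phi> k)" for k
    using mult_left_mono[OF two_pi_powr_le_1, of "cmod (fhat \<phi> k)"] by (simp add: norm_mult norm_basis_fun)
qed

text \<open>The series converges uniformly, so its sum is continuous and has the same coefficients as \<open>\<phi>\<close>; hence both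
agree almost everywhere in the cell, and then everywhere by continuity and periodicity.\<close>

theorem fourier_inversion:
  assumes \<phi>: "\<phi> \<in> test_functions"
  shows "((\<lambda>k. fhat \<phi> k * basis_fun k x) has_sum \<phi> x) UNIV"
proof -
  let ?S = "\<lambda>F x. \<Sum>k\<in>F. fhat \<phi> k * basis_fun k x"
  define \<psi> where "\<psi> x = (\<Sum>\<^sub>\<infinity>k. fhat \<phi> k * basis_fun k x)" for x
  have ul: "uniform_limit UNIV ?S \<psi> (finite_subsets_at_top UNIV)"
    unfolding \<psi>_def by (rule fourier_partial_sums_uniform[OF \<phi>])
  have Sc: "continuous_on UNIV (?S F)" for F by (intro continuous_intros continuous_basis_fun)
  have \<psi>c: "continuous_on UNIV \<psi>"
    by (rule uniform_limit_theorem[OF _ ul]) (auto intro!: always_eventually Sc)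
  have coeff: "(LINT x|torus_measure. (\<phi> x - \<psi> x) * basis_fun j x) = 0" for j
  proof -
    have "uniform_limit period_cell (\<lambda>F x. ?S F x * basis_fun j x) (\<lambda>x. \<psi> x * basis_fun j x) (finite_subsets_at_top UNIV)"
    proof (rule uniform_lim_mult[OF uniform_limit_on_subset[OF ul subset_UNIV] uniform_limit_const])
      show "bounded (\<psi> ` period_cell)"
        by (intro compact_imp_bounded compact_continuous_image compact_period_cell continuous_on_subset[OF \<psi>c] subset_UNIV)
      show "bounded (basis_fun j ` period_cell)"
        by (intro compact_imp_bounded compact_continuous_image compact_period_cell continuous_basis_fun)
    qed
    then obtain I J where IJ: "\<And>F. ((\<lambda>x. ?S F x * basis_fun j x) has_integral I F) period_cell"
        "((\<lambda>x. \<psi> x * basis_fun j x) has_integral J) period_cell" "(I \<longlongrightarrow> J) (finite_subsets_at_top UNIV)"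
      unfolding period_cell_def
      by (rule uniform_limit_integral_cbox) (auto intro!: continuous_intros continuous_basis_fun)
    have I: "I F = fhat \<phi> (- j)" if F: "finite F" "- j \<in> F" for F
    proof -
      have "I F = integral period_cell (\<lambda>x. ?S F x * basis_fun j x)" by (rule integral_unique[OF IJ(1), symmetric])
      also have "\<dots> = (LINT x|torus_measure. ?S F x * basis_fun j x)"
        by (intro LINT_torus_measure_eq_integral[symmetric] continuous_on_mult Sc continuous_basis_fun)
      also have "\<dots> = (LINT x|torus_measure. (\<Sum>k\<in>F. fhat \<phi> k * (basis_fun k x * basis_fun j x)))"
        by (simp add: sum_distrib_right mult.assoc)
      also have "\<dots> = (\<Sum>k\<in>F. fhat \<phi> k * (LINT x|torus_measure. basis_fun k x * basis_fun j x))"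
        by (subst Bochner_Integration.integral_sum)
          (auto intro!: continuous_integrable_torus_measure continuous_on_mult continuous_basis_fun continuous_on_const)
      also have "\<dots> = (\<Sum>k\<in>F. if k = - j then fhat \<phi> (- j) else 0)"
        by (rule sum.cong) (auto simp: integral_basis_fun_mult add_eq_0_iff2)
      also have "\<dots> = fhat \<phi> (- j)" using F by simp
      finally show ?thesis .
    qed
    have "eventually (\<lambda>F. I F = fhat \<phi> (- j)) (finite_subsets_at_top UNIV)"
      unfolding eventually_finite_subsets_at_top by (intro exI[of _ "{- j}"]) (auto intro: I)
    then have "(I \<longlongrightarrow> fhat \<phi> (- j)) (finite_subsets_at_top UNIV)" by (rule tendsto_eventually)
    then have J: "J = fhat \<phi> (- j)" using IJ(3) by (intro tendsto_unique[of "finite_subsets_at_top UNIV"]) auto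
    have "(LINT x|torus_measure. \<psi> x * basis_fun j x) = J"
      using IJ(2) by (subst LINT_torus_measure_eq_integral) (auto intro!: continuous_on_mult \<psi>c continuous_basis_fun integral_unique)
    moreover have "(LINT x|torus_measure. \<phi> x * basis_fun j x) = fhat \<phi> (- j)" by (simp add: fhat_def)
    moreover have "(LINT x|torus_measure. (\<phi> x - \<psi> x) * basis_fun j x) = (LINT x|torus_measure. \<phi> x * basis_fun j x) - (LINT x|torus_measure. \<psi> x * basis_fun j x)"
      unfolding left_diff_distrib
      by (intro Bochner_Integration.integral_diff continuous_integrable_torus_measure continuous_on_mult \<psi>c continuous_basis_fun test_continuous \<phi>)
    ultimately show ?thesis by (simp add: J)
  qed
  have "integrable torus_measure (\<lambda>x. \<phi> x - \<psi> x)"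
    by (intro continuous_integrable_torus_measure continuous_on_diff \<psi>c test_continuous \<phi>)
  then have "AE x in torus_measure. \<phi> x - \<psi> x = 0" using coeff by (rule fourier_coefficients_zero_imp_AE_zero)
  then have ae: "AE x in torus_measure. \<phi> x = \<psi> x" by simp
  obtain y where y: "\<And>r. 0 \<le> y $ r \<and> y $ r < 2 * pi" "\<And>f. periodic f \<Longrightarrow> f x = f y" by (rule periodic_reduce[of x]) blast
  have "y \<in> period_cell" using y(1) by (simp add: period_cell_iff less_imp_le)
  then have "\<phi> y = \<psi> y" by (rule continuous_AE_eq_imp_eq_cell[OF test_continuous[OF \<phi>] \<psi>c ae])
  moreover have "\<phi> x = \<phi> y" by (intro y(2) test_functionsD \<phi>)
  moreover have "basis_fun k x = basis_fun k y" for k by (intro y(2) test_functionsD basis_fun_test)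
  ultimately have "\<phi> x = \<psi> x" by (simp add: \<psi>_def)
  then show ?thesis unfolding \<psi>_def
    using has_sum_infsum[OF abs_summable_summable[OF fourier_summable[OF \<phi>]]] by metis
qed

lemma fourier_remainder_le:
  assumes \<phi>: "\<phi> \<in> test_functions" and F: "finite F"
  shows "cmod (\<phi> x - (\<Sum>k\<in>F. fhat \<phi> k * basis_fun k x)) \<le> (\<Sum>\<^sub>\<infinity>k. cmod (fhat \<phi> k)) - (\<Sum>k\<in>F. cmod (fhat \<phi> k))"
proof -
  let ?f = "\<lambda>k. fhat \<phi> k * basis_fun k x"
  have "eventually (\<lambda>G. cmod (sum ?f G - sum ?f F) \<le> (\<Sum>\<^sub>\<infinity>k. cmod (fhat \<phi> k)) - (\<Sum>k\<in>F. cmod (fhat \<phi> k))) (finite_subsets_at_top UNIV)"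
    unfolding eventually_finite_subsets_at_top
  proof (intro exI[of _ F] conjI allI impI F subset_UNIV)
    fix G assume G: "finite G \<and> F \<subseteq> G \<and> G \<subseteq> UNIV"
    have "sum ?f G - sum ?f F = sum ?f (G - F)" using G by (simp add: sum_diff)
    also have "cmod \<dots> \<le> (\<Sum>k\<in>G - F. cmod (fhat \<phi> k))"
    proof (rule order_trans[OF norm_sum sum_mono])
      show "cmod (?f k) \<le> cmod (fhat \<phi> k)" for k
        using mult_left_mono[OF two_pi_powr_le_1, of "cmod (fhat \<phi> k)"] by (simp add: norm_mult norm_basis_fun)
    qed
    also have "\<dots> = (\<Sum>k\<in>G. cmod (fhat \<phi> k)) - (\<Sum>k\<in>F. cmod (fhat \<phi> k))" using G by (simp add: sum_diff)
    also have "(\<Sum>k\<in>G. cmod (fhat \<phi> k)) \<le> (\<Sum>\<^sub>\<infinity>k. cmod (fhat \<phi> k))"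
      using G by (intro finite_sum_le_infsum fhat_abs_summable \<phi>) auto
    finally show "cmod (sum ?f G - sum ?f F) \<le> (\<Sum>\<^sub>\<infinity>k. cmod (fhat \<phi> k)) - (\<Sum>k\<in>F. cmod (fhat \<phi> k))" by simp
  qed
  moreover have "((\<lambda>G. cmod (sum ?f G - sum ?f F)) \<longlongrightarrow> cmod (\<phi> x - sum ?f F)) (finite_subsets_at_top UNIV)"
    using fourier_inversion[OF \<phi>, of x] unfolding has_sum_def by (intro tendsto_intros)
  ultimately show ?thesis by (intro tendsto_upperbound[of _ _ "finite_subsets_at_top UNIV"]) auto
qed

section \<open>Fourier expansion of distributions\<close>

lemma distributionD:
  assumes "T \<in> distributions"
  shows "T \<in> extensional test_functions"
    "\<phi> \<in> test_functions \<Longrightarrow> \<psi> \<in> test_functions \<Longrightarrow> T (\<lambda>x. \<phi> x + \<psi> x) = T \<phi> + T \<psi>"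
    "\<phi> \<in> test_functions \<Longrightarrow> T (\<lambda>x. c * \<phi> x) = c * T \<phi>"
    "\<exists>C m. \<forall>\<phi>\<in>test_functions. cmod (T \<phi>) \<le> C * C_norm m \<phi>"
  using assms by (auto simp: distributions_def)

text \<open>A derivative of the remainder is the remainder of the derivative, so that \<open>fourier_remainder_le\<close>
controls all the terms of \<open>C_norm\<close>. The three facts share one induction on the set of modes.\<close>

lemma fourier_remainder_test:
  assumes \<phi>: "\<phi> \<in> test_functions" and F: "finite F"
  shows "(\<lambda>x. \<phi> x - (\<Sum>k\<in>F. fhat \<phi> k * basis_fun k x)) \<in> test_functions \<and>
    foldr partial rs (\<lambda>x. \<phi> x - (\<Sum>k\<in>F. fhat \<phi> k * basis_fun k x)) = (\<lambda>x. foldr partial rs \<phi> x - (\<Sum>k\<in>F. fhat (foldr partial rs \<phi>) k * basis_fun k x)) \<and>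
    (T \<in> distributions \<longrightarrow> T (\<lambda>x. \<phi> x - (\<Sum>k\<in>F. fhat \<phi> k * basis_fun k x)) = T \<phi> - (\<Sum>k\<in>F. fhat \<phi> k * T (basis_fun k)))"
  using F
proof (induction F)
  case (insert j F)
  let ?R = "\<lambda>x. \<phi> x - (\<Sum>k\<in>F. fhat \<phi> k * basis_fun k x)"
  have R: "?R \<in> test_functions" using insert.IH by blast
  have eq: "(\<lambda>x. \<phi> x - (\<Sum>k\<in>insert j F. fhat \<phi> k * basis_fun k x)) = (\<lambda>x. 1 * ?R x + (- fhat \<phi> j) * basis_fun j x)"
    using insert.hyps by (simp add: fun_eq_iff)
  have lin: "foldr partial rs (\<lambda>x. 1 * ?R x + (- fhat \<phi> j) * basis_fun j x)
      = (\<lambda>x. 1 * foldr partial rs ?R x + (- fhat \<phi> j) * foldr partial rs (basis_fun j) x)"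
    by (rule foldr_partial_lincomb) (intro test_functionsD R basis_fun_test)+
  have fd: "foldr partial rs (\<lambda>x. \<phi> x - (\<Sum>k\<in>insert j F. fhat \<phi> k * basis_fun k x))
     = (\<lambda>x. foldr partial rs \<phi> x - (\<Sum>k\<in>insert j F. fhat (foldr partial rs \<phi>) k * basis_fun k x))"
    unfolding eq lin using insert.IH insert.hyps by (simp add: fun_eq_iff foldr_partial_basis_fun fhat_foldr_partial[OF \<phi>] mult_ac)
  have tt: "(\<lambda>x. \<phi> x - (\<Sum>k\<in>insert j F. fhat \<phi> k * basis_fun k x)) \<in> test_functions"
    unfolding eq by (intro test_lincomb R basis_fun_test)
  have "T (\<lambda>x. \<phi> x - (\<Sum>k\<in>insert j F. fhat \<phi> k * basis_fun k x)) = T \<phi> - (\<Sum>k\<in>insert j F. fhat \<phi> k * T (basis_fun k))"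
    if T: "T \<in> distributions"
  proof -
    have "T (\<lambda>x. 1 * ?R x + (- fhat \<phi> j) * basis_fun j x) = T (\<lambda>x. 1 * ?R x) + T (\<lambda>x. (- fhat \<phi> j) * basis_fun j x)"
      by (intro distributionD(2)[OF T] test_cmult R basis_fun_test)
    also have "\<dots> = 1 * T ?R + (- fhat \<phi> j) * T (basis_fun j)"
      by (simp only: distributionD(3)[OF T R] distributionD(3)[OF T basis_fun_test])
    finally show ?thesis unfolding eq using insert T by simp
  qed
  then show ?case using fd tt by blast
qed (use \<phi> in simp)

text \<open>The remainders of the Fourier series of \<open>\<phi>\<close> tend to zero in every \<open>C_norm m\<close>, and \<open>T\<close> is continuous
for one of them.\<close>

theorem distribution_fourier_expansion:
  assumes T: "T \<in> distributions" and \<phi>: "\<phi> \<in> test_functions"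
  shows "((\<lambda>k. fhat \<phi> k * T (basis_fun k)) has_sum T \<phi>) UNIV"
proof -
  obtain C m where C: "\<And>\<phi>. \<phi> \<in> test_functions \<Longrightarrow> cmod (T \<phi>) \<le> C * C_norm m \<phi>" using distributionD(4)[OF T] by blast
  let ?A = "\<lambda>rs. \<Sum>\<^sub>\<infinity>k. cmod (fhat (foldr partial rs \<phi>) k)" and ?a = "\<lambda>rs F. \<Sum>k\<in>F. cmod (fhat (foldr partial rs \<phi>) k)"
  have le: "cmod (T \<phi> - (\<Sum>k\<in>F. fhat \<phi> k * T (basis_fun k))) \<le> \<bar>C\<bar> * (\<Sum>rs | length rs \<le> m. ?A rs - ?a rs F)" if F: "finite F" for F
  proof -
    let ?R = "\<lambda>x. \<phi> x - (\<Sum>k\<in>F. fhat \<phi> k * basis_fun k x)"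
    have R: "?R \<in> test_functions" "T ?R = T \<phi> - (\<Sum>k\<in>F. fhat \<phi> k * T (basis_fun k))"
      using fourier_remainder_test[OF \<phi> F] T by blast+
    have Rd: "foldr partial rs ?R = (\<lambda>x. foldr partial rs \<phi> x - (\<Sum>k\<in>F. fhat (foldr partial rs \<phi>) k * basis_fun k x))" for rs
      using fourier_remainder_test[OF \<phi> F] by blast
    have "cmod (T ?R) \<le> C * C_norm m ?R" by (rule C[OF R(1)])
    also have "\<dots> \<le> \<bar>C\<bar> * C_norm m ?R" by (intro mult_right_mono C_norm_nonneg R) simp
    also have "\<dots> \<le> \<bar>C\<bar> * (\<Sum>rs | length rs \<le> m. ?A rs - ?a rs F)"
      unfolding C_norm_def Rd
      by (intro mult_left_mono sum_mono cSUP_least fourier_remainder_le test_foldr_partial \<phi> F) auto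
    finally show ?thesis unfolding R(2) .
  qed
  have "((\<lambda>F. \<bar>C\<bar> * (\<Sum>rs | length rs \<le> m. ?A rs - ?a rs F)) \<longlongrightarrow> \<bar>C\<bar> * (\<Sum>rs | length rs \<le> m. ?A rs - ?A rs)) (finite_subsets_at_top UNIV)"
    by (intro tendsto_intros infsum_tendsto fhat_abs_summable test_foldr_partial \<phi>)
  then have g: "((\<lambda>F. \<bar>C\<bar> * (\<Sum>rs | length rs \<le> m. ?A rs - ?a rs F)) \<longlongrightarrow> 0) (finite_subsets_at_top UNIV)" by simp
  have "((\<lambda>F. T \<phi> - (\<Sum>k\<in>F. fhat \<phi> k * T (basis_fun k))) \<longlongrightarrow> 0) (finite_subsets_at_top UNIV)"
    by (rule Lim_null_comparison[OF _ g]) (auto simp: eventually_finite_subsets_at_top intro!: le exI[of _ "{}"])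
  then have "((\<lambda>F. T \<phi> - (T \<phi> - (\<Sum>k\<in>F. fhat \<phi> k * T (basis_fun k)))) \<longlongrightarrow> T \<phi> - 0) (finite_subsets_at_top UNIV)"
    by (rule tendsto_diff[OF tendsto_const])
  then show ?thesis by (simp add: has_sum_def)
qed

text \<open>In particular, two vector fields with the same Fourier coefficients are equal as functionals.\<close>

lemma distribution_eqI:
  assumes "S \<in> distributions" "T \<in> distributions" "\<And>k. S (basis_fun k) = T (basis_fun k)"
  shows "S = T"
proof (rule extensionalityI[OF distributionD(1)[OF assms(1)] distributionD(1)[OF assms(2)]])
  fix \<phi> assume \<phi>: "\<phi> \<in> test_functions"
  show "S \<phi> = T \<phi>"
    using distribution_fourier_expansion[OF assms(1) \<phi>] distribution_fourier_expansion[OF assms(2) \<phi>]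
    unfolding assms(3) by (rule has_sum_unique)
qed

section \<open>Square integrable functions\<close>

lemma square_integrable_torus_measure:
  "square_integrable f \<Longrightarrow> f \<in> borel_measurable torus_measure" "square_integrable f \<Longrightarrow> integrable torus_measure (\<lambda>x. (cmod (f x))\<^sup>2)"
  unfolding square_integrable_def integrable_torus_measure_iff by (auto intro: measurable_torus_measure)

lemma square_integrableI:
  "f \<in> borel_measurable borel \<Longrightarrow> integrable torus_measure (\<lambda>x. (cmod (f x))\<^sup>2) \<Longrightarrow> square_integrable f"
  unfolding square_integrable_def integrable_torus_measure_iff by simp

lemma integrable_mult_L2:
  fixes f g :: "real^3 \<Rightarrow> complex"
  assumes "f \<in> borel_measurable torus_measure" "integrable torus_measure (\<lambda>x. (cmod (f x))\<^sup>2)"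
    "g \<in> borel_measurable torus_measure" "integrable torus_measure (\<lambda>x. (cmod (g x))\<^sup>2)"
  shows "integrable torus_measure (\<lambda>x. f x * g x)"
proof (rule Bochner_Integration.integrable_bound[where f = "\<lambda>x. (cmod (f x))\<^sup>2 + (cmod (g x))\<^sup>2"])
  show "AE x in torus_measure. norm (f x * g x) \<le> norm ((cmod (f x))\<^sup>2 + (cmod (g x))\<^sup>2)"
  proof (rule AE_I2)
    fix x
    have "2 * (cmod (f x) * cmod (g x)) \<le> (cmod (f x))\<^sup>2 + (cmod (g x))\<^sup>2" using sum_squares_bound[of "cmod (f x)" "cmod (g x)"] by (simp add: mult_ac)
    moreover have "0 \<le> cmod (f x) * cmod (g x)" by simp
    ultimately have "cmod (f x) * cmod (g x) \<le> (cmod (f x))\<^sup>2 + (cmod (g x))\<^sup>2" by linarith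
    then show "norm (f x * g x) \<le> norm ((cmod (f x))\<^sup>2 + (cmod (g x))\<^sup>2)" by (simp add: norm_mult)
  qed
qed (use assms in simp_all)

lemma norm_integral_mult_le_L2:
  fixes f g :: "real^3 \<Rightarrow> complex"
  assumes f: "f \<in> borel_measurable torus_measure" "integrable torus_measure (\<lambda>x. (cmod (f x))\<^sup>2)"
    and g: "g \<in> borel_measurable torus_measure" "integrable torus_measure (\<lambda>x. (cmod (g x))\<^sup>2)"
  shows "(LINT x|torus_measure. cmod (f x) * cmod (g x)) \<le> sqrt (LINT x|torus_measure. (cmod (f x))\<^sup>2) * sqrt (LINT x|torus_measure. (cmod (g x))\<^sup>2)"
proof -
  let ?A = "LINT x|torus_measure. (cmod (f x))\<^sup>2" and ?B = "LINT x|torus_measure. (cmod (g x))\<^sup>2" and ?C = "LINT x|torus_measure. cmod (f x) * cmod (g x)"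
  have A: "?A \<ge> 0" and B: "?B \<ge> 0" by simp_all
  have int: "integrable torus_measure (\<lambda>x. cmod (f x) * cmod (g x))"
    using integrable_norm[OF integrable_mult_L2[OF f g]] by (simp add: norm_mult)
  have young: "2 * l * ?C \<le> l\<^sup>2 * ?A + ?B" for l
  proof -
    have "2 * l * ?C = (LINT x|torus_measure. 2 * l * (cmod (f x) * cmod (g x)))" by simp
    also have "\<dots> \<le> (LINT x|torus_measure. l\<^sup>2 * (cmod (f x))\<^sup>2 + (cmod (g x))\<^sup>2)"
    proof (rule integral_mono)
      show "2 * l * (cmod (f x) * cmod (g x)) \<le> l\<^sup>2 * (cmod (f x))\<^sup>2 + (cmod (g x))\<^sup>2" for x
        using sum_squares_bound[of "l * cmod (f x)" "cmod (g x)"] by (simp add: power_mult_distrib mult_ac)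
    qed (use f g int in auto)
    also have "\<dots> = l\<^sup>2 * ?A + ?B" using f g by simp
    finally show ?thesis .
  qed
  \<comment> \<open>A quadratic polynomial in \<open>l\<close> without negative values has no positive discriminant.\<close>
  have "?C\<^sup>2 \<le> ?A * ?B"
  proof (cases "?A = 0")
    case True
    have "?C \<le> 0"
    proof (rule ccontr)
      assume "\<not> ?C \<le> 0"
      then have C: "?C > 0" by simp
      have "2 * (?B / ?C) * ?C \<le> ?B" using young[of "?B / ?C"] True by simp
      then have "?B = 0" using C B by simp
      then show False using young[of 1] True C by simp
    qed
    moreover have "?C \<ge> 0" by simp
    ultimately show ?thesis using True by simp
  next
    case False
    then have A': "?A > 0" using A by linarith
    have "2 * (?C / ?A) * ?C \<le> (?C / ?A)\<^sup>2 * ?A + ?B" by (rule young)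
    also have "(?C / ?A)\<^sup>2 * ?A = (?C / ?A) * ?C" using A' by (simp add: power2_eq_square)
    finally have "(?C / ?A) * ?C \<le> ?B" by simp
    then show ?thesis using A' by (simp add: power2_eq_square field_simps)
  qed
  then have "?C \<le> sqrt (?A * ?B)" by (rule real_le_rsqrt)
  then show ?thesis by (simp add: real_sqrt_mult)
qed

lemma square_integrable_bounded:
  fixes f :: "real^3 \<Rightarrow> complex"
  assumes "continuous_on UNIV f" shows "f \<in> borel_measurable borel" "integrable torus_measure (\<lambda>x. (cmod (f x))\<^sup>2)"
  using assms by (auto intro!: borel_measurable_continuous_onI continuous_integrable_torus_measure continuous_intros)

lemma integrable_L2_L1:
  fixes f :: "real^3 \<Rightarrow> complex"
  assumes f: "f \<in> borel_measurable torus_measure" "integrable torus_measure (\<lambda>x. (cmod (f x))\<^sup>2)"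
  shows "integrable torus_measure f"
proof -
  note c = square_integrable_bounded[OF continuous_on_const[of UNIV 1]]
  show ?thesis using integrable_mult_L2[OF f measurable_torus_measure[OF c(1)] c(2)] by simp
qed

lemma L1_le_L2:
  fixes f :: "real^3 \<Rightarrow> complex"
  assumes f: "f \<in> borel_measurable torus_measure" "integrable torus_measure (\<lambda>x. (cmod (f x))\<^sup>2)"
  shows "(LINT x|torus_measure. cmod (f x)) \<le> sqrt ((2 * pi) ^ 3) * sqrt (LINT x|torus_measure. (cmod (f x))\<^sup>2)"
proof -
  note c = square_integrable_bounded[OF continuous_on_const[of UNIV 1]]
  have "(LINT x|torus_measure. (cmod (1 :: complex))\<^sup>2) = (2 * pi) ^ 3" using measure_torus_measure by simp
  then show ?thesis using norm_integral_mult_le_L2[OF f measurable_torus_measure[OF c(1)] c(2)] by (simp add: mult.commute)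
qed

section \<open>The theorem of Riesz and Fischer\<close>

text \<open>An exhausting sequence of finite sets of frequencies, since almost everywhere convergence needs
sequences rather than nets.\<close>

definition freq_ball :: "nat \<Rightarrow> (int^3) set" where
  "freq_ball n = {k. (norm (real_vec k))\<^sup>2 < real n}"

definition fourier_psum :: "(int^3 \<Rightarrow> complex) \<Rightarrow> nat \<Rightarrow> real^3 \<Rightarrow> complex" where
  "fourier_psum a n x = (\<Sum>k\<in>freq_ball n. a k * basis_fun k x)"

definition l2tail :: "(int^3 \<Rightarrow> complex) \<Rightarrow> nat \<Rightarrow> real" where
  "l2tail a n = (\<Sum>\<^sub>\<infinity>k. (cmod (a k))\<^sup>2) - (\<Sum>k\<in>freq_ball n. (cmod (a k))\<^sup>2)"

lemma finite_freq_ball: "finite (freq_ball n)"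
  unfolding freq_ball_def by (rule finite_int_vec_ball)

lemma freq_ball_mono: "n \<le> m \<Longrightarrow> freq_ball n \<subseteq> freq_ball m"
  by (auto simp: freq_ball_def)

lemma eventually_mem_freq_ball: "eventually (\<lambda>n. k \<in> freq_ball n) sequentially"
proof -
  obtain N where "(norm (real_vec k))\<^sup>2 < real N" using reals_Archimedean2 by blast
  then show ?thesis unfolding eventually_sequentially freq_ball_def by (intro exI[of _ N]) auto
qed

lemma filterlim_freq_ball: "filterlim freq_ball (finite_subsets_at_top UNIV) sequentially"
  unfolding filterlim_finite_subsets_at_top
proof (intro allI impI)
  fix X :: "(int^3) set" assume X: "finite X \<and> X \<subseteq> UNIV"
  then have "eventually (\<lambda>n. \<forall>k\<in>X. k \<in> freq_ball n) sequentially"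
    by (intro eventually_ball_finite) (auto intro: eventually_mem_freq_ball)
  then show "eventually (\<lambda>n. finite (freq_ball n) \<and> X \<subseteq> freq_ball n \<and> freq_ball n \<subseteq> UNIV) sequentially"
    by eventually_elim (auto simp: finite_freq_ball)
qed

lemma has_sum_freq_ball: "(f has_sum S) UNIV \<Longrightarrow> (\<lambda>n. \<Sum>k\<in>freq_ball n. f k) \<longlonglongrightarrow> S"
  unfolding has_sum_def by (rule filterlim_compose[OF _ filterlim_freq_ball])

lemma continuous_fourier_psum: "continuous_on S (fourier_psum a n)"
  unfolding fourier_psum_def by (intro continuous_intros continuous_basis_fun)

lemma fourier_psum_L2: "fourier_psum a n \<in> borel_measurable borel" "integrable torus_measure (\<lambda>x. (cmod (fourier_psum a n x))\<^sup>2)"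
  by (rule square_integrable_bounded[OF continuous_fourier_psum])+

lemma integral_trig_poly_norm_square:
  assumes F: "finite F"
  shows "(LINT x|torus_measure. (cmod (\<Sum>k\<in>F. a k * basis_fun k x))\<^sup>2) = (\<Sum>k\<in>F. (cmod (a k))\<^sup>2)"
proof -
  let ?s = "\<lambda>x. \<Sum>k\<in>F. a k * basis_fun k x"
  have c: "continuous_on UNIV ?s" by (intro continuous_intros continuous_basis_fun)
  have "complex_of_real (LINT x|torus_measure. (cmod (?s x))\<^sup>2) = (LINT x|torus_measure. complex_of_real ((cmod (?s x))\<^sup>2))"
    by (rule integral_complex_of_real[symmetric])
  also have "\<dots> = (LINT x|torus_measure. (\<Sum>k\<in>F. \<Sum>j\<in>F. a k * cnj (a j) * (basis_fun k x * basis_fun (- j) x)))"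
    unfolding complex_norm_square cnj_sum sum_product by (simp add: cnj_basis_fun mult_ac)
  also have "\<dots> = (\<Sum>k\<in>F. \<Sum>j\<in>F. a k * cnj (a j) * (LINT x|torus_measure. basis_fun k x * basis_fun (- j) x))"
    by (simp add: Bochner_Integration.integral_sum Bochner_Integration.integrable_sum continuous_integrable_torus_measure continuous_on_mult continuous_basis_fun)
  also have "\<dots> = (\<Sum>k\<in>F. \<Sum>j\<in>F. if j = k then a k * cnj (a k) else 0)"
    by (intro sum.cong refl) (auto simp: integral_basis_fun_mult)
  also have "\<dots> = (\<Sum>k\<in>F. complex_of_real ((cmod (a k))\<^sup>2))"
    using F by (intro sum.cong refl) (simp add: complex_norm_square del: of_real_power)
  finally show ?thesis by (simp only: of_real_sum[symmetric] of_real_eq_iff)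
qed

context
  fixes a :: "int^3 \<Rightarrow> complex"
  assumes a: "(\<lambda>k. (cmod (a k))\<^sup>2) summable_on UNIV"
begin

lemma l2tail_tendsto: "l2tail a \<longlonglongrightarrow> 0"
  using tendsto_diff[OF tendsto_const has_sum_freq_ball[OF has_sum_infsum[OF a]], of "\<Sum>\<^sub>\<infinity>k. (cmod (a k))\<^sup>2"]
  by (simp add: l2tail_def[abs_def])

lemma l2tail_nonneg: "l2tail a n \<ge> 0"
  unfolding l2tail_def using finite_sum_le_infsum[OF a finite_freq_ball] by simp

lemma fourier_psum_diff_L2:
  assumes "n \<le> m" shows "(LINT x|torus_measure. (cmod (fourier_psum a m x - fourier_psum a n x))\<^sup>2) \<le> l2tail a n"
proof -
  have "fourier_psum a m x - fourier_psum a n x = (\<Sum>k\<in>freq_ball m - freq_ball n. a k * basis_fun k x)" for x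
    unfolding fourier_psum_def using freq_ball_mono[OF assms] finite_freq_ball by (simp add: sum_diff)
  then have "(LINT x|torus_measure. (cmod (fourier_psum a m x - fourier_psum a n x))\<^sup>2) = (\<Sum>k\<in>freq_ball m - freq_ball n. (cmod (a k))\<^sup>2)"
    by (simp add: integral_trig_poly_norm_square finite_freq_ball)
  also have "\<dots> = (\<Sum>k\<in>freq_ball m. (cmod (a k))\<^sup>2) - (\<Sum>k\<in>freq_ball n. (cmod (a k))\<^sup>2)"
    using freq_ball_mono[OF assms] finite_freq_ball by (simp add: sum_diff)
  also have "\<dots> \<le> l2tail a n"
    unfolding l2tail_def using finite_sum_le_infsum[OF a finite_freq_ball, of m] by simp
  finally show ?thesis .
qed

lemma fourier_psum_diff_L1:
  assumes "n \<le> m" shows "(LINT x|torus_measure. cmod (fourier_psum a m x - fourier_psum a n x)) \<le> sqrt ((2 * pi) ^ 3) * sqrt (l2tail a n)"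
proof -
  have c: "continuous_on UNIV (\<lambda>x. fourier_psum a m x - fourier_psum a n x)" by (intro continuous_intros continuous_fourier_psum)
  note s = square_integrable_bounded[OF c]
  show ?thesis
    by (rule order_trans[OF L1_le_L2[OF measurable_torus_measure[OF s(1)] s(2)]])
       (intro mult_left_mono real_sqrt_le_mono fourier_psum_diff_L2 assms, simp)
qed

text \<open>The partial sums form a Cauchy sequence in \<open>L\<^sup>2\<close> and hence in \<open>L\<^sup>1\<close>, so a subsequence converges
almost everywhere. Fatou's lemma applied along the subsequence bounds the distance of the
limit from each partial sum.\<close>

theorem riesz_fischer:
  obtains f where "square_integrable f" "\<And>n. integrable torus_measure (\<lambda>x. (cmod (f x - fourier_psum a n x))\<^sup>2)"
    "\<And>n. (LINT x|torus_measure. (cmod (f x - fourier_psum a n x))\<^sup>2) \<le> l2tail a n"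
proof -
  have int: "integrable torus_measure (fourier_psum a n)" for n by (intro continuous_integrable_torus_measure continuous_fourier_psum)
  have lim: "(\<lambda>n. sqrt ((2 * pi) ^ 3) * sqrt (l2tail a n)) \<longlonglongrightarrow> sqrt ((2 * pi) ^ 3) * sqrt 0"
    by (intro tendsto_intros l2tail_tendsto)
  obtain r where r: "strict_mono r" "AE x in torus_measure. Cauchy (\<lambda>i. fourier_psum a (r i) x)"
  proof (rule cauchy_L1_AE_cauchy_subseq[of torus_measure "fourier_psum a", OF int])
    fix e :: real assume "e > 0"
    then have "eventually (\<lambda>n. sqrt ((2 * pi) ^ 3) * sqrt (l2tail a n) < e) sequentially"
      using order_tendstoD(2)[OF lim, of e] by simp
    then obtain N where N: "\<And>n. n \<ge> N \<Longrightarrow> sqrt ((2 * pi) ^ 3) * sqrt (l2tail a n) < e"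
      unfolding eventually_sequentially by blast
    have "(LINT x|torus_measure. cmod (fourier_psum a i x - fourier_psum a j x)) < e" if "i \<ge> N" "j \<ge> N" for i j
    proof (cases "i \<le> j")
      case True
      then show ?thesis using fourier_psum_diff_L1[OF True] N[OF that(1)] by (simp add: norm_minus_commute)
    next
      case False
      then show ?thesis using fourier_psum_diff_L1[of j i] N[OF that(2)] by simp
    qed
    then show "\<exists>N. \<forall>i\<ge>N. \<forall>j\<ge>N. (LINT x|torus_measure. cmod (fourier_psum a i x - fourier_psum a j x)) < e" by blast
  qed blast
  \<comment> \<open>The subsequence diverges only on a null set, where the value of the limit is irrelevant.\<close>
  define f where "f x = lim (\<lambda>i. fourier_psum a (r i) x)" for x
  have fm: "f \<in> borel_measurable borel"
    unfolding f_def by (rule borel_measurable_lim_metric) (rule fourier_psum_L2)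
  have conv: "AE x in torus_measure. (\<lambda>i. fourier_psum a (r i) x) \<longlonglongrightarrow> f x"
    using r(2) by eventually_elim (simp add: f_def Cauchy_convergent_iff convergent_LIMSEQ_iff)
  have fatou: "(\<integral>\<^sup>+x. ennreal ((cmod (f x - fourier_psum a n x))\<^sup>2) \<partial>torus_measure) \<le> ennreal (l2tail a n)" for n
  proof -
    let ?g = "\<lambda>i x. ennreal ((cmod (fourier_psum a (r i) x - fourier_psum a n x))\<^sup>2)"
    have gm: "?g i \<in> borel_measurable torus_measure" for i
      using fourier_psum_L2(1)[of a "r i"] fourier_psum_L2(1)[of a n] by (intro measurable_torus_measure) measurable
    have "(\<integral>\<^sup>+x. ennreal ((cmod (f x - fourier_psum a n x))\<^sup>2) \<partial>torus_measure) = (\<integral>\<^sup>+x. liminf (\<lambda>i. ?g i x) \<partial>torus_measure)"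
    proof (rule nn_integral_cong_AE)
      show "AE x in torus_measure. ennreal ((cmod (f x - fourier_psum a n x))\<^sup>2) = liminf (\<lambda>i. ?g i x)"
        using conv
      proof eventually_elim
        case (elim x)
        then have "(\<lambda>i. ?g i x) \<longlonglongrightarrow> ennreal ((cmod (f x - fourier_psum a n x))\<^sup>2)" by (intro tendsto_intros)
        then show ?case by (rule lim_imp_Liminf[OF sequentially_bot, symmetric])
      qed
    qed
    also have "\<dots> \<le> liminf (\<lambda>i. \<integral>\<^sup>+x. ?g i x \<partial>torus_measure)" by (rule nn_integral_liminf[OF gm])
    also have "\<dots> \<le> ennreal (l2tail a n)"
    proof (rule Liminf_le)
      show "eventually (\<lambda>i. (\<integral>\<^sup>+x. ?g i x \<partial>torus_measure) \<le> ennreal (l2tail a n)) sequentially"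
        unfolding eventually_sequentially
      proof (intro exI[of _ n] allI impI)
        fix i assume "n \<le> i"
        then have ni: "n \<le> r i" using seq_suble[OF r(1), of i] by simp
        have c: "continuous_on UNIV (\<lambda>x. fourier_psum a (r i) x - fourier_psum a n x)" by (intro continuous_intros continuous_fourier_psum)
        have "(\<integral>\<^sup>+x. ?g i x \<partial>torus_measure) = ennreal (LINT x|torus_measure. (cmod (fourier_psum a (r i) x - fourier_psum a n x))\<^sup>2)"
          by (rule nn_integral_eq_integral[OF square_integrable_bounded(2)[OF c]]) simp
        then show "(\<integral>\<^sup>+x. ?g i x \<partial>torus_measure) \<le> ennreal (l2tail a n)"
          using fourier_psum_diff_L2[OF ni] by (simp add: ennreal_leI)
      qed
    qed simp
    finally show ?thesis .
  qed
  have m: "(\<lambda>x. (cmod (f x - fourier_psum a n x))\<^sup>2) \<in> borel_measurable torus_measure" for n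
    using fourier_psum_L2(1)[of a n] fm by (intro measurable_torus_measure) measurable
  have i: "integrable torus_measure (\<lambda>x. (cmod (f x - fourier_psum a n x))\<^sup>2)" for n
    using m[of n] fatou[of n] by (intro integrableI_nonneg) (auto intro: le_less_trans)
  have b: "(LINT x|torus_measure. (cmod (f x - fourier_psum a n x))\<^sup>2) \<le> l2tail a n" for n
    using fatou[of n] nn_integral_eq_integral[OF i[of n]] l2tail_nonneg[of n] by simp
  \<comment> \<open>The ball with index \<open>0\<close> is empty, so the bound for \<open>n = 0\<close> concerns \<open>f\<close> itself.\<close>
  have "fourier_psum a 0 x = 0" for x by (simp add: fourier_psum_def freq_ball_def)
  then have "square_integrable f" using i[of 0] by (intro square_integrableI fm) simp
  then show ?thesis using i b by (rule that)
qed

lemma L2_limit_integral: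
  assumes f: "f \<in> borel_measurable torus_measure" "\<And>n. integrable torus_measure (\<lambda>x. (cmod (f x - fourier_psum a n x))\<^sup>2)"
    "\<And>n. (LINT x|torus_measure. (cmod (f x - fourier_psum a n x))\<^sup>2) \<le> l2tail a n" "integrable torus_measure (\<lambda>x. (cmod (f x))\<^sup>2)"
    and g: "g \<in> borel_measurable torus_measure" "integrable torus_measure (\<lambda>x. (cmod (g x))\<^sup>2)"
  shows "(\<lambda>n. \<Sum>k\<in>freq_ball n. a k * (LINT x|torus_measure. basis_fun k x * g x)) \<longlonglongrightarrow> (LINT x|torus_measure. f x * g x)"
proof -
  have pm: "fourier_psum a n \<in> borel_measurable torus_measure" for n by (intro measurable_torus_measure fourier_psum_L2)
  have dm: "(\<lambda>x. f x - fourier_psum a n x) \<in> borel_measurable torus_measure" for n by (intro borel_measurable_diff f pm)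
  let ?B = "LINT x|torus_measure. (cmod (g x))\<^sup>2"
  have bm: "basis_fun k \<in> borel_measurable torus_measure" "integrable torus_measure (\<lambda>x. (cmod (basis_fun k x))\<^sup>2)" for k
    by (intro measurable_torus_measure square_integrable_bounded continuous_basis_fun)+
  have p: "(LINT x|torus_measure. fourier_psum a n x * g x) = (\<Sum>k\<in>freq_ball n. a k * (LINT x|torus_measure. basis_fun k x * g x))" for n
  proof -
    have "(LINT x|torus_measure. fourier_psum a n x * g x) = (LINT x|torus_measure. (\<Sum>k\<in>freq_ball n. a k * (basis_fun k x * g x)))"
      by (simp add: fourier_psum_def sum_distrib_right mult.assoc)
    also have "\<dots> = (\<Sum>k\<in>freq_ball n. a k * (LINT x|torus_measure. basis_fun k x * g x))"
      by (subst Bochner_Integration.integral_sum) (rule integrable_mult_right[OF integrable_mult_L2[OF bm g]], simp)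
    finally show ?thesis .
  qed
  have "norm ((LINT x|torus_measure. f x * g x) - (LINT x|torus_measure. fourier_psum a n x * g x)) \<le> sqrt (l2tail a n) * sqrt ?B" for n
  proof -
    have "(LINT x|torus_measure. f x * g x) - (LINT x|torus_measure. fourier_psum a n x * g x) = (LINT x|torus_measure. (f x - fourier_psum a n x) * g x)"
      unfolding left_diff_distrib
      by (intro Bochner_Integration.integral_diff[symmetric] integrable_mult_L2 f g pm fourier_psum_L2)
    also have "norm \<dots> \<le> (LINT x|torus_measure. norm ((f x - fourier_psum a n x) * g x))" by (rule integral_norm_bound)
    also have "\<dots> = (LINT x|torus_measure. cmod (f x - fourier_psum a n x) * cmod (g x))" by (simp add: norm_mult)
    also have "\<dots> \<le> sqrt (LINT x|torus_measure. (cmod (f x - fourier_psum a n x))\<^sup>2) * sqrt ?B"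
      by (rule norm_integral_mult_le_L2[OF dm f(2) g])
    also have "\<dots> \<le> sqrt (l2tail a n) * sqrt ?B"
      by (intro mult_right_mono real_sqrt_le_mono f) simp
    finally show ?thesis .
  qed
  note bound = this
  have z: "(\<lambda>n. sqrt (l2tail a n) * sqrt ?B) \<longlonglongrightarrow> 0"
  proof -
    have "(\<lambda>n. sqrt (l2tail a n) * sqrt ?B) \<longlonglongrightarrow> sqrt 0 * sqrt ?B"
      by (intro tendsto_intros l2tail_tendsto)
    then show ?thesis by simp
  qed
  have "(\<lambda>n. (LINT x|torus_measure. f x * g x) - (LINT x|torus_measure. fourier_psum a n x * g x)) \<longlonglongrightarrow> 0"
    by (rule Lim_null_comparison[OF always_eventually z]) (rule allI, rule bound)
  from tendsto_diff[OF tendsto_const[of "LINT x|torus_measure. f x * g x"] this]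
  show ?thesis by (simp add: p)
qed

lemma L2_limit_coeff:
  assumes f: "f \<in> borel_measurable torus_measure" "\<And>n. integrable torus_measure (\<lambda>x. (cmod (f x - fourier_psum a n x))\<^sup>2)"
    "\<And>n. (LINT x|torus_measure. (cmod (f x - fourier_psum a n x))\<^sup>2) \<le> l2tail a n" "integrable torus_measure (\<lambda>x. (cmod (f x))\<^sup>2)"
  shows "(LINT x|torus_measure. f x * basis_fun (- j) x) = a j"
proof -
  have bm: "basis_fun k \<in> borel_measurable torus_measure" "integrable torus_measure (\<lambda>x. (cmod (basis_fun k x))\<^sup>2)" for k
    by (intro measurable_torus_measure square_integrable_bounded continuous_basis_fun)+
  have "(\<lambda>n. \<Sum>k\<in>freq_ball n. a k * (LINT x|torus_measure. basis_fun k x * basis_fun (- j) x)) \<longlonglongrightarrow> (LINT x|torus_measure. f x * basis_fun (- j) x)"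
    by (rule L2_limit_integral[OF f bm])
  moreover have "eventually (\<lambda>n. (\<Sum>k\<in>freq_ball n. a k * (LINT x|torus_measure. basis_fun k x * basis_fun (- j) x)) = a j) sequentially"
    using eventually_mem_freq_ball[of j]
  proof eventually_elim
    case (elim n)
    have "(\<Sum>k\<in>freq_ball n. a k * (LINT x|torus_measure. basis_fun k x * basis_fun (- j) x)) = (\<Sum>k\<in>freq_ball n. if k = j then a j else 0)"
      by (intro sum.cong refl) (auto simp: integral_basis_fun_mult)
    then show ?case using elim by (simp add: finite_freq_ball)
  qed
  then have "(\<lambda>n. \<Sum>k\<in>freq_ball n. a k * (LINT x|torus_measure. basis_fun k x * basis_fun (- j) x)) \<longlonglongrightarrow> a j"
    by (rule tendsto_eventually)
  ultimately show ?thesis by (rule LIMSEQ_unique)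
qed

text \<open>A square integrable function with these coefficients coincides almost everywhere with the one
constructed before. This makes the choice in \<open>L2_representative\<close> immaterial.\<close>

lemma square_integrable_L2_limit:
  assumes f: "square_integrable f" and c: "\<And>k. (LINT x|torus_measure. f x * basis_fun (- k) x) = a k"
  shows "integrable torus_measure (\<lambda>x. (cmod (f x - fourier_psum a n x))\<^sup>2) \<and> (LINT x|torus_measure. (cmod (f x - fourier_psum a n x))\<^sup>2) \<le> l2tail a n"
proof -
  obtain g where g: "square_integrable g" "\<And>n. integrable torus_measure (\<lambda>x. (cmod (g x - fourier_psum a n x))\<^sup>2)"
    "\<And>n. (LINT x|torus_measure. (cmod (g x - fourier_psum a n x))\<^sup>2) \<le> l2tail a n" using riesz_fischer by blast
  note fm = square_integrable_torus_measure[OF f] and gm = square_integrable_torus_measure[OF g(1)]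
  have bm: "basis_fun k \<in> borel_measurable torus_measure" "integrable torus_measure (\<lambda>x. (cmod (basis_fun k x))\<^sup>2)" for k
    by (intro measurable_torus_measure square_integrable_bounded continuous_basis_fun)+
  have "AE x in torus_measure. f x - g x = 0"
  proof (rule fourier_coefficients_zero_imp_AE_zero)
    show "integrable torus_measure (\<lambda>x. f x - g x)"
      by (intro Bochner_Integration.integrable_diff integrable_L2_L1 fm gm)
    fix k
    have "(LINT x|torus_measure. (f x - g x) * basis_fun k x) = (LINT x|torus_measure. f x * basis_fun k x) - (LINT x|torus_measure. g x * basis_fun k x)"
      unfolding left_diff_distrib
      by (intro Bochner_Integration.integral_diff integrable_mult_L2 fm gm bm)
    also have "\<dots> = 0"
      using c[of "- k"] L2_limit_coeff[OF gm(1) g(2,3) gm(2), of "- k"] by simp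
    finally show "(LINT x|torus_measure. (f x - g x) * basis_fun k x) = 0" .
  qed
  then have ae: "AE x in torus_measure. (cmod (g x - fourier_psum a n x))\<^sup>2 = (cmod (f x - fourier_psum a n x))\<^sup>2" by eventually_elim simp
  have m: "(\<lambda>x. (cmod (f x - fourier_psum a n x))\<^sup>2) \<in> borel_measurable torus_measure" "(\<lambda>x. (cmod (g x - fourier_psum a n x))\<^sup>2) \<in> borel_measurable torus_measure"
    using measurable_torus_measure[OF fourier_psum_L2(1)[of a n]] fm(1) gm(1) by measurable
  show ?thesis
    using integrable_cong_AE_imp[OF g(2)[of n] m(1)] ae integral_cong_AE[OF m(2,1) ae] g(3)[of n] by (auto elim!: eventually_mono)
qed

end

section \<open>Derivatives and products of distributions\<close>

lemma distribution_of_apply: "\<phi> \<in> test_functions \<Longrightarrow> distribution_of f \<phi> = (LINT x|torus_measure. f x * \<phi> x)"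
  by (simp add: distribution_of_def LINT_torus_measure)

lemma integrable_mult_test: "integrable torus_measure f \<Longrightarrow> \<phi> \<in> test_functions \<Longrightarrow> integrable torus_measure (\<lambda>x. f x * \<phi> x)"
  by (rule integrable_torus_measure_mult_bounded[where B = "sup_norm \<phi>"])
     (auto intro!: measurable_torus_measure borel_measurable_continuous_onI test_continuous norm_le_sup_norm)

lemma distribution_of_distribution:
  assumes f: "integrable torus_measure f" shows "distribution_of f \<in> distributions"
  unfolding distributions_def
proof (intro CollectI conjI ballI allI)
  show "distribution_of f \<in> extensional test_functions" by (simp add: distribution_of_def)
  show "distribution_of f (\<lambda>x. \<phi> x + \<psi> x) = distribution_of f \<phi> + distribution_of f \<psi>"
    if "\<phi> \<in> test_functions" "\<psi> \<in> test_functions" for \<phi> \<psi>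
    using that by (simp add: distribution_of_apply test_add distrib_left integrable_mult_test[OF f])
  show "distribution_of f (\<lambda>x. c * \<phi> x) = c * distribution_of f \<phi>" if "\<phi> \<in> test_functions" for c \<phi>
    using that by (simp add: distribution_of_apply test_cmult mult.left_commute)
  show "\<exists>C m. \<forall>\<phi>\<in>test_functions. cmod (distribution_of f \<phi>) \<le> C * C_norm m \<phi>"
  proof (intro exI ballI)
    fix \<phi> assume \<phi>: "\<phi> \<in> test_functions"
    have "cmod (distribution_of f \<phi>) \<le> (LINT x|torus_measure. cmod (f x) * sup_norm \<phi>)"
      unfolding distribution_of_apply[OF \<phi>]
      by (rule Bochner_Integration.integral_norm_bound_integral)
         (auto simp: norm_mult intro!: integrable_mult_test f \<phi> mult_left_mono norm_le_sup_norm)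
    also have "\<dots> = (LINT x|torus_measure. cmod (f x)) * sup_norm \<phi>" by simp
    also have "\<dots> \<le> (LINT x|torus_measure. cmod (f x)) * C_norm 0 \<phi>"
      using sup_norm_le_C_norm[OF \<phi>, of "[]" 0] by (intro mult_left_mono) auto
    finally show "cmod (distribution_of f \<phi>) \<le> (LINT x|torus_measure. cmod (f x)) * C_norm 0 \<phi>" .
  qed
qed

lemma C_norm_partial_le:
  assumes \<phi>: "\<phi> \<in> test_functions" shows "C_norm m (partial s \<phi>) \<le> C_norm (Suc m) \<phi>"
proof -
  let ?f = "\<lambda>rs. sup_norm (foldr partial rs \<phi>)"
  have "C_norm m (partial s \<phi>) = (\<Sum>rs | length rs \<le> m. ?f (rs @ [s]))" by (simp add: C_norm_def)
  also have "\<dots> = (\<Sum>rs\<in>(\<lambda>rs. rs @ [s]) ` {rs. length rs \<le> m}. ?f rs)" by (subst sum.reindex) (auto simp: inj_on_def)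
  also have "\<dots> \<le> C_norm (Suc m) \<phi>"
    unfolding C_norm_def by (rule sum_mono2) (auto intro!: finite_multi_indices sup_norm_nonneg test_foldr_partial \<phi>)
  finally show ?thesis .
qed

lemma partial_test_lincomb:
  "\<phi> \<in> test_functions \<Longrightarrow> \<psi> \<in> test_functions \<Longrightarrow> partial s (\<lambda>x. c * \<phi> x + d * \<psi> x) = (\<lambda>x. c * partial s \<phi> x + d * partial s \<psi> x)"
  using foldr_partial_lincomb[of \<phi> \<psi> "[s]" c d] by (simp add: test_functionsD)

lemma distribution_deriv_distribution:
  assumes T: "T \<in> distributions" shows "distribution_deriv s T \<in> distributions"
  unfolding distributions_def
proof (intro CollectI conjI ballI allI)
  show "distribution_deriv s T \<in> extensional test_functions" by (simp add: distribution_deriv_def)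
  show "distribution_deriv s T (\<lambda>x. \<phi> x + \<psi> x) = distribution_deriv s T \<phi> + distribution_deriv s T \<psi>"
    if "\<phi> \<in> test_functions" "\<psi> \<in> test_functions" for \<phi> \<psi>
    using that partial_test_lincomb[of \<phi> \<psi> s 1 1] distributionD(2)[OF T, of "partial s \<phi>" "partial s \<psi>"]
    by (simp add: distribution_deriv_def test_add test_partial)
  show "distribution_deriv s T (\<lambda>x. c * \<phi> x) = c * distribution_deriv s T \<phi>" if "\<phi> \<in> test_functions" for c \<phi>
    using that partial_test_lincomb[of \<phi> \<phi> s c 0] distributionD(3)[OF T, of "partial s \<phi>" c]
    by (simp add: distribution_deriv_def test_cmult test_partial)
  obtain C m where C: "\<And>\<phi>. \<phi> \<in> test_functions \<Longrightarrow> cmod (T \<phi>) \<le> C * C_norm m \<phi>" using distributionD(4)[OF T] by blast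
  show "\<exists>C m. \<forall>\<phi>\<in>test_functions. cmod (distribution_deriv s T \<phi>) \<le> C * C_norm m \<phi>"
  proof (intro exI ballI)
    fix \<phi> assume \<phi>: "\<phi> \<in> test_functions"
    have "cmod (distribution_deriv s T \<phi>) \<le> C * C_norm m (partial s \<phi>)"
      using C[OF test_partial[OF \<phi>]] \<phi> by (simp add: distribution_deriv_def)
    also have "\<dots> \<le> \<bar>C\<bar> * C_norm m (partial s \<phi>)" by (intro mult_right_mono C_norm_nonneg test_partial \<phi>) simp
    also have "\<dots> \<le> \<bar>C\<bar> * C_norm (Suc m) \<phi>" by (intro mult_left_mono C_norm_partial_le \<phi>) simp
    finally show "cmod (distribution_deriv s T \<phi>) \<le> \<bar>C\<bar> * C_norm (Suc m) \<phi>" .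
  qed
qed

lemma distribution_deriv_basis_fun:
  assumes "T \<in> distributions"
  shows "distribution_deriv s T (basis_fun (- k)) = \<i> * of_int (k $ s) * T (basis_fun (- k))"
  unfolding distribution_deriv_def using distributionD(3)[OF assms basis_fun_test, of "- \<i> * of_int (k $ s)" "- k"]
  by (simp add: basis_fun_test partial_basis_fun)

lemma L2_representative_props:
  assumes T: "T \<in> distributions" and s: "(\<lambda>k. (cmod (T (basis_fun (- k))))\<^sup>2) summable_on UNIV"
  shows "square_integrable (L2_representative T)" "distribution_of (L2_representative T) = T"
proof -
  let ?a = "\<lambda>k. T (basis_fun (- k))"
  obtain f where f: "square_integrable f" "\<And>n. integrable torus_measure (\<lambda>x. (cmod (f x - fourier_psum ?a n x))\<^sup>2)"
    "\<And>n. (LINT x|torus_measure. (cmod (f x - fourier_psum ?a n x))\<^sup>2) \<le> l2tail ?a n" using riesz_fischer[OF s] by blast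
  note fm = square_integrable_torus_measure[OF f(1)]
  have "distribution_of f = T"
  proof (rule distribution_eqI[OF distribution_of_distribution[OF integrable_L2_L1[OF fm]] T])
    fix k
    show "distribution_of f (basis_fun k) = T (basis_fun k)"
      unfolding distribution_of_apply[OF basis_fun_test] using L2_limit_coeff[OF s fm(1) f(2,3) fm(2), of "- k"] by simp
  qed
  then have "\<exists>f. square_integrable f \<and> distribution_of f = T" using f(1) by blast
  from someI_ex[OF this] show "square_integrable (L2_representative T)" "distribution_of (L2_representative T) = T"
    unfolding L2_representative_def by blast+
qed

text \<open>The factor \<open>T\<close> is replaced by its partial sums, which converge in \<open>L\<^sup>2\<close>; a basis function times the
representative of \<open>S\<close> has shifted coefficients.\<close>

lemma distribution_mult_coeff:
  assumes S: "S \<in> distributions" "(\<lambda>k. (cmod (S (basis_fun (- k))))\<^sup>2) summable_on UNIV"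
    and T: "T \<in> distributions" "(\<lambda>k. (cmod (T (basis_fun (- k))))\<^sup>2) summable_on UNIV"
  shows "(\<lambda>n. \<Sum>l\<in>freq_ball n. T (basis_fun (- l)) * (complex_of_real ((2 * pi) powr (- 3 / 2)) * S (basis_fun (- (k - l)))))
    \<longlonglongrightarrow> distribution_mult S T (basis_fun (- k))"
proof -
  let ?f = "L2_representative T" and ?g = "L2_representative S" and ?e = "basis_fun (- k)"
  note fr = L2_representative_props[OF T] and gr = L2_representative_props[OF S]
  note fm = square_integrable_torus_measure[OF fr(1)] and gm = square_integrable_torus_measure[OF gr(1)]
  have em: "?e \<in> borel_measurable torus_measure"
    by (intro measurable_torus_measure borel_measurable_continuous_onI continuous_basis_fun)
  have cf: "(LINT x|torus_measure. ?f x * basis_fun (- l) x) = T (basis_fun (- l))" for l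
    unfolding distribution_of_apply[OF basis_fun_test, symmetric] fr(2) ..
  have cg: "(LINT x|torus_measure. ?g x * basis_fun l x) = S (basis_fun l)" for l
    unfolding distribution_of_apply[OF basis_fun_test, symmetric] gr(2) ..
  have "integrable torus_measure (\<lambda>x. (cmod (?g x))\<^sup>2 * ((2 * pi) powr (- 3 / 2))\<^sup>2)" by (intro integrable_mult_left gm)
  then have ge: "(\<lambda>x. ?g x * ?e x) \<in> borel_measurable torus_measure" "integrable torus_measure (\<lambda>x. (cmod (?g x * ?e x))\<^sup>2)"
    using gm(1) em by (simp_all add: norm_mult norm_basis_fun power_mult_distrib)
  note lim = square_integrable_L2_limit[OF T(2) fr(1) cf]
  have "(\<lambda>n. \<Sum>l\<in>freq_ball n. T (basis_fun (- l)) * (LINT x|torus_measure. basis_fun l x * (?g x * ?e x))) \<longlonglongrightarrow> (LINT x|torus_measure. ?f x * (?g x * ?e x))"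
    by (rule L2_limit_integral[OF T(2) fm(1) _ _ fm(2) ge]) (use lim in blast)+
  moreover have "(LINT x|torus_measure. basis_fun l x * (?g x * ?e x)) = complex_of_real ((2 * pi) powr (- 3 / 2)) * S (basis_fun (- (k - l)))" for l
  proof -
    have "basis_fun l x * (?g x * ?e x) = complex_of_real ((2 * pi) powr (- 3 / 2)) * (?g x * basis_fun (- (k - l)) x)" for x
      using basis_fun_mult[of l x "- k"] by (simp add: mult_ac)
    then have "(LINT x|torus_measure. basis_fun l x * (?g x * ?e x)) = (LINT x|torus_measure. complex_of_real ((2 * pi) powr (- 3 / 2)) * (?g x * basis_fun (- (k - l)) x))"
      by (simp only:)
    also have "\<dots> = complex_of_real ((2 * pi) powr (- 3 / 2)) * (LINT x|torus_measure. ?g x * basis_fun (- (k - l)) x)" by simp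
    finally show ?thesis by (simp only: cg)
  qed
  moreover have "(LINT x|torus_measure. ?f x * (?g x * ?e x)) = distribution_mult S T (basis_fun (- k))"
    unfolding distribution_mult_def distribution_of_apply[OF basis_fun_test] by (simp add: mult_ac)
  ultimately show ?thesis by simp
qed

section \<open>Sobolev spaces and the advection term\<close>

lemma vector_fields_distributions: "v \<in> vector_fields \<Longrightarrow> v $ r \<in> distributions"
  by (simp add: vector_fields_def real_distributions_def)

lemma fourier_coeff_nth: "fourier_coeff v k $ r = (v $ r) (basis_fun (- k))"
  by (simp add: fourier_coeff_def)

text \<open>This is where the distributions being real is used.\<close>

lemma vector_fields_coeff_cnj:
  assumes "v \<in> vector_fields" shows "fourier_coeff v (- k) = cnj_vec (fourier_coeff v k)"
proof -
  have "(v $ r) (basis_fun k) = cnj ((v $ r) (basis_fun (- k)))" for r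
  proof -
    have "(v $ r) (\<lambda>x. cnj (basis_fun (- k) x)) = cnj ((v $ r) (basis_fun (- k)))"
      using assms basis_fun_test by (simp add: vector_fields_def real_distributions_def)
    then show ?thesis by (simp add: cnj_basis_fun)
  qed
  then show ?thesis by (simp add: vec_eq_iff fourier_coeff_nth cnj_vec_def)
qed

lemma vector_fields_eqI:
  assumes "v \<in> vector_fields" "w \<in> vector_fields" "\<And>k. fourier_coeff v k = fourier_coeff w k"
  shows "v = w"
proof -
  have "v $ r = w $ r" for r
  proof (rule distribution_eqI[OF vector_fields_distributions[OF assms(1)] vector_fields_distributions[OF assms(2)]])
    show "(v $ r) (basis_fun k) = (w $ r) (basis_fun k)" for k
      using assms(3)[of "- k"] by (simp add: vec_eq_iff fourier_coeff_nth)
  qed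
  then show ?thesis by (simp add: vec_eq_iff)
qed

lemma sobolev_weight: "norm (real_vec k) powr (2 * 1) * (norm (a :: complex^3))\<^sup>2 = (norm (real_vec k) * norm a)\<^sup>2"
  by (simp add: power_mult_distrib powr_numeral)

lemma sobolev_1_iff: "v \<in> sobolev 1 \<longleftrightarrow> v \<in> vector_fields \<and> fourier_coeff v 0 = 0 \<and> h1_finite (fourier_coeff v)"
proof -
  have "(\<lambda>k. (norm (real_vec k) * norm (fourier_coeff v k))\<^sup>2) summable_on (UNIV - {0}) \<longleftrightarrow> h1_finite (fourier_coeff v)"
    unfolding h1_finite_def by (rule summable_on_cong_neutral) auto
  then show ?thesis unfolding sobolev_def sobolev_weight by simp
qed

lemma sobolev_norm_1: "sobolev_norm 1 v = h1_norm (fourier_coeff v)"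
proof -
  have "(\<Sum>\<^sub>\<infinity>k\<in>UNIV - {0}. (norm (real_vec k) * norm (fourier_coeff v k))\<^sup>2) = (\<Sum>\<^sub>\<infinity>k. (norm (real_vec k) * norm (fourier_coeff v k))\<^sup>2)"
    by (rule infsum_cong_neutral) auto
  then show ?thesis unfolding sobolev_norm_def h1_norm_def sobolev_weight by simp
qed

lemma sobolev_div_free_1_iff:
  "v \<in> sobolev_div_free 1 \<longleftrightarrow> v \<in> vector_fields \<and> admissible (fourier_coeff v) \<and> h1_finite (fourier_coeff v)"
  unfolding sobolev_div_free_def sobolev_1_iff admissible_def using vector_fields_coeff_cnj by auto

lemma fourier_coeff_vf_diff: "fourier_coeff (vf_diff v w) k = fourier_coeff v k - fourier_coeff w k"
  by (simp add: fourier_coeff_def vf_diff_def vec_eq_iff basis_fun_test)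

lemma h1_finite_component_summable:
  assumes "h1_finite a" "a 0 = 0" shows "(\<lambda>k. (cmod (a k $ s))\<^sup>2) summable_on UNIV"
proof (rule summable_on_comparison_test[OF assms(1)[unfolded h1_finite_def]])
  fix k
  have "cmod (a k $ s) \<le> norm (real_vec k) * norm (a k)"
  proof (cases "k = 0")
    case False
    have "cmod (a k $ s) \<le> 1 * norm (a k)" by (simp add: component_le_norm_cart Finite_Cartesian_Product.norm_nth_le)
    also have "\<dots> \<le> norm (real_vec k) * norm (a k)" using norm_real_vec_ge_1[OF False] by (intro mult_right_mono) auto
    finally show ?thesis .
  qed (simp add: assms)
  then show "(cmod (a k $ s))\<^sup>2 \<le> (norm (real_vec k) * norm (a k))\<^sup>2" by (intro power_mono) auto
qed simp

text \<open>For each component the products of \<open>v s\<close> and \<open>\<partial> s w\<close> have limits of convolution sums over the balls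
of frequencies as coefficients. Their sum over \<open>s\<close> is the partial sum of an absolutely convergent series.\<close>

theorem fourier_coeff_advection:
  assumes v: "v \<in> vector_fields" "admissible (fourier_coeff v)" "h1_finite (fourier_coeff v)"
    and w: "w \<in> vector_fields" "admissible (fourier_coeff w)" "h1_finite (fourier_coeff w)"
  shows "fourier_coeff (advection v w) k = adv_coeff (fourier_coeff v) (fourier_coeff w) k"
proof -
  let ?a = "fourier_coeff v" and ?b = "fourier_coeff w" and ?q = "(2 * pi) powr (- 3 / 2)"
  have "fourier_coeff (advection v w) k $ r = adv_coeff ?a ?b k $ r" for r
  proof -
    have dw: "distribution_deriv s (w $ r) \<in> distributions" for s
      by (intro distribution_deriv_distribution vector_fields_distributions w)
    have wc: "distribution_deriv s (w $ r) (basis_fun (- l)) = \<i> * of_int (l $ s) * ?b l $ r" for s l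
      by (simp add: distribution_deriv_basis_fun vector_fields_distributions w fourier_coeff_nth)
    have vs: "(\<lambda>k. (cmod ((v $ s) (basis_fun (- k))))\<^sup>2) summable_on UNIV" for s
      using h1_finite_component_summable[OF v(3) admissible_0[OF v(2)], of s] by (simp add: fourier_coeff_nth)
    have ws: "(\<lambda>l. (cmod (distribution_deriv s (w $ r) (basis_fun (- l))))\<^sup>2) summable_on UNIV" for s
    proof (rule summable_on_comparison_test[OF w(3)[unfolded h1_finite_def]])
      fix l
      have "cmod (\<i> * of_int (l $ s) * ?b l $ r) = \<bar>real_vec l $ s\<bar> * cmod (?b l $ r)" by (simp add: norm_mult real_vec_def)
      also have "\<dots> \<le> norm (real_vec l) * norm (?b l)"
        by (intro mult_mono component_le_norm_cart Finite_Cartesian_Product.norm_nth_le) auto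
      finally show "(cmod (distribution_deriv s (w $ r) (basis_fun (- l))))\<^sup>2 \<le> (norm (real_vec l) * norm (?b l))\<^sup>2"
        unfolding wc by (intro power_mono) auto
    qed simp
    have "(\<lambda>n. \<Sum>s\<in>UNIV. \<Sum>l\<in>freq_ball n. (\<i> * of_int (l $ s) * ?b l $ r) * (complex_of_real ?q * ?a (k - l) $ s))
       \<longlonglongrightarrow> (\<Sum>s\<in>UNIV. distribution_mult (v $ s) (distribution_deriv s (w $ r)) (basis_fun (- k)))"
      using distribution_mult_coeff[OF vector_fields_distributions[OF v(1)] vs dw ws]
      by (intro tendsto_sum) (simp add: wc fourier_coeff_nth)
    moreover have "(\<Sum>s\<in>UNIV. \<Sum>l\<in>freq_ball n. (\<i> * of_int (l $ s) * ?b l $ r) * (complex_of_real ?q * ?a (k - l) $ s))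
        = (?q *\<^sub>R (\<Sum>l\<in>freq_ball n. adv_term ?a ?b k l)) $ r" for n
    proof -
      have "(\<Sum>s\<in>UNIV. \<Sum>l\<in>freq_ball n. (\<i> * of_int (l $ s) * ?b l $ r) * (complex_of_real ?q * ?a (k - l) $ s))
         = (\<Sum>l\<in>freq_ball n. \<Sum>s\<in>UNIV. (\<i> * of_int (l $ s) * ?b l $ r) * (complex_of_real ?q * ?a (k - l) $ s))"
        by (rule sum.swap)
      also have "\<dots> = (\<Sum>l\<in>freq_ball n. complex_of_real ?q * adv_term ?a ?b k l $ r)"
        by (intro sum.cong refl) (simp add: adv_term_def cdot_def complex_vec_def sum_distrib_left sum_distrib_right mult_ac)
      also have "\<dots> = (?q *\<^sub>R (\<Sum>l\<in>freq_ball n. adv_term ?a ?b k l)) $ r"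
        by (simp add: sum_distrib_left scaleR_conv_of_real[where 'a = complex])
      finally show ?thesis .
    qed
    moreover have "(\<lambda>n. (?q *\<^sub>R (\<Sum>l\<in>freq_ball n. adv_term ?a ?b k l)) $ r) \<longlonglongrightarrow> adv_coeff ?a ?b k $ r"
      unfolding adv_coeff_def
      by (intro tendsto_vec_nth tendsto_scaleR tendsto_const has_sum_freq_ball has_sum_infsum
          adv_term_summable[OF h1_le_h1_norm[OF v(3)] admissible_0[OF v(2)] h1_le_h1_norm[OF w(3)]])
    ultimately have "(\<Sum>s\<in>UNIV. distribution_mult (v $ s) (distribution_deriv s (w $ r)) (basis_fun (- k))) = adv_coeff ?a ?b k $ r"
      using LIMSEQ_unique by simp
    then show ?thesis by (simp add: fourier_coeff_nth advection_def basis_fun_test)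
  qed
  then show ?thesis by (simp add: vec_eq_iff)
qed

section \<open>Fourier series as vector fields\<close>

lemma fourier_series_apply:
  assumes "\<phi> \<in> test_functions"
  shows "(fourier_series c $ r) \<phi> = (\<Sum>\<^sub>\<infinity>k. c k $ r * fhat \<phi> (- k))"
  using assms by (simp add: fourier_series_def distribution_of_basis_fun)

lemma fourier_coeff_fourier_series: "fourier_coeff (fourier_series c) k = c k"
proof -
  have "(fourier_series c $ r) (basis_fun (- k)) = c k $ r" for r
  proof -
    have "(\<Sum>\<^sub>\<infinity>j. c j $ r * fhat (basis_fun (- k)) (- j)) = (\<Sum>\<^sub>\<infinity>j\<in>{k}. c j $ r * fhat (basis_fun (- k)) (- j))"
      by (rule infsum_cong_neutral) (auto simp: fhat_basis_fun)
    then show ?thesis by (simp add: fourier_series_apply basis_fun_test fhat_basis_fun)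
  qed
  then show ?thesis by (simp add: vec_eq_iff fourier_coeff_nth)
qed

lemma summable_on_uminus_index:
  fixes f :: "int^3 \<Rightarrow> 'b :: {topological_comm_monoid_add, t2_space}"
  shows "(\<lambda>k. f (- k)) summable_on UNIV \<longleftrightarrow> f summable_on UNIV" "(\<Sum>\<^sub>\<infinity>k. f (- k)) = (\<Sum>\<^sub>\<infinity>k. f k)"
proof -
  have b: "bij_betw uminus (UNIV :: (int^3) set) UNIV" by (rule bij_betw_byWitness[where f' = uminus]) auto
  show "(\<lambda>k. f (- k)) summable_on UNIV \<longleftrightarrow> f summable_on UNIV" by (rule summable_on_reindex_bij_betw[OF b])
  show "(\<Sum>\<^sub>\<infinity>k. f (- k)) = (\<Sum>\<^sub>\<infinity>k. f k)" by (rule infsum_reindex_bij_betw[OF b])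
qed

lemma series_majorant_summable:
  assumes \<phi>: "\<phi> \<in> test_functions" shows "(\<lambda>k. M * cmod (fhat \<phi> (- k))) summable_on UNIV"
  using summable_on_uminus_index(1)[of "\<lambda>k. cmod (fhat \<phi> k)"] fhat_abs_summable[OF \<phi>]
  by (intro summable_on_cmult_right) simp

lemma series_term_le:
  assumes "norm (c :: complex^3) \<le> M" shows "cmod (c $ r * z) \<le> M * cmod z"
  using assms order_trans[OF Finite_Cartesian_Product.norm_nth_le assms] by (simp add: norm_mult mult_right_mono)

lemma series_abs_summable:
  assumes c: "\<And>k. norm (c k :: complex^3) \<le> M" and \<phi>: "\<phi> \<in> test_functions"
  shows "(\<lambda>k. cmod (c k $ r * fhat \<phi> (- k))) summable_on UNIV"
  by (rule Infinite_Sum.abs_summable_on_comparison_test'[OF series_majorant_summable[OF \<phi>, of M]]) (rule series_term_le[OF c])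

lemma series_summable:
  assumes c: "\<And>k. norm (c k :: complex^3) \<le> M" and \<phi>: "\<phi> \<in> test_functions"
  shows "(\<lambda>k. c k $ r * fhat \<phi> (- k)) summable_on UNIV"
  by (rule abs_summable_summable[OF series_abs_summable[OF c \<phi>]])

lemma fhat_add: "\<phi> \<in> test_functions \<Longrightarrow> \<psi> \<in> test_functions \<Longrightarrow> fhat (\<lambda>x. \<phi> x + \<psi> x) k = fhat \<phi> k + fhat \<psi> k"
  using distributionD(2)[OF distribution_of_distribution[OF continuous_integrable_torus_measure[OF continuous_basis_fun[of UNIV "- k"]]], of \<phi> \<psi>]
  by (simp add: distribution_of_basis_fun test_add)

lemma fhat_cmult: "\<phi> \<in> test_functions \<Longrightarrow> fhat (\<lambda>x. c * \<phi> x) k = c * fhat \<phi> k"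
  by (simp add: fhat_def mult.assoc)

lemma fhat_cnj: "fhat (\<lambda>x. cnj (\<phi> x)) k = cnj (fhat \<phi> (- k))"
proof -
  have "cnj (\<phi> x) * basis_fun (- k) x = cnj (\<phi> x * basis_fun k x)" for x by (simp add: cnj_basis_fun)
  then show ?thesis unfolding fhat_def by (simp only: Bochner_Integration.integral_cnj minus_minus)
qed

lemma test_cnj:
  assumes "\<phi> \<in> test_functions" shows "(\<lambda>x. cnj (\<phi> x)) \<in> test_functions"
proof -
  have s: "smooth \<phi>" using assms by (rule test_functionsD)
  have d: "((\<lambda>x. cnj (f x)) has_derivative (\<lambda>h. cnj (frechet_derivative f (at x) h))) (at x)" if "f differentiable (at x)" for f :: "real^3 \<Rightarrow> complex" and x
    by (rule bounded_linear.has_derivative[OF bounded_linear_cnj differentiable_partial[OF that]])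
  have fp: "foldr partial rs (\<lambda>x. cnj (\<phi> x)) = (\<lambda>x. cnj (foldr partial rs \<phi> x))" for rs
  proof (induction rs)
    case (Cons r rs)
    have "partial r (\<lambda>x. cnj (foldr partial rs \<phi> x)) x = cnj (partial r (foldr partial rs \<phi>) x)" for x
      using has_derivative_imp_partial[OF d[OF smoothD[OF s]]] by (simp add: partial_def)
    then show ?case by (simp only: foldr_Cons o_apply Cons.IH)
  qed simp
  have "smooth (\<lambda>x. cnj (\<phi> x))"
    unfolding smooth_def fp by (intro allI, rule differentiableI, rule d[OF smoothD[OF s]])
  then show ?thesis using test_functionsD(2)[OF assms] by (simp add: test_functions_def periodic_def)
qed

text \<open>Bounded coefficients are enough, since the coefficients of test functions are absolutely summable with a
bound by \<open>C_norm 6\<close>.\<close>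

theorem fourier_series_vector_field:
  assumes c: "\<And>k. norm (c k :: complex^3) \<le> M" and re: "\<And>k. c (- k) = cnj_vec (c k)"
  shows "fourier_series c \<in> vector_fields"
  unfolding vector_fields_def real_distributions_def distributions_def
proof (intro CollectI allI conjI ballI)
  fix r
  show "fourier_series c $ r \<in> extensional test_functions" by (simp add: fourier_series_def)
  show "(fourier_series c $ r) (\<lambda>x. \<phi> x + \<psi> x) = (fourier_series c $ r) \<phi> + (fourier_series c $ r) \<psi>"
    if "\<phi> \<in> test_functions" "\<psi> \<in> test_functions" for \<phi> \<psi>
    using that by (simp add: fourier_series_apply test_add fhat_add distrib_left infsum_add series_summable[OF c])
  show "(fourier_series c $ r) (\<lambda>x. z * \<phi> x) = z * (fourier_series c $ r) \<phi>" if "\<phi> \<in> test_functions" for z \<phi>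
    using that by (simp add: fourier_series_apply test_cmult fhat_cmult mult.left_commute[of _ z] infsum_cmult_right')
  have M: "M \<ge> 0" using c norm_ge_zero order_trans by blast
  obtain K where K: "K \<ge> 0" "\<And>\<phi>. \<phi> \<in> test_functions \<Longrightarrow> (\<Sum>\<^sub>\<infinity>k. cmod (fhat \<phi> k)) \<le> K * C_norm 6 \<phi>"
    using fhat_infsum_le by blast
  show "\<exists>C m. \<forall>\<phi>\<in>test_functions. cmod ((fourier_series c $ r) \<phi>) \<le> C * C_norm m \<phi>"
  proof (intro exI ballI)
    fix \<phi> assume \<phi>: "\<phi> \<in> test_functions"
    have "cmod ((fourier_series c $ r) \<phi>) \<le> (\<Sum>\<^sub>\<infinity>k. cmod (c k $ r * fhat \<phi> (- k)))"
      unfolding fourier_series_apply[OF \<phi>] by (rule norm_infsum_bound[OF series_abs_summable[OF c \<phi>]])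
    also have "\<dots> \<le> (\<Sum>\<^sub>\<infinity>k. M * cmod (fhat \<phi> (- k)))"
      by (rule infsum_mono[OF series_abs_summable[OF c \<phi>] series_majorant_summable[OF \<phi>] series_term_le[OF c]])
    also have "\<dots> = M * (\<Sum>\<^sub>\<infinity>k. cmod (fhat \<phi> (- k)))" by (rule infsum_cmult_right')
    also have "(\<Sum>\<^sub>\<infinity>k. cmod (fhat \<phi> (- k))) = (\<Sum>\<^sub>\<infinity>k. cmod (fhat \<phi> k))" by (rule summable_on_uminus_index(2))
    also have "M * \<dots> \<le> M * (K * C_norm 6 \<phi>)" by (intro mult_left_mono K M \<phi>)
    finally show "cmod ((fourier_series c $ r) \<phi>) \<le> M * K * C_norm 6 \<phi>" by (simp add: mult.assoc)
  qed
  show "(fourier_series c $ r) (\<lambda>x. cnj (\<phi> x)) = cnj ((fourier_series c $ r) \<phi>)" if \<phi>: "\<phi> \<in> test_functions" for \<phi>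
  proof -
    have "c k $ r * cnj (fhat \<phi> k) = cnj (c (- k) $ r * fhat \<phi> (- (- k)))" for k
      by (simp add: re cnj_vec_def)
    then have "(fourier_series c $ r) (\<lambda>x. cnj (\<phi> x)) = (\<Sum>\<^sub>\<infinity>k. cnj (c (- k) $ r * fhat \<phi> (- (- k))))"
      by (simp only: fourier_series_apply[OF test_cnj[OF \<phi>]] fhat_cnj minus_minus)
    also have "\<dots> = (\<Sum>\<^sub>\<infinity>k. cnj (c k $ r * fhat \<phi> (- k)))"
      by (rule summable_on_uminus_index(2)[of "\<lambda>k. cnj (c k $ r * fhat \<phi> (- k))"])
    also have "\<dots> = cnj ((fourier_series c $ r) \<phi>)"
      unfolding fourier_series_apply[OF \<phi>] by (rule infsum_cnj)
    finally show ?thesis .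
  qed
qed

section \<open>Mild solutions in terms of coefficients\<close>

lemma time_domain_iff: "t \<in> time_domain T \<longleftrightarrow> 0 \<le> t \<and> ereal t < T"
  by (simp add: time_domain_def)

lemma fourier_coeff_heat: "fourier_coeff (heat t v) = heat_flow (fourier_coeff v) t"
  by (rule ext) (simp add: heat_def fourier_coeff_fourier_series heat_flow_def)

lemma heat_leray_advection_coeff:
  assumes "v \<in> sobolev_div_free 1"
  shows "heat t (leray (advection v v)) = fourier_series (heat_flow (bilin (fourier_coeff v) (fourier_coeff v)) t)"
proof -
  have "fourier_coeff (leray (advection v v)) = bilin (fourier_coeff v) (fourier_coeff v)"
    using assms
    by (intro ext) (simp add: leray_def fourier_coeff_fourier_series fourier_coeff_advection sobolev_div_free_1_iff bilin_def)
  then show ?thesis by (simp add: heat_def heat_flow_def[abs_def])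
qed

lemma mild_solution_curve:
  assumes m: "mild_solution u0 T u" and t1: "0 \<le> t1" "ereal t1 < T"
  shows "curve (\<lambda>t. fourier_coeff (u t)) {0..t1}"
  unfolding curve_def
proof (intro conjI ballI)
  have sub: "{0..t1} \<subseteq> time_domain T"
  proof
    fix t assume t: "t \<in> {0..t1}"
    then have "ereal t \<le> ereal t1" by simp
    then have "ereal t < T" using t1(2) by (rule le_less_trans)
    then show "t \<in> time_domain T" using t by (simp add: time_domain_iff)
  qed
  have mem: "u t \<in> sobolev_div_free 1" if "t \<in> time_domain T" for t using m that by (simp add: mild_solution_def)
  show "admissible (fourier_coeff (u t))" "h1_finite (fourier_coeff (u t))" if "t \<in> {0..t1}" for t
    using mem[OF subsetD[OF sub that]] by (simp_all add: sobolev_div_free_1_iff)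
  have "h1_cont (\<lambda>t. fourier_coeff (u t)) (time_domain T)"
    unfolding h1_cont_def
  proof (intro ballI allI impI)
    fix t e :: real assume t: "t \<in> time_domain T" and e: "e > 0"
    have "((\<lambda>t'. sobolev_norm 1 (vf_diff (u t') (u t))) \<longlongrightarrow> 0) (at t within time_domain T)"
      using m t by (simp add: mild_solution_def)
    then have "eventually (\<lambda>t'. sobolev_norm 1 (vf_diff (u t') (u t)) < e) (at t within time_domain T)"
      using e by (rule order_tendstoD(2))
    then obtain d where d: "d > 0" "\<And>t'. t' \<in> time_domain T \<Longrightarrow> t' \<noteq> t \<Longrightarrow> dist t' t < d \<Longrightarrow> sobolev_norm 1 (vf_diff (u t') (u t)) < e"
      unfolding eventually_at by blast
    show "\<exists>d>0. \<forall>t'\<in>time_domain T. \<bar>t' - t\<bar> < d \<longrightarrow> h1_le (\<lambda>k. fourier_coeff (u t') k - fourier_coeff (u t) k) e"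
    proof (intro exI[of _ d] conjI ballI impI d(1))
      fix t' assume t': "t' \<in> time_domain T" "\<bar>t' - t\<bar> < d"
      show "h1_le (\<lambda>k. fourier_coeff (u t') k - fourier_coeff (u t) k) e"
      proof (cases "t' = t")
        case True
        then show ?thesis using e by (simp add: h1_le_mono[OF h1_le_zero])
      next
        case False
        have "h1_finite (\<lambda>k. fourier_coeff (u t') k - fourier_coeff (u t) k)"
          using mem[OF t] mem[OF t'(1)] by (intro h1_finite_diff) (simp_all add: sobolev_div_free_1_iff)
        moreover have "h1_norm (\<lambda>k. fourier_coeff (u t') k - fourier_coeff (u t) k) < e"
          using d(2)[OF t'(1) False] t'(2) by (simp add: dist_real_def sobolev_norm_1 fourier_coeff_vf_diff[abs_def])
        ultimately show ?thesis by (simp add: h1_le_iff)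
      qed
    qed
  qed
  then show "h1_cont (\<lambda>t. fourier_coeff (u t)) {0..t1}" using sub by (rule h1_cont_subset)
qed

lemma integral_vec_nth:
  fixes g :: "real \<Rightarrow> complex^3"
  assumes "g integrable_on S" shows "integral S (\<lambda>s. g s $ r) = integral S g $ r"
  using integral_linear[OF assms bounded_linear_vec_nth[of r]] by (simp add: o_def)

text \<open>The integral equation is tested against the basis functions.\<close>

lemma mild_solution_duhamel:
  assumes m: "mild_solution u0 T u" and t: "0 \<le> t" "ereal t < T"
  shows "fourier_coeff (u t) k = heat_flow (fourier_coeff u0) t k - duhamel (\<lambda>t. fourier_coeff (u t)) (\<lambda>t. fourier_coeff (u t)) t k"
proof -
  let ?a = "\<lambda>t. fourier_coeff (u t)"
  have td: "t \<in> time_domain T" using t by (simp add: time_domain_iff)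
  have mem: "u s \<in> sobolev_div_free 1" if "s \<in> {0..t}" for s
  proof -
    have "ereal s < T" using that t(2) by (auto intro: le_less_trans[of "ereal s" "ereal t"])
    then show ?thesis using m that by (simp add: mild_solution_def time_domain_iff)
  qed
  have c: "curve ?a {0..t}" by (rule mild_solution_curve[OF m t])
  have "fourier_coeff (u t) k $ r = heat_flow (fourier_coeff u0) t k $ r - duhamel ?a ?a t k $ r" for r
  proof -
    let ?f = "\<lambda>s. (heat (t - s) (leray (advection (u s) (u s))) $ r) (basis_fun (- k))"
    have si: "set_integrable lborel {0..t} ?f"
      and eq: "(u t $ r) (basis_fun (- k)) = (heat t u0 $ r) (basis_fun (- k)) - (LINT s:{0..t}|lborel. ?f s)"
      using m td basis_fun_test[of "- k"] by (auto simp: mild_solution_def)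
    have "(LINT s:{0..t}|lborel. ?f s) = integral {0..t} ?f" by (rule set_borel_integral_eq_integral(2)[OF si])
    also have "\<dots> = integral {0..t} (\<lambda>s. (exp (- (t - s) * (norm (real_vec k))\<^sup>2) *\<^sub>R bilin (?a s) (?a s) k) $ r)"
    proof (rule integral_cong)
      fix s assume "s \<in> {0..t}"
      then have "?f s = fourier_coeff (fourier_series (heat_flow (bilin (?a s) (?a s)) (t - s))) k $ r"
        using mem by (simp only: heat_leray_advection_coeff fourier_coeff_nth)
      then show "?f s = (exp (- (t - s) * (norm (real_vec k))\<^sup>2) *\<^sub>R bilin (?a s) (?a s) k) $ r"
        by (simp only: fourier_coeff_fourier_series heat_flow_def)
    qed
    also have "\<dots> = duhamel ?a ?a t k $ r"
      unfolding duhamel_def by (intro integral_vec_nth integrable_continuous_interval continuous_duhamel_integrand[OF c c]) simp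
    finally have "(LINT s:{0..t}|lborel. ?f s) = duhamel ?a ?a t k $ r" .
    moreover have "(heat t u0 $ r) (basis_fun (- k)) = heat_flow (fourier_coeff u0) t k $ r"
      unfolding fourier_coeff_heat[symmetric] fourier_coeff_nth ..
    ultimately show ?thesis using eq by (simp add: fourier_coeff_nth)
  qed
  then show ?thesis by (simp add: vec_eq_iff)
qed

lemma fourier_series_curve:
  assumes "admissible a" "h1_finite a" shows "fourier_series a \<in> vector_fields"
  using assms by (intro fourier_series_vector_field[of a "h1_norm a"] h1_le_component' h1_le_h1_norm) (auto simp: admissible_def)

text \<open>For a test function \<open>\<phi>\<close> the integrand is a series in \<open>k\<close> with terms bounded by a constant times
\<open>|fhat \<phi> (- k)|\<close>. It converges uniformly in \<open>s\<close>, so the integrand is continuous and the sum can be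
interchanged with the time integral.\<close>

lemma coeff_solution_mild:
  assumes u0: "u0 \<in> sobolev_div_free 1"
    and a: "\<And>T. T \<ge> 0 \<Longrightarrow> curve a {0..T}"
    and eq: "\<And>t k. t \<ge> 0 \<Longrightarrow> a t k = heat_flow (fourier_coeff u0) t k - duhamel a a t k"
  shows "mild_solution u0 \<infinity> (\<lambda>t. fourier_series (a t))"
proof -
  have td: "time_domain \<infinity> = {0..}" by (auto simp: time_domain_def)
  have at: "admissible (a t)" "h1_finite (a t)" if "t \<ge> 0" for t using a[OF that] that by (auto simp: curve_def)
  have mem: "fourier_series (a t) \<in> sobolev_div_free 1" if "t \<ge> 0" for t
    unfolding sobolev_div_free_1_iff
    using at[OF that] fourier_series_curve[OF at[OF that]] by (simp add: fourier_coeff_fourier_series[abs_def])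
  have hc: "h1_cont a {0..}"
  proof (rule h1_cont_atLeast)
    fix T :: real
    show "h1_cont a {0..T}"
      using a[of T] by (cases "T \<ge> 0") (auto simp: curve_def h1_cont_def)
  qed
  have cont: "((\<lambda>t'. sobolev_norm 1 (vf_diff (fourier_series (a t')) (fourier_series (a t)))) \<longlongrightarrow> 0) (at t within {0..})" if t: "t \<in> {0..}" for t
    unfolding sobolev_norm_1 fourier_coeff_vf_diff[abs_def] fourier_coeff_fourier_series
  proof (rule tendstoI)
    fix e :: real assume e: "e > 0"
    then have e2: "e / 2 > 0" by simp
    obtain d where d: "d > 0" "\<And>t'. t' \<in> {0..} \<Longrightarrow> \<bar>t' - t\<bar> < d \<Longrightarrow> h1_le (\<lambda>k. a t' k - a t k) (e / 2)"
      using h1_contE[OF hc t e2] by blast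
    show "eventually (\<lambda>t'. dist (h1_norm (\<lambda>k. a t' k - a t k)) 0 < e) (at t within {0..})"
      unfolding eventually_at
    proof (intro exI[of _ d] conjI ballI impI d(1))
      fix t' assume "t' \<in> {0..}" "t' \<noteq> t \<and> dist t' t < d"
      then have "h1_le (\<lambda>k. a t' k - a t k) (e / 2)" by (intro d(2)) (auto simp: dist_real_def)
      then show "dist (h1_norm (\<lambda>k. a t' k - a t k)) 0 < e" using e h1_norm_nonneg[of "\<lambda>k. a t' k - a t k"] by (simp add: h1_le_iff dist_real_def)
    qed
  qed
  have integral_eq: "set_integrable lborel {0..t} (\<lambda>s. (heat (t - s) (leray (advection (fourier_series (a s)) (fourier_series (a s)))) $ r) \<phi>) \<and>
        (fourier_series (a t) $ r) \<phi> = (heat t u0 $ r) \<phi>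
          - (LINT s:{0..t}|lborel. (heat (t - s) (leray (advection (fourier_series (a s)) (fourier_series (a s)))) $ r) \<phi>)"
    (is "set_integrable lborel {0..t} ?h \<and> _") if t: "t \<ge> 0" and \<phi>: "\<phi> \<in> test_functions" for t r \<phi>
  proof -
    have ca: "curve a {0..t}" by (rule a[OF t])
    obtain M where M: "M > 0" "\<And>s. s \<in> {0..t} \<Longrightarrow> h1_le (a s) M" by (rule curve_bounded[OF ca]) blast
    let ?g = "\<lambda>s k. exp (- (t - s) * (norm (real_vec k))\<^sup>2) *\<^sub>R bilin (a s) (a s) k"
    let ?f = "\<lambda>s k. ?g s k $ r * fhat \<phi> (- k)"
    have g_le: "norm (?g s k) \<le> M * M" if s: "s \<in> {0..t}" for s k
    proof -
      have "0 \<le> (t - s) * (norm (real_vec k))\<^sup>2" using s by simp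
      then have "exp (- (t - s) * (norm (real_vec k))\<^sup>2) \<le> 1" by (simp only: exp_le_one_iff mult_minus_left neg_le_0_iff_le)
      moreover have "norm (bilin (a s) (a s) k) \<le> M * M"
        using s at(1)[of s] by (intro norm_bilin_le M) (auto simp: admissible_0)
      ultimately have "exp (- (t - s) * (norm (real_vec k))\<^sup>2) * norm (bilin (a s) (a s) k) \<le> 1 * (M * M)"
        by (intro mult_mono) auto
      then show ?thesis by simp
    qed
    have h: "?h s = (\<Sum>\<^sub>\<infinity>k. ?f s k)" if s: "s \<in> {0..t}" for s
    proof -
      have "?h s = (fourier_series (heat_flow (bilin (a s) (a s)) (t - s)) $ r) \<phi>"
        using heat_leray_advection_coeff[OF mem, of s "t - s"] s by (simp add: fourier_coeff_fourier_series[abs_def])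
      then show ?thesis by (simp only: fourier_series_apply[OF \<phi>] heat_flow_def)
    qed
    have gc: "continuous_on {0..t} (\<lambda>s. ?g s k)" for k by (rule continuous_duhamel_integrand[OF ca ca order_refl])
    have fc: "continuous_on {0..t} (\<lambda>s. \<Sum>k\<in>F. ?f s k)" for F by (intro continuous_on_sum continuous_on_mult continuous_on_const bounded_linear.continuous_on[OF bounded_linear_vec_nth] gc)
    have ul: "uniform_limit {0..t} (\<lambda>F s. \<Sum>k\<in>F. ?f s k) (\<lambda>s. \<Sum>\<^sub>\<infinity>k. ?f s k) (finite_subsets_at_top UNIV)"
      by (rule Weierstrass_m_test_general[OF _ series_majorant_summable[OF \<phi>, of "M * M"]]) (rule series_term_le[OF g_le])
    have sc: "continuous_on {0..t} (\<lambda>s. \<Sum>\<^sub>\<infinity>k. ?f s k)"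
      by (rule uniform_limit_theorem[OF always_eventually ul]) (rule allI, rule fc, simp)
    then have hcont: "continuous_on {0..t} ?h" by (rule continuous_on_eq) (rule h[symmetric])
    have si: "set_integrable lborel {0..t} ?h"
      unfolding set_integrable_def by (rule borel_integrable_compact[OF compact_Icc hcont])
    obtain I J where IJ: "\<And>F. ((\<lambda>s. \<Sum>k\<in>F. ?f s k) has_integral I F) {0..t}"
        "((\<lambda>s. \<Sum>\<^sub>\<infinity>k. ?f s k) has_integral J) {0..t}" "(I \<longlongrightarrow> J) (finite_subsets_at_top UNIV)"
      by (rule uniform_limit_integral[OF ul fc]) (auto intro: that)
    have I: "I F = (\<Sum>k\<in>F. duhamel a a t k $ r * fhat \<phi> (- k))" for F
    proof -
      have gi: "(\<lambda>s. ?g s k) integrable_on {0..t}" for k by (rule integrable_continuous_interval[OF gc])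
      have "((\<lambda>s. ?f s k) has_integral duhamel a a t k $ r * fhat \<phi> (- k)) {0..t}" for k
      proof (rule has_integral_mult_left)
        show "((\<lambda>s. ?g s k $ r) has_integral duhamel a a t k $ r) {0..t}"
          using has_integral_linear[OF integrable_integral[OF gi] bounded_linear_vec_nth[of r]] by (simp add: o_def duhamel_def)
      qed
      then have "((\<lambda>s. \<Sum>k\<in>F. ?f s k) has_integral (\<Sum>k\<in>F. duhamel a a t k $ r * fhat \<phi> (- k))) {0..t}" if "finite F"
        using that by (intro has_integral_sum)
      moreover have "((\<lambda>s. \<Sum>k\<in>F. ?f s k) has_integral (\<Sum>k\<in>F. duhamel a a t k $ r * fhat \<phi> (- k))) {0..t}" if "infinite F"
        using that by simp
      ultimately have "((\<lambda>s. \<Sum>k\<in>F. ?f s k) has_integral (\<Sum>k\<in>F. duhamel a a t k $ r * fhat \<phi> (- k))) {0..t}" by blast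
      then show ?thesis using IJ(1) has_integral_unique by blast
    qed
    have J: "((\<lambda>k. duhamel a a t k $ r * fhat \<phi> (- k)) has_sum J) UNIV" using IJ(3) unfolding I[abs_def] has_sum_def .
    have LJ: "(LINT s:{0..t}|lborel. ?h s) = J"
    proof -
      have "(LINT s:{0..t}|lborel. ?h s) = integral {0..t} ?h" by (rule set_borel_integral_eq_integral(2)[OF si])
      also have "\<dots> = integral {0..t} (\<lambda>s. \<Sum>\<^sub>\<infinity>k. ?f s k)" by (rule integral_cong) (rule h)
      also have "\<dots> = J" by (rule integral_unique[OF IJ(2)])
      finally show ?thesis .
    qed
    have ch: "curve (heat_flow (fourier_coeff u0)) {0..t}" using u0 by (intro curve_heat_flow) (auto simp: sobolev_div_free_1_iff)
    have hb: "norm (heat_flow (fourier_coeff u0) t k) \<le> h1_norm (heat_flow (fourier_coeff u0) t)" for k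
      using ch t by (intro h1_le_component' h1_le_h1_norm) (auto simp: curve_def admissible_0)
    have H: "((\<lambda>k. heat_flow (fourier_coeff u0) t k $ r * fhat \<phi> (- k)) has_sum (heat t u0 $ r) \<phi>) UNIV"
    proof -
      have "(heat t u0 $ r) \<phi> = (\<Sum>\<^sub>\<infinity>k. heat_flow (fourier_coeff u0) t k $ r * fhat \<phi> (- k))"
        unfolding heat_def fourier_series_apply[OF \<phi>] heat_flow_def ..
      then show ?thesis using has_sum_infsum[OF series_summable[OF hb \<phi>]] by simp
    qed
    have "((\<lambda>k. heat_flow (fourier_coeff u0) t k $ r * fhat \<phi> (- k) + - (duhamel a a t k $ r * fhat \<phi> (- k))) has_sum ((heat t u0 $ r) \<phi> + - J)) UNIV"
      by (rule has_sum_add[OF H]) (simp add: has_sum_uminus J)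
    moreover have "heat_flow (fourier_coeff u0) t k $ r * fhat \<phi> (- k) + - (duhamel a a t k $ r * fhat \<phi> (- k)) = a t k $ r * fhat \<phi> (- k)" for k
      by (simp add: eq[OF t] left_diff_distrib)
    ultimately have "((\<lambda>k. a t k $ r * fhat \<phi> (- k)) has_sum ((heat t u0 $ r) \<phi> - J)) UNIV" by simp
    then have "(fourier_series (a t) $ r) \<phi> = (heat t u0 $ r) \<phi> - J"
      unfolding fourier_series_apply[OF \<phi>] by (rule infsumI)
    then show ?thesis using si LJ by simp
  qed
  show ?thesis
    unfolding mild_solution_def td using mem cont integral_eq by auto
qed

section \<open>The amplification function and the theorem\<close>

text \<open>This form has no singularity at \<open>0\<close> and shows monotonicity and the bounds at once.\<close>

lemma chi_fun_eq:
  assumes "z \<in> {0..1}" shows "chi_fun z = 2 / (1 + sqrt (1 - z))"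
proof (cases "z = 0")
  case False
  define s where "s = sqrt (1 - z)"
  have s: "s\<^sup>2 = 1 - z" "s \<ge> 0" using assms by (auto simp: s_def)
  have z: "z = (1 - s) * (1 + s)" using s by (simp add: power2_eq_square algebra_simps)
  have "1 - s \<noteq> 0" using z False by auto
  then have "(1 - s) / ((1 - s) * (1 + s) / 2) = 2 / (1 + s)"
    unfolding divide_divide_eq_right by (rule mult_divide_mult_cancel_left)
  then show ?thesis using False unfolding chi_fun_def s_def[symmetric] z[symmetric] by simp
qed (simp add: chi_fun_def)

lemma chi_fun_properties:
  "continuous_on {0..1} chi_fun" "chi_fun ` {0..1} \<subseteq> {1..2}" "strict_mono_on {0..1} chi_fun"
proof -
  have pos: "1 + sqrt (1 - z) > 0" if "z \<in> {0..1}" for z using that by (simp add: add_pos_nonneg)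
  have "continuous_on {0..1} (\<lambda>z :: real. 2 / (1 + sqrt (1 - z)))"
    using pos by (intro continuous_intros) force
  then show "continuous_on {0..1} chi_fun" by (rule continuous_on_eq) (simp only: chi_fun_eq)
  show "chi_fun ` {0..1} \<subseteq> {1..2}"
    using pos by (auto simp: chi_fun_eq pos_le_divide_eq pos_divide_le_eq)
  show "strict_mono_on {0..1} chi_fun"
  proof (rule strict_mono_onI)
    fix y z :: real assume yz: "y \<in> {0..1}" "z \<in> {0..1}" "y < z"
    then have "sqrt (1 - z) < sqrt (1 - y)" by simp
    then show "chi_fun y < chi_fun z"
      unfolding chi_fun_eq[OF yz(1)] chi_fun_eq[OF yz(2)] using pos[OF yz(1)] pos[OF yz(2)] by (intro divide_strict_left_mono) auto
  qed
qed

text \<open>On the domain of any mild solution its coefficients are those of the global one, hence so are its values,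
because vector fields are determined by their coefficients.\<close>

theorem corollary6p3:
  fixes u0 :: "functional^3"
  assumes "u0 \<in> sobolev_div_free 1"
    and "sobolev_norm 1 u0 \<le> 0.407"
  shows "(continuous_on {0..1} chi_fun \<and> chi_fun ` {0..1} \<subseteq> {1..2} \<and>
            strict_mono_on {0..1} chi_fun) \<and>
         (\<exists>T u. maximal_solution u0 T u) \<and>
         (\<forall>T u. maximal_solution u0 T u \<longrightarrow>
            T = \<infinity> \<and>
            (\<forall>t\<ge>0.
               sobolev_norm 1 (u t)
                 \<le> chi_fun (sobolev_norm 1 u0 / 0.407) * exp (- t) * sobolev_norm 1 u0 \<and>
               chi_fun (sobolev_norm 1 u0 / 0.407) * exp (- t) * sobolev_norm 1 u0
                 \<le> 2 * exp (- t) * sobolev_norm 1 u0))"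
proof -
  define N where "N = sobolev_norm 1 u0"
  have N: "0 \<le> N" "N \<le> 0.407" using assms(2) by (simp_all add: N_def sobolev_norm_1 h1_norm_nonneg)
  let ?a0 = "fourier_coeff u0"
  have a0: "admissible ?a0" "h1_le ?a0 N"
    using assms(1) by (simp_all add: sobolev_div_free_1_iff N_def sobolev_norm_1 h1_le_h1_norm)
  obtain a where a: "\<And>T. T \<ge> 0 \<Longrightarrow> curve a {0..T}" "\<And>t. t \<ge> 0 \<Longrightarrow> h1_le (a t) (N * chi_fun (N / 0.407) * exp (- t))"
    "\<And>t k. t \<ge> 0 \<Longrightarrow> a t k = heat_flow ?a0 t k - duhamel a a t k"
    using coeff_global_solution[OF a0 N(2)] by blast
  let ?U = "\<lambda>t. fourier_series (a t)"
  have U: "mild_solution u0 \<infinity> ?U" by (rule coeff_solution_mild[OF assms(1) a(1,3)])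
  then have Umax: "maximal_solution u0 \<infinity> ?U" by (simp add: maximal_solution_def)
  have agree: "fourier_coeff (u t) = a t" if u: "mild_solution u0 T u" and t: "0 \<le> t" "ereal t < T" for T u t
  proof (rule coeff_solution_unique[OF mild_solution_curve[OF u t] a(1)[OF t(1)] t(1)])
    show "fourier_coeff (u s) k = heat_flow ?a0 s k - duhamel (\<lambda>t. fourier_coeff (u t)) (\<lambda>t. fourier_coeff (u t)) s k" if "s \<in> {0..t}" for s k
      using that t(2) by (intro mild_solution_duhamel[OF u]) (auto intro: le_less_trans[of "ereal s" "ereal t"])
    show "a s k = heat_flow ?a0 s k - duhamel a a s k" if "s \<in> {0..t}" for s k using that by (intro a(3)) simp
  qed (use t in auto)
  have "T = \<infinity> \<and> (\<forall>t\<ge>0. sobolev_norm 1 (u t) \<le> chi_fun (N / 0.407) * exp (- t) * N \<and>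
      chi_fun (N / 0.407) * exp (- t) * N \<le> 2 * exp (- t) * N)" if "maximal_solution u0 T u" for T u
  proof -
    have u: "mild_solution u0 T u" and mx: "\<not> (\<exists>T' u'. T < T' \<and> mild_solution u0 T' u' \<and> (\<forall>t\<in>time_domain T. u' t = u t))"
      using that unfolding maximal_solution_def by blast+
    have same: "?U t = u t" if t: "t \<in> time_domain T" for t
    proof (rule vector_fields_eqI)
      have t': "0 \<le> t" "ereal t < T" using t by (simp_all add: time_domain_iff)
      show "?U t \<in> vector_fields" using U t' by (simp add: mild_solution_def time_domain_iff sobolev_div_free_1_iff)
      show "u t \<in> vector_fields" using u t by (simp add: mild_solution_def sobolev_div_free_1_iff)
      show "fourier_coeff (?U t) k = fourier_coeff (u t) k" for k
        unfolding agree[OF u t'] fourier_coeff_fourier_series ..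
    qed
    \<comment> \<open>Otherwise the global solution would be a proper extension.\<close>
    have T: "T = \<infinity>"
    proof (rule ccontr)
      assume "T \<noteq> \<infinity>"
      then have "T < \<infinity>" by simp
      then show False using mx U same by blast
    qed
    have "sobolev_norm 1 (u t) \<le> chi_fun (N / 0.407) * exp (- t) * N" if "t \<ge> 0" for t
    proof -
      have "sobolev_norm 1 (u t) = h1_norm (a t)" unfolding sobolev_norm_1 using agree[OF u that] T by simp
      also have "\<dots> \<le> N * chi_fun (N / 0.407) * exp (- t)" using a(2)[OF that] by (simp add: h1_le_iff)
      finally show ?thesis by (simp add: mult_ac)
    qed
    moreover have "chi_fun (N / 0.407) * exp (- t) * N \<le> 2 * exp (- t) * N" for t
    proof -
      have "N / 0.407 \<in> {0..1}" using N by simp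
      from subsetD[OF chi_fun_properties(2) imageI[OF this]] have "chi_fun (N / 0.407) \<le> 2" by simp
      then show ?thesis using N(1) by (intro mult_right_mono) auto
    qed
    ultimately show ?thesis using T by blast
  qed
  then show ?thesis using chi_fun_properties Umax unfolding N_def by blast
qed

end
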